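(* Let $0<q<p$ be coprime odd integers with $q\neq1$, and let $\mathcal{X}$ be the parabolic character variety of $S^3\setminus K(p,q)$, i.e. the (finite) set of conjugacy classes of irreducible representations $\rho:\pi_1(S^3\setminus K(p,q))\to\mathrm{SL}_2(\mathbb{C})$ sending every meridian to a non-trivial matrix of trace $2$. Then $$\sum_{\rho\in\mathcal{X}}\frac1{\tau_1(\rho)}=\pm1\qquad\text{and}\qquad\sum_{\rho\in\mathcal{X}}\frac1{\tau_2(\rho)}=0,$$ where $\tau_1,\tau_2$ are the Reidemeister torsions of $S^3\setminus K(p,q)$ in the tautological and adjoint representations, each a function on $\mathcal{X}$ defined up to one global sign (see the context).
   Context: **Knot group.** $K(p,q)$ is the two-bridge knot with parameters $(p,q)$ (its double branched cover is the lens space $L(p,q)$), $M$ is its complement in $S^3$. Put $\epsilon_k=(-1)^{\lfloor kq/p\rfloor}$ for $k\in\mathbb{Z}$. The knot group is $G=\langle u,v\mid r\rangle$, $r=wuw^{-1}v^{-1}$, $w=u^{\epsilon_1}v^{\epsilon_2}\cdots u^{\epsilon_{p-2}}v^{\epsilon_{p-1}}$, with $u,v$ meridians. **Algebra.** Define $P_k\in\mathbb{Z}[X]$ by $P_{-1}=0$, $P_0=1$, $P_k=\epsilon_kXP_{k-1}+P_{k-2}$. Let $V=\mathbb{Q}[X]/(P_{p-1})$ (a semi-simple $\mathbb{Q}$-algebra, $P_{p-1}$ being an even polynomial with simple roots); $x$ is the image of $X$. The formulas $\rho(u)=\begin{pmatrix} 1 & x \\ 0 & 1 \end{pmatrix}$,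 $\rho(v)=\begin{pmatrix} 1 & 0 \\ x & 1 \end{pmatrix}$ define a representation $\rho:G\to\mathrm{SL}_2(V)$. Substituting a complex root $X_0$ of $P_{p-1}$ for $x$ gives a point of $\mathcal{X}$; every point of $\mathcal{X}$ is obtained in this way, and two roots give the same point if and only if they have the same square. Thus the coordinate ring $\mathbb{Q}[\mathcal{X}]$ is the subalgebra $V^+\subset V$ generated by $x^2$. The torsions below lie in $V^+$ up to sign, and $\tau_n(\rho)$ is the value of $\tau_n$ at $x=X_0$. **Torsion.** $\rho_n=s_n\circ\rho$, where $s_n$ is the action of $\mathrm{SL}_2(V)$ on $\mathrm{S}^nV^2$; so $\rho_1=\rho$, and $\rho_2$ is identified with the adjoint action on $\mathrm{sl}_2(V)$, with basis $\mathfrak{e}_1=E=\begin{pmatrix} 0 & 1 \\ 0 & 0 \end{pmatrix}$, $\mathfrak{e}_2=\tfrac12\begin{pmatrix} 1 & 0 \\ 0 & -1 \end{pmatrix}$, $\mathfrak{e}_3=F=\begin{pmatrix} 0 & 0 \\ 1 & 0 \end{pmatrix}$ and invariant pairing $\langle\xi,\eta\rangle=\mathrm{Tr}(\xi\eta)$. The twisted cochain complex of $M$ is $$C^*:\ \mathrm{S}^nV^2\xrightarrow{D^0}\mathrm{S}^nV^2\oplus\mathrm{S}^nV^2\xrightarrow{D^1}\mathrm{S}^nV^2,$$ $D^0(\xi)=(\rho_n(u-1)\xi,\rho_n(v-1)\xi)$, $D^1(\xi,\eta)=\rho_n(\tfrac{\partial r}{\partial u})\xi+\rho_n(\tfrac{\partial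 r}{\partial v})\eta$ (Fox derivatives). For an acyclic complex $C^0\xrightarrow{D^0}C^1\xrightarrow{D^1}C^2\to\cdots$ of based free modules, the torsion is $\prod_i\Delta_i^{(-1)^{i+1}}$ up to sign (Cayley formula), where one chooses row sets so that $\Delta_i$ is the (invertible) maximal minor of the matrix of $D^i$ whose columns are those basis vectors of $C^i$ not used as rows for $\Delta_{i-1}$. For $n=1$ the complex $C^*$ is acyclic and $\tau_1\in V/\{\pm1\}$ is its torsion ($\tau_1=\Delta_1/\Delta_0$). For $n=2$, $H^k(M,\mathrm{S}^2V^2)$ vanishes except for $k=1,2$. Let $m$ be the meridian $u$, lying on the boundary torus $\partial M$ of the knot exterior. The restriction maps $H^1(M,\mathrm{S}^2V^2)\to H^1(m,\mathrm{S}^2V^2)$, $H^2(M,\mathrm{S}^2V^2)\to H^2(\partial M,\mathrm{S}^2V^2)$ are isomorphisms and, using Poincaré duality and the pairing, the targets are identified with $H^0(m,\mathrm{S}^2V^2)^*$ and $H^0(\partial M,\mathrm{S}^2V^2)^*$. Both $H^0$'s are free of rank one generated by $\mathfrak{e}_1$; evaluating at $\mathfrak{e}_1$ gives isomorphisms $H^1(M,\mathrm{S}^2V^2)\cong V$, induced by $f_1(\xi,\eta)=\langle\xi,\mathfrak{e}_1\rangle$ on $C^1$, and $H^2(M,\mathrm{S}^2V^2)\cong V$, induced by a linear map $f_2:C^2\to V$. Then $\tau_2\in V/\{\pm1\}$ is the torsion of the acyclic mapping cone $$\mathrm{S}^2V^2\xrightarrow{D^0}\mathrm{S}^2V^2\oplus\mathrm{S}^2V^2\xrightarrow{(D^1,f_1)}\mathrm{S}^2V^2\oplus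 V\xrightarrow{(f_2,0)}V,$$ i.e. $\tau_2=\Delta_1/(\Delta_0\Delta_2)$. *)

theory Defs
  imports
    "HOL-Algebra.Algebra"
    "HOL-Number_Theory.Cong"
    "HOL-Computational_Algebra.Polynomial_Factorial"
    "HOL-Computational_Algebra.Field_as_Ring"
    "Jordan_Normal_Form.Determinant"
    "Jordan_Normal_Form.DL_Submatrix"
begin

section \<open>Words and presented groups\<close>

datatype gen = U | V

text \<open>A letter carries \<open>True\<close> for a generator and \<open>False\<close> for its inverse.\<close>

type_synonym letter = "gen \<times> bool"
type_synonym word = "letter list"

abbreviation flip :: "letter \<Rightarrow> letter" where
  "flip a \<equiv> (fst a, \<not> snd a)"

definition winv :: "word \<Rightarrow> word" where
  "winv a = rev (map flip a)"

text \<open>Equality of words in the group presented by the generators \<^term>\<open>U\<close>, \<^term>\<open>V\<close> and the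
  relators in \<open>R\<close>; for \<open>R = {}\<close> this is equality in the free group.\<close>

inductive pres_eq :: "word set \<Rightarrow> word \<Rightarrow> word \<Rightarrow> bool" for R where
  pres_refl: "pres_eq R a a"
| pres_sym: "pres_eq R a b \<Longrightarrow> pres_eq R b a"
| pres_trans: "pres_eq R a b \<Longrightarrow> pres_eq R b c \<Longrightarrow> pres_eq R a c"
| pres_mult: "pres_eq R a a' \<Longrightarrow> pres_eq R b b' \<Longrightarrow> pres_eq R (a @ b) (a' @ b')"
| pres_cancel: "pres_eq R [l, flip l] []"
| pres_rel: "r \<in> R \<Longrightarrow> pres_eq R r []"

definition word_class :: "word set \<Rightarrow> word \<Rightarrow> word set" where
  "word_class R a = {b. pres_eq R a b}"

definition presented_group :: "word set \<Rightarrow> word set monoid" where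
  "presented_group R =
    \<lparr>carrier = UNIV // {(a, b). pres_eq R a b},
     monoid.mult = (\<lambda>A B. \<Union>a\<in>A. \<Union>b\<in>B. word_class R (a @ b)),
     one = word_class R []\<rparr>"

lemma carrier_presented_group:
  "carrier (presented_group R) = range (word_class R)"
  by (auto simp: presented_group_def quotient_def word_class_def)

lemma word_class_eq_iff: "word_class R a = word_class R b \<longleftrightarrow> pres_eq R a b"
proof
  assume "word_class R a = word_class R b"
  then show "pres_eq R a b" using pres_refl[of R b] by (auto simp: word_class_def)
next
  assume "pres_eq R a b"
  then have "pres_eq R a c \<longleftrightarrow> pres_eq R b c" for c
    using pres_trans[of R a b c] pres_trans[of R b a c] pres_sym[of R a b] by argo
  then show "word_class R a = word_class R b" by (simp add: word_class_def)
qed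

lemma mult_presented_group:
  "word_class R a \<otimes>\<^bsub>presented_group R\<^esub> word_class R b = word_class R (a @ b)"
proof -
  have *: "word_class R (a' @ b') = word_class R (a @ b)"
    if "a' \<in> word_class R a" "b' \<in> word_class R b" for a' b'
  proof -
    have "pres_eq R (a @ b) (a' @ b')"
      using that by (simp add: word_class_def pres_mult)
    then show ?thesis unfolding word_class_eq_iff by (rule pres_sym)
  qed
  have ne: "word_class R c \<noteq> {}" for c
    using pres_refl[of R c] by (auto simp: word_class_def)
  have "word_class R a \<otimes>\<^bsub>presented_group R\<^esub> word_class R b =
    (\<Union>a'\<in>word_class R a. \<Union>b'\<in>word_class R b. word_class R (a' @ b'))"
    by (simp add: presented_group_def)
  also have "\<dots> = (\<Union>a'\<in>word_class R a. \<Union>b'\<in>word_class R b. word_class R (a @ b))"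
    by (intro SUP_cong refl *)
  also have "\<dots> = word_class R (a @ b)"
    using ne[of a] ne[of b] by (simp only: UN_constant if_False)
  finally show ?thesis .
qed

lemma one_presented_group: "\<one>\<^bsub>presented_group R\<^esub> = word_class R []"
  by (simp add: presented_group_def)

lemma pres_eq_winv_left: "pres_eq R (winv a @ a) []"
proof (induction a)
  case Nil
  show ?case by (simp add: winv_def pres_refl)
next
  case (Cons l a)
  have "pres_eq R ([flip l, l]) []" using pres_cancel[of R "flip l"] by simp
  then have "pres_eq R (winv a @ [flip l, l] @ a) (winv a @ [] @ a)"
    by (intro pres_mult pres_refl)
  with Cons.IH have "pres_eq R (winv a @ [flip l, l] @ a) []"
    using pres_trans[of R "winv a @ [flip l, l] @ a" "winv a @ a"] by simp
  then show ?case by (simp add: winv_def)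
qed

lemma group_presented_group: "group (presented_group R)"
proof (rule groupI)
  fix A assume "A \<in> carrier (presented_group R)"
  then obtain a where "A = word_class R a" by (auto simp: carrier_presented_group)
  then show "\<exists>B\<in>carrier (presented_group R). B \<otimes>\<^bsub>presented_group R\<^esub> A = \<one>\<^bsub>presented_group R\<^esub>"
    by (intro bexI[of _ "word_class R (winv a)"])
      (auto simp: carrier_presented_group mult_presented_group one_presented_group
        word_class_eq_iff pres_eq_winv_left)
qed (auto simp: carrier_presented_group mult_presented_group one_presented_group)


section \<open>The two-bridge knot group\<close>

definition eps :: "nat \<Rightarrow> nat \<Rightarrow> nat \<Rightarrow> int" where
  "eps p q k = (- 1) ^ (k * q div p)"

definition wword :: "nat \<Rightarrow> nat \<Rightarrow> word" where
  "wword p q = map (\<lambda>k. (if odd k then U else V, eps p q k = 1)) [1..<p]"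

definition relator :: "nat \<Rightarrow> nat \<Rightarrow> word" where
  "relator p q = wword p q @ [(U, True)] @ winv (wword p q) @ [(V, False)]"

definition knot_group :: "nat \<Rightarrow> nat \<Rightarrow> word set monoid" where
  "knot_group p q = presented_group {relator p q}"

definition gen_elem :: "nat \<Rightarrow> nat \<Rightarrow> gen \<Rightarrow> word set" where
  "gen_elem p q g = word_class {relator p q} [(g, True)]"

text \<open>The meridians, of either orientation; \<open>v\<close> is among them since \<open>v = w u w\<inverse>\<close> in the group.\<close>

definition meridians :: "nat \<Rightarrow> nat \<Rightarrow> word set set" where
  "meridians p q =
    {g \<otimes>\<^bsub>knot_group p q\<^esub> m \<otimes>\<^bsub>knot_group p q\<^esub> inv\<^bsub>knot_group p q\<^esub> g | g m.
      g \<in> carrier (knot_group p q) \<and>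
      m \<in> {gen_elem p q U, inv\<^bsub>knot_group p q\<^esub> (gen_elem p q U)}}"


section \<open>The parabolic character variety\<close>

definition SL2 :: "complex mat monoid" where
  "SL2 = \<lparr>carrier = {A \<in> carrier_mat 2 2. det A = 1}, monoid.mult = (*), one = 1\<^sub>m 2\<rparr>"

definition mtrace :: "'a :: comm_ring_1 mat \<Rightarrow> 'a" where
  "mtrace A = (\<Sum>i<dim_row A. A $$ (i, i))"

definition irreducible_rep :: "nat \<Rightarrow> nat \<Rightarrow> (word set \<Rightarrow> complex mat) \<Rightarrow> bool" where
  "irreducible_rep p q \<rho> \<longleftrightarrow>
    \<not> (\<exists>z \<in> carrier_vec 2. z \<noteq> 0\<^sub>v 2 \<and>
         (\<forall>\<gamma> \<in> carrier (knot_group p q). \<exists>c. \<rho> \<gamma> *\<^sub>v z = c \<cdot>\<^sub>v z))"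

definition parabolic_rep :: "nat \<Rightarrow> nat \<Rightarrow> (word set \<Rightarrow> complex mat) \<Rightarrow> bool" where
  "parabolic_rep p q \<rho> \<longleftrightarrow> (\<forall>m \<in> meridians p q. \<rho> m \<noteq> 1\<^sub>m 2 \<and> mtrace (\<rho> m) = 2)"

definition par_reps :: "nat \<Rightarrow> nat \<Rightarrow> (word set \<Rightarrow> complex mat) set" where
  "par_reps p q =
    {\<rho> \<in> hom (knot_group p q) SL2. irreducible_rep p q \<rho> \<and> parabolic_rep p q \<rho>}"

text \<open>Values outside the carrier are irrelevant: homomorphisms that agree on the carrier are
  conjugate by the identity.\<close>

definition conj_rel ::
  "nat \<Rightarrow> nat \<Rightarrow> ((word set \<Rightarrow> complex mat) \<times> (word set \<Rightarrow> complex mat)) set" where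
  "conj_rel p q =
    {(\<rho>, \<rho>'). \<rho> \<in> par_reps p q \<and> \<rho>' \<in> par_reps p q \<and>
      (\<exists>g \<in> carrier SL2. \<forall>\<gamma> \<in> carrier (knot_group p q). \<rho>' \<gamma> * g = g * \<rho> \<gamma>)}"

definition par_char_variety :: "nat \<Rightarrow> nat \<Rightarrow> (word set \<Rightarrow> complex mat) set set" where
  "par_char_variety p q = par_reps p q // conj_rel p q"


section \<open>The algebra \<open>V\<close> and the representation \<open>\<rho>\<close>\<close>

fun Ppoly :: "nat \<Rightarrow> nat \<Rightarrow> nat \<Rightarrow> int poly" where
  "Ppoly p q 0 = 1"
| "Ppoly p q (Suc 0) = [:0, eps p q 1:]"
| "Ppoly p q (Suc (Suc k)) = [:0, eps p q (Suc (Suc k)):] * Ppoly p q (Suc k) + Ppoly p q k"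

text \<open>\<open>V = \<rat>[X]/(P\<^bsub>p-1\<^esub>)\<close>: elements of \<open>V\<close> are represented by rational polynomials, and equality
  in \<open>V\<close> is congruence modulo \<^term>\<open>Vmod p q\<close>.\<close>

definition Vmod :: "nat \<Rightarrow> nat \<Rightarrow> rat poly" where
  "Vmod p q = map_poly of_int (Ppoly p q (p - 1))"

definition unit_mod :: "rat poly \<Rightarrow> rat poly \<Rightarrow> bool" where
  "unit_mod P a \<longleftrightarrow> (\<exists>b. [a * b = 1] (mod P))"

fun gen_mat :: "'a :: comm_ring_1 \<Rightarrow> gen \<Rightarrow> 'a mat" where
  "gen_mat x U = mat_of_rows_list 2 [[1, x], [0, 1]]"
| "gen_mat x V = mat_of_rows_list 2 [[1, 0], [x, 1]]"

text \<open>The matrices \<^term>\<open>gen_mat x g\<close> are unipotent, so \<^term>\<open>gen_mat (- x) g\<close> is the inverse.\<close>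

definition letter_mat :: "'a :: comm_ring_1 \<Rightarrow> letter \<Rightarrow> 'a mat" where
  "letter_mat x l = gen_mat (if snd l then x else - x) (fst l)"

definition word_mat :: "'a :: comm_ring_1 \<Rightarrow> word \<Rightarrow> 'a mat" where
  "word_mat x a = foldr (\<lambda>l A. letter_mat x l * A) a (1\<^sub>m 2)"

definition rho1 :: "word \<Rightarrow> rat poly mat" where
  "rho1 = word_mat [:0, 1:]"

text \<open>The basis of \<open>sl\<^sub>2\<close>, numbered from \<open>0\<close>, and the coordinates in this basis.\<close>

definition sl2_basis :: "nat \<Rightarrow> rat poly mat" where
  "sl2_basis j = mat_of_rows_list 2
     ([[[0, 1], [0, 0]], [[[:1/2:], 0], [0, [:-1/2:]]], [[0, 0], [1, 0]]] ! j)"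

definition sl2_coord :: "rat poly mat \<Rightarrow> nat \<Rightarrow> rat poly" where
  "sl2_coord A i = [A $$ (0, 1), 2 * A $$ (0, 0), A $$ (1, 0)] ! i"

lemma sl2_basis_coord:
  assumes "A \<in> carrier_mat 2 2" "mtrace A = 0"
  shows "A = sl2_coord A 0 \<cdot>\<^sub>m sl2_basis 0 + sl2_coord A 1 \<cdot>\<^sub>m sl2_basis 1 +
    sl2_coord A 2 \<cdot>\<^sub>m sl2_basis 2"
proof -
  have tr: "A $$ (1, 1) = - A $$ (0, 0)"
    using assms by (auto simp: mtrace_def numeral_2_eq_2 eq_neg_iff_add_eq_0 add.commute)
  have half: "2 * a * [:1/2:] = a" "2 * a * [:-1/2:] = - a" for a :: "rat poly"
    by (simp_all add: numeral_poly mult.commute)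
  show ?thesis
    using assms(1) tr half
    by (intro eq_matI)
      (auto simp: sl2_coord_def sl2_basis_def mat_of_rows_list_def numeral_2_eq_2 less_Suc_eq)
qed

definition rho2 :: "word \<Rightarrow> rat poly mat" where
  "rho2 a = mat 3 3 (\<lambda>(i, j). sl2_coord (rho1 a * sl2_basis j * rho1 (winv a)) i)"


section \<open>The twisted cochain complex\<close>

text \<open>A formal sum of words with integer coefficients represents an element of the group ring of
  the free group.\<close>

type_synonym group_ring = "(int \<times> word) list"

fun fox :: "gen \<Rightarrow> word \<Rightarrow> group_ring" where
  "fox g [] = []"
| "fox g (l # a) =
    (if fst l = g then [if snd l then (1, []) else (- 1, [l])] else []) @
    map (\<lambda>(c, b). (c, l # b)) (fox g a)"

definition ring_mat :: "nat \<Rightarrow> (word \<Rightarrow> rat poly mat) \<Rightarrow> group_ring \<Rightarrow> rat poly mat" where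
  "ring_mat n rep z = foldr (\<lambda>(c, a) A. of_int c \<cdot>\<^sub>m rep a + A) z (0\<^sub>m n n)"

definition D0 :: "nat \<Rightarrow> (word \<Rightarrow> rat poly mat) \<Rightarrow> rat poly mat" where
  "D0 n rep = ring_mat n rep [(1, [(U, True)]), (- 1, [])] @\<^sub>r
    ring_mat n rep [(1, [(V, True)]), (- 1, [])]"

definition D1 :: "nat \<Rightarrow> nat \<Rightarrow> nat \<Rightarrow> (word \<Rightarrow> rat poly mat) \<Rightarrow> rat poly mat" where
  "D1 p q n rep = four_block_mat
    (ring_mat n rep (fox U (relator p q))) (ring_mat n rep (fox V (relator p q)))
    (0\<^sub>m 0 n) (0\<^sub>m 0 n)"


section \<open>Reidemeister torsion\<close>

definition minor_cols :: "rat poly mat list \<Rightarrow> nat set list \<Rightarrow> nat \<Rightarrow> nat set" where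
  "minor_cols Ds Rs i = {..<dim_col (Ds ! i)} - (if i = 0 then {} else Rs ! (i - 1))"

definition minor :: "rat poly mat list \<Rightarrow> nat set list \<Rightarrow> nat \<Rightarrow> rat poly" where
  "minor Ds Rs i = det (submatrix (Ds ! i) (Rs ! i) (minor_cols Ds Rs i))"

text \<open>\<^term>\<open>Rs ! i\<close> is the set of rows used for the minor of \<^term>\<open>Ds ! i\<close>; the last minor uses all
  the rows.\<close>

definition row_sets :: "rat poly \<Rightarrow> rat poly mat list \<Rightarrow> nat set list \<Rightarrow> bool" where
  "row_sets P Ds Rs \<longleftrightarrow> length Rs = length Ds \<and>
    (\<forall>i < length Ds. Rs ! i \<subseteq> {..<dim_row (Ds ! i)} \<and>
       card (Rs ! i) = card (minor_cols Ds Rs i) \<and> unit_mod P (minor Ds Rs i)) \<and>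
    last Rs = {..<dim_row (last Ds)}"

definition is_torsion :: "rat poly \<Rightarrow> rat poly mat list \<Rightarrow> rat poly \<Rightarrow> bool" where
  "is_torsion P Ds t \<longleftrightarrow> (\<exists>Rs s. row_sets P Ds Rs \<and> s \<in> {1, - 1} \<and>
    [t * (\<Prod>i | i < length Ds \<and> even i. minor Ds Rs i) =
     s * (\<Prod>i | i < length Ds \<and> odd i. minor Ds Rs i)] (mod P))"

text \<open>A polynomial representing the torsion in \<open>V\<close>, with an arbitrary choice of the sign.\<close>

definition torsion :: "rat poly \<Rightarrow> rat poly mat list \<Rightarrow> rat poly" where
  "torsion P Ds = (SOME t. is_torsion P Ds t)"

definition tau1 :: "nat \<Rightarrow> nat \<Rightarrow> rat poly" where
  "tau1 p q = torsion (Vmod p q) [D0 2 rho1, D1 p q 2 rho1]"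


section \<open>The peripheral torus and the adjoint torsion\<close>

text \<open>Let \<open>w'\<close> be \<open>w\<close> read backwards. The element \<open>l = w' w\<close> is represented by a curve on the
  boundary torus parallel to the knot; it differs from the preferred longitude by a power of the
  meridian \<open>u\<close>, which does not change the commutator \<open>[u, l]\<close> in the free group. The elements
  \<open>u\<close> and \<open>l\<close> generate the fundamental group of the torus.\<close>

definition longitude :: "nat \<Rightarrow> nat \<Rightarrow> word" where
  "longitude p q = rev (wword p q) @ wword p q"

definition shift :: "nat \<Rightarrow> nat \<Rightarrow> nat" where
  "shift p q = (LEAST s. even s \<and> [s * q = 1] (mod p))"

text \<open>The inclusion of the torus, with its 2-cell attached along \<open>[u, l]\<close>, into the presentation
  2-complex sends the 2-cell to \<open>\<Sum>\<^sub>i s\<^sub>i g\<^sub>i\<close> times the 2-cell of \<open>r\<close>, when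
  \<open>[u, l] = \<Prod>\<^sub>i g\<^sub>i r\<^bsup>s\<^sub>i\<^esup> g\<^sub>i\<inverse>\<close> in the free group. The chain below is such a sum, see
  the lemma \<open>torus_chain\<close>; its first coefficient comes from the fact that the relator
  \<open>w' v = u w'\<close> is a cyclic permutation of \<open>r\<close>.\<close>

definition torus_chain :: "nat \<Rightarrow> nat \<Rightarrow> group_ring" where
  "torus_chain p q =
    [(1, rev (wword p q) @ [(V, True)] @ winv (take (shift p q - 1) (relator p q))),
     (- 1, rev (wword p q))]"

definition relator_prod :: "word \<Rightarrow> group_ring \<Rightarrow> word" where
  "relator_prod r z =
    concat (map (\<lambda>(s, g). g @ (if s = 1 then r else winv r) @ winv g) z)"

lemma pres_eq_class: "pres_eq R a b \<Longrightarrow> pres_eq R (c @ a @ d) (c @ b @ d)"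
  by (intro pres_mult pres_refl)

lemma winv_append: "winv (a @ b) = winv b @ winv a"
  by (simp add: winv_def)

lemma winv_winv [simp]: "winv (winv a) = a"
  by (simp add: winv_def rev_map comp_def)

lemma pres_eq_del_left: "pres_eq R (c @ winv a @ a @ d) (c @ d)"
  using pres_eq_class[OF pres_eq_winv_left, of R c a d] by simp

lemma pres_eq_del_right: "pres_eq R (c @ a @ winv a @ d) (c @ d)"
  using pres_eq_del_left[of R c "winv a" d] by simp

lemma winv_rev: "winv (rev a) = map flip a"
  by (simp add: winv_def rev_map)

lemma length_wword [simp]: "length (wword p q) = p - 1"
  by (simp add: wword_def)

lemma length_winv [simp]: "length (winv a) = length a"
  by (simp add: winv_def)

lemma nth_winv: "i < length a \<Longrightarrow> winv a ! i = flip (a ! (length a - Suc i))"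
  by (simp add: winv_def rev_nth)

lemma eps_eq_1: "eps p q k = 1 \<longleftrightarrow> even (k * q div p)"
  by (auto simp: eps_def minus_one_power_iff)

lemma nth_wword:
  "i < p - 1 \<Longrightarrow> wword p q ! i = (if even i then U else V, even (Suc i * q div p))"
  by (simp add: wword_def eps_eq_1)

lemma div_pred:
  fixes p a :: nat
  assumes "0 < p" "\<not> p dvd a"
  shows "(a - 1) div p = a div p"
proof -
  have "0 < a mod p" using assms by (simp add: dvd_eq_mod_eq_0)
  then have *: "a - 1 = (a mod p - 1) + (a div p) * p"
    using div_mult_mod_eq[of a p] by linarith
  have "a mod p - 1 < p" using assms(1) by (simp add: less_imp_diff_less)
  then show ?thesis using assms(1) by (subst *) simp
qed

lemma div_reflect:
  fixes p a m :: nat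
  assumes "0 < p" "\<not> p dvd a" "a < m * p"
  shows "(m * p - a) div p = m - 1 - a div p" "a div p < m"
proof -
  show "a div p < m" using assms by (simp add: less_mult_imp_div_less)
  have r: "0 < a mod p" "a mod p < p" using assms by (simp_all add: dvd_eq_mod_eq_0)
  obtain d where d: "m = a div p + 1 + d"
  proof
    show "m = a div p + 1 + (m - a div p - 1)" using \<open>a div p < m\<close> by linarith
  qed
  have a: "a = a div p * p + a mod p" by simp
  have "m * p = a div p * p + p + d * p" by (simp add: d algebra_simps)
  with a r have e: "m * p - a = (p - a mod p) + d * p" by linarith
  have "p - a mod p < p" using r by simp
  then show "(m * p - a) div p = m - 1 - a div p"
    unfolding e using assms(1) by (subst div_mult_self1) (simp_all add: d)
qed

context
  fixes p q :: nat
  assumes q0: "0 < q" and qp: "q < p" and cop: "coprime p q" and op: "odd p" and oq: "odd q"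
begin

lemma p_gt_1: "1 < p"
  using q0 qp by simp

lemma ndvd: "0 < k \<Longrightarrow> k < p \<Longrightarrow> \<not> p dvd k * q"
  using coprime_dvd_mult_left_iff[OF cop] by (simp add: nat_dvd_not_less)

lemma even_eps_reflect:
  assumes "0 < k" "k < p"
  shows "even ((p - k) * q div p) \<longleftrightarrow> even (k * q div p)"
proof -
  have e: "(p - k) * q = q * p - k * q" by (simp add: algebra_simps diff_mult_distrib)
  have "k * q < q * p" using assms q0 by simp
  then have "(p - k) * q div p = q - 1 - k * q div p" "k * q div p < q"
    unfolding e using div_reflect[of p "k * q" q] ndvd[OF assms] p_gt_1 by simp_all
  then show ?thesis using oq q0 by simp
qed

lemma length_relator: "length (relator p q) = 2 * p"
  using p_gt_1 by (simp add: relator_def)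

lemma nth_relator:
  assumes "i < 2 * p"
  shows "relator p q ! i = (if even i then U else V, even ((Suc i * q - 1) div p))"
proof -
  consider "i < p - 1" | "i = p - 1" | "p \<le> i" "i < 2 * p - 1" | "i = 2 * p - 1"
    using assms by linarith
  then show ?thesis
  proof cases
    case 1
    then have "(Suc i * q - 1) div p = Suc i * q div p"
      using ndvd[of "Suc i"] p_gt_1 by (intro div_pred) simp_all
    with 1 show ?thesis by (simp add: relator_def nth_append nth_wword)
  next
    case 2
    then have i: "Suc i = p" using p_gt_1 by simp
    have "(p * q - 1) div p = q - 1"
    proof -
      have e: "p * q - 1 = (p - 1) + (q - 1) * p"
        using p_gt_1 q0 by (cases q) (auto simp: algebra_simps)
      show ?thesis unfolding e using p_gt_1 by (subst div_mult_self1) simp_all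
    qed
    with 2 i op oq q0 show ?thesis by (simp add: relator_def nth_append)
  next
    case 3
    define k where "k = 2 * p - Suc i"
    have k: "0 < k" "k < p" "Suc i = 2 * p - k" using 3 by (auto simp: k_def)
    let ?a = "wword p q @ [(U, True)]" and ?b = "winv (wword p q)"
    have h: "i = length ?a + (i - p)" "i - p < length ?b"
        "length (wword p q) - Suc (i - p) = k - 1"
      using 3 p_gt_1 by (auto simp: k_def)
    have "relator p q = ?a @ ?b @ [(V, False)]" by (simp add: relator_def)
    then have "relator p q ! i = (?b @ [(V, False)]) ! (i - p)"
      using h(1) by (metis nth_append_length_plus)
    also have "\<dots> = ?b ! (i - p)" using h(2) by (simp only: nth_append if_True)
    also have "\<dots> = flip (wword p q ! (k - 1))"
      using h(2) by (simp only: nth_winv length_winv h(3))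
    also have "\<dots> = (if odd k then U else V, odd (k * q div p))"
      using k by (simp add: nth_wword)
    finally have *: "relator p q ! i = (if odd k then U else V, odd (k * q div p))" .
    have e: "Suc i * q = (2 * q) * p - k * q"
      unfolding k(3) by (simp add: algebra_simps diff_mult_distrib)
    have "k * q < (2 * q) * p" using k q0 by simp
    then have d: "Suc i * q div p = 2 * q - 1 - k * q div p" "k * q div p < 2 * q"
      unfolding e using div_reflect[of p "k * q" "2 * q"] ndvd[OF k(1,2)] p_gt_1 by simp_all
    have "\<not> p dvd Suc i * q"
    proof
      assume "p dvd Suc i * q"
      then have "p dvd Suc i" using cop coprime_dvd_mult_left_iff by blast
      then have "p dvd 2 * p - Suc i" by (intro dvd_diff_nat) simp_all
      then have "p dvd k" by (simp only: k_def)
      then show False using k by (simp add: nat_dvd_not_less)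
    qed
    then have "(Suc i * q - 1) div p = Suc i * q div p"
      using p_gt_1 by (intro div_pred) simp_all
    moreover have "even (2 * q - 1 - k * q div p) \<longleftrightarrow> odd (k * q div p)"
      using d(2) even_diff_nat[of "2 * q - 1" "k * q div p"] q0 by simp
    moreover have "odd k \<longleftrightarrow> even i"
    proof -
      have "Suc i + k = 2 * p" using k by linarith
      then have "even (Suc i + k)" by simp
      then show ?thesis by simp
    qed
    ultimately show ?thesis using * d by simp
  next
    case 4
    then have i: "Suc i = 2 * p" using p_gt_1 by simp
    have "(2 * p * q - 1) div p = 2 * q - 1"
    proof -
      have e: "2 * p * q - 1 = (p - 1) + (2 * q - 1) * p"
        using p_gt_1 q0 by (cases q) (auto simp: algebra_simps)
      show ?thesis unfolding e using p_gt_1 by (subst div_mult_self1) simp_all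
    qed
    moreover have "relator p q ! i = (V, False)"
    proof -
      let ?c = "wword p q @ [(U, True)] @ winv (wword p q)"
      have "i = length ?c" using 4 p_gt_1 by simp
      moreover have "relator p q = ?c @ [(V, False)]" by (simp add: relator_def)
      ultimately show ?thesis by (simp only: nth_append_length)
    qed
    moreover have "odd i"
    proof -
      have "even (Suc i)" unfolding i by simp
      then show ?thesis by simp
    qed
    moreover have "odd (2 * q - 1)" using q0 by simp
    ultimately show ?thesis by (simp only: i if_False)
  qed
qed

lemma shift_props:
  shows "even (shift p q)" "[shift p q * q = 1] (mod p)" "shift p q < 2 * p" "0 < shift p q"
proof -
  have "coprime q p" using cop by (simp add: coprime_commute)
  then obtain x where "[q * x = Suc 0] (mod p)" by (rule exE[OF cong_solve_coprime_nat])
  then have x: "[x * q = 1] (mod p)" by (simp add: mult.commute)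
  define y where "y = x mod p"
  have y: "[y * q = 1] (mod p)" "y < p"
    using x p_gt_1 by (auto simp: y_def cong_def mod_mult_left_eq)
  define z where "z = (if even y then y else y + p)"
  have "[(y + p) * q = 1] (mod p)" using y(1) by (simp add: cong_def algebra_simps)
  then have z: "even z \<and> [z * q = 1] (mod p)" "z < 2 * p"
    using y op by (auto simp: z_def)
  have s: "even (shift p q) \<and> [shift p q * q = 1] (mod p)"
    unfolding shift_def by (rule LeastI[of _ z]) (rule z(1))
  then show "even (shift p q)" and c: "[shift p q * q = 1] (mod p)" by simp_all
  have "shift p q \<le> z" unfolding shift_def by (rule Least_le) (rule z(1))
  with z show "shift p q < 2 * p" by simp
  show "0 < shift p q"
  proof (rule ccontr)
    assume "\<not> 0 < shift p q"
    with c p_gt_1 show False by (simp add: cong_def)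
  qed
qed

lemma rotate_relator:
  "drop (shift p q - 1) (relator p q) @ take (shift p q - 1) (relator p q) =
    [(V, False)] @ winv (rev (wword p q)) @ [(U, True)] @ rev (wword p q)"
  (is "?L = ?R")
proof (rule nth_equalityI)
  let ?s = "shift p q"
  show len: "length ?L = length ?R" using p_gt_1 by (simp add: length_relator)
  obtain m where m: "?s * q - 1 = p + 2 * p * m"
  proof -
    have "0 < ?s * q" using shift_props(4) q0 by simp
    then have "p dvd ?s * q - 1" using shift_props(2)
      by (intro cong_to_1_nat)
    then obtain n where n: "?s * q - 1 = p * n" by (elim dvdE)
    moreover have "odd (?s * q - 1)" using shift_props(1) \<open>0 < ?s * q\<close> by simp
    ultimately have "odd n" by simp
    then obtain m where "n = 2 * m + 1" by (elim oddE)
    with n that[of m] show thesis by (simp add: algebra_simps)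
  qed
  have shifted: "(j + ?s) * q - 1 = j * q + p + 2 * p * m" for j
  proof -
    have "0 < ?s * q" using shift_props(4) q0 by simp
    with m show ?thesis by (simp only: add_mult_distrib)
  qed
  fix j assume "j < length ?L"
  then have j: "j < 2 * p" using shift_props(3) by (simp add: length_relator)
  have L: "?L ! j = (if odd j then U else V, even ((j * q + p) div p))"
  proof (cases "j + ?s \<le> 2 * p")
    case True
    then have h: "j < 2 * p - (?s - 1)" "?s - 1 + j = j + ?s - 1"
      using shift_props(4) by linarith+
    have "?L ! j = drop (?s - 1) (relator p q) ! j"
      using h(1) by (simp only: nth_append length_drop length_relator if_True)
    also have "\<dots> = relator p q ! (?s - 1 + j)"
      using shift_props(3) by (intro nth_drop) (simp add: length_relator)
    finally have "?L ! j = relator p q ! (j + ?s - 1)" by (simp only: h(2))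
    also have "\<dots> = (if odd j then U else V, even (((j + ?s) * q - 1) div p))"
      using True shift_props(1,4) by (subst nth_relator) auto
    also have "((j + ?s) * q - 1) div p = (j * q + p) div p + 2 * m"
      unfolding shifted using p_gt_1 by (simp add: mult.commute[of 2 p] mult.assoc)
    finally show ?thesis by simp
  next
    case False
    then have h: "\<not> j < 2 * p - (?s - 1)" "j - (2 * p - (?s - 1)) = j + ?s - 1 - 2 * p"
        "j + ?s - 1 - 2 * p < ?s - 1"
      using shift_props(3,4) j by linarith+
    have "?L ! j = take (?s - 1) (relator p q) ! (j - (2 * p - (?s - 1)))"
      using h(1) by (simp only: nth_append length_drop length_relator if_False)
    also have "\<dots> = relator p q ! (j + ?s - 1 - 2 * p)"
      unfolding h(2) using h(3) by (rule nth_take)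
    finally have "?L ! j = relator p q ! (j + ?s - 1 - 2 * p)" .
    also have "\<dots> = (if odd j then U else V, even (((j + ?s - 2 * p) * q - 1) div p))"
    proof -
      have "Suc (j + ?s - 1 - 2 * p) = j + ?s - 2 * p" "j + ?s - 1 - 2 * p < 2 * p"
        using False shift_props(3) j by linarith+
      moreover have "even (j + ?s - 1 - 2 * p) \<longleftrightarrow> odd j"
        using False shift_props(1) by presburger
      ultimately show ?thesis by (simp only: nth_relator if_not_P not_not split: if_split)
    qed
    also have "even (((j + ?s - 2 * p) * q - 1) div p) \<longleftrightarrow> even ((j * q + p) div p)"
    proof -
      have "0 < (j + ?s - 2 * p) * q" using False q0 by simp
      then have "(j + ?s) * q - 1 = ((j + ?s - 2 * p) * q - 1) + (2 * q) * p"
        using False by (simp add: diff_mult_distrib algebra_simps)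
      then have "((j + ?s) * q - 1) div p = ((j + ?s - 2 * p) * q - 1) div p + 2 * q"
        using p_gt_1 by simp
      moreover have "((j + ?s) * q - 1) div p = (j * q + p) div p + 2 * m"
        unfolding shifted using p_gt_1 by (simp add: mult.commute[of 2 p] mult.assoc)
      ultimately show ?thesis by (metis dvd_triv_left even_add)
    qed
    finally show ?thesis .
  qed
  have dj: "(j * q + p) div p = Suc (j * q div p)" using p_gt_1 by simp
  consider "j = 0" | "0 < j" "j < p" | "j = p" | "p < j" by linarith
  then show "?L ! j = ?R ! j"
  proof cases
    case 1
    then show ?thesis using L p_gt_1 by simp
  next
    case 2
    then have "?R ! j = flip (wword p q ! (j - 1))"
      using p_gt_1 by (cases j) (auto simp: nth_append winv_rev)
    also have "\<dots> = (if odd j then U else V, odd (j * q div p))"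
      using 2 by (simp add: nth_wword)
    finally show ?thesis using L dj by simp
  next
    case 3
    then have "?R ! j = (U, True)"
      using p_gt_1 by (cases j) (auto simp: nth_append)
    then show ?thesis using 3 L dj op oq p_gt_1 by simp
  next
    case 4
    define i where "i = j - p"
    have i: "0 < i" "i < p" "j = p + i" using 4 j by (auto simp: i_def)
    have "?R ! j = wword p q ! (p - i - 1)"
      using i by (cases i) (auto simp: nth_append nth_Cons' rev_nth)
    also have "\<dots> = (if odd (p - i) then U else V, even ((p - i) * q div p))"
    proof -
      have "Suc (p - i - 1) = p - i" "p - i - 1 < p - 1" using i by linarith+
      moreover have "even (p - i - 1) \<longleftrightarrow> odd (p - i)" using i by simp
      ultimately show ?thesis by (simp only: nth_wword)
    qed
    also have "\<dots> = (if odd j then U else V, even (i * q div p))"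
      using i op even_eps_reflect[OF i(1,2)] by simp
    also have "even (i * q div p) \<longleftrightarrow> even ((j * q + p) div p)"
    proof -
      have "j * q = i * q + q * p" using i by (simp add: algebra_simps)
      then have "j * q div p = i * q div p + q" using p_gt_1 by simp
      then show ?thesis using dj oq by simp
    qed
    finally show ?thesis using L by simp
  qed
qed

lemma torus_chain:
  "pres_eq {} ([(U, True)] @ longitude p q @ winv [(U, True)] @ winv (longitude p q))
    (relator_prod (relator p q) (torus_chain p q))"
proof -
  define w where "w = wword p q"
  define t where "t = take (shift p q - 1) (relator p q)"
  define d where "d = drop (shift p q - 1) (relator p q)"
  let ?u = "[(U, True)]" and ?v = "[(V, True)]"
  let ?w' = "rev w"
  have r: "relator p q = t @ d" by (simp add: t_def d_def)
  have rw: "relator p q = w @ ?u @ winv w @ winv ?v"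
    by (simp add: relator_def w_def winv_def)
  have rot: "d @ t = winv ?v @ winv ?w' @ ?u @ ?w'"
    using rotate_relator by (simp add: t_def d_def w_def winv_def)
  note del = pres_eq_del_left[of "{}"] pres_eq_del_right[of "{}"]
  have "torus_chain p q = [(1, ?w' @ ?v @ winv t), (- 1, ?w')]"
    by (simp add: torus_chain_def t_def w_def)
  moreover have "winv (?v @ winv t) = t @ winv ?v" by (simp only: winv_append winv_winv)
  ultimately have "relator_prod (relator p q) (torus_chain p q) =
    (?w' @ ?v) @ winv t @ relator p q @
      (t @ winv ?v @ winv ?w' @ ?w' @ winv (relator p q) @ winv ?w')"
    by (simp add: relator_prod_def winv_append)
  also have "\<dots> = (?w' @ ?v) @ winv t @ t @
      (d @ t @ winv ?v @ winv ?w' @ ?w' @ winv (relator p q) @ winv ?w')"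
    by (subst (1) r) simp
  also have "pres_eq {} \<dots> ((?w' @ ?v) @ (d @ t @ winv ?v @ winv ?w' @ ?w' @ winv (relator p q) @ winv ?w'))"
    by (rule del)
  finally have 1: "pres_eq {} (relator_prod (relator p q) (torus_chain p q))
    ((?w' @ ?v @ d @ t @ winv ?v) @ winv ?w' @ ?w' @ (winv (relator p q) @ winv ?w'))"
    by simp
  have 2: "pres_eq {} \<dots> ((?w' @ ?v @ d @ t @ winv ?v) @ (winv (relator p q) @ winv ?w'))"
    by (rule del)
  have "(?w' @ ?v @ d @ t @ winv ?v) @ (winv (relator p q) @ winv ?w') =
    ?w' @ ?v @ winv ?v @ (winv ?w' @ ?u @ ?w' @ winv ?v @ ?v @ w @ winv ?u @ winv w @ winv ?w')"
    using rot by (simp add: rw winv_append del: append.simps)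
  then have 3: "pres_eq {} ((?w' @ ?v @ d @ t @ winv ?v) @ (winv (relator p q) @ winv ?w'))
    (?w' @ (winv ?w' @ ?u @ ?w' @ winv ?v @ ?v @ w @ winv ?u @ winv w @ winv ?w'))"
    by (simp only: del)
  have 4: "pres_eq {} ([] @ ?w' @ winv ?w' @ (?u @ ?w' @ winv ?v @ ?v @ w @ winv ?u @ winv w @ winv ?w'))
     ([] @ (?u @ ?w' @ winv ?v @ ?v @ w @ winv ?u @ winv w @ winv ?w'))"
    by (rule del)
  have 5: "pres_eq {} ((?u @ ?w') @ winv ?v @ ?v @ (w @ winv ?u @ winv w @ winv ?w'))
     ((?u @ ?w') @ (w @ winv ?u @ winv w @ winv ?w'))"
    by (rule del)
  have "pres_eq {} (relator_prod (relator p q) (torus_chain p q))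
     (?u @ ?w' @ w @ winv ?u @ winv w @ winv ?w')"
    using pres_trans[OF 1 pres_trans[OF 2 pres_trans[OF 3]]] pres_trans[OF 4] 5
    by simp
  then show ?thesis
    by (intro pres_sym[of _ "relator_prod _ _"])
      (simp add: longitude_def winv_append flip: w_def)
qed

end

text \<open>The linear form \<open>\<xi> \<mapsto> \<langle>\<xi>, \<ee>\<^sub>1\<rangle>\<close> as a row.\<close>

definition pair_e1 :: "rat poly mat" where
  "pair_e1 = mat 1 3 (\<lambda>(i, j). mtrace (sl2_basis j * sl2_basis 0))"

definition f1_row :: "rat poly mat" where
  "f1_row = four_block_mat pair_e1 (0\<^sub>m 1 3) (0\<^sub>m 0 3) (0\<^sub>m 0 3)"

text \<open>Restricting a 2-cochain \<open>\<xi>\<close> to the torus gives \<open>\<rho>\<^sub>2(c) \<xi>\<close>, where \<open>c\<close> is the chain above;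
  by Poincare duality its class in the second cohomology of the torus is identified with the
  functional on the invariants given by the pairing.\<close>

definition f2_row :: "nat \<Rightarrow> nat \<Rightarrow> rat poly mat" where
  "f2_row p q = pair_e1 * ring_mat 3 rho2 (torus_chain p q)"

definition tau2 :: "nat \<Rightarrow> nat \<Rightarrow> rat poly" where
  "tau2 p q = torsion (Vmod p q)
    [D0 3 rho2,
     D1 p q 3 rho2 @\<^sub>r f1_row,
     four_block_mat (f2_row p q) (0\<^sub>m 1 1) (0\<^sub>m 0 3) (0\<^sub>m 0 1)]"


section \<open>Torsions as functions on the character variety\<close>

text \<open>The root \<open>z\<close> gives the point \<open>\<chi>\<close> if \<open>\<chi>\<close> contains the representation obtained by
  substituting \<open>z\<close> for \<open>x\<close>.\<close>

definition gives_point :: "nat \<Rightarrow> nat \<Rightarrow> complex \<Rightarrow> (word set \<Rightarrow> complex mat) set \<Rightarrow> bool" where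
  "gives_point p q z \<chi> \<longleftrightarrow> poly (map_poly of_rat (Vmod p q)) z = 0 \<and>
    (\<exists>\<rho> \<in> \<chi>. \<forall>g. \<rho> (gen_elem p q g) = gen_mat z g)"

text \<open>The two roots giving \<open>\<chi>\<close> are opposite, and the torsions are even functions of \<open>x\<close>.\<close>

definition value_at :: "nat \<Rightarrow> nat \<Rightarrow> rat poly \<Rightarrow> (word set \<Rightarrow> complex mat) set \<Rightarrow> complex" where
  "value_at p q t \<chi> = poly (map_poly of_rat t) (SOME z. gives_point p q z \<chi>)"

end

theory Submission
  imports
    Defs
    "HOL-Library.Z2"
    "HOL-Computational_Algebra.Fundamental_Theorem_Algebra"
    "Jordan_Normal_Form.Char_Poly"
begin

text \<open>At a root \<open>z\<close> of \<open>P = P\<^bsub>p-1\<^esub>\<close> the numbers \<open>R\<^sub>i = P\<^bsub>i-1\<^esub>(z)\<close>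
  extend to all integers \<open>i\<close>, with \<open>R\<^bsub>i+p\<^esub> = \<plusminus> j R\<^sub>i\<close> and \<open>j\<^sup>2 = - 1\<close>. If
  \<open>n\<close> is even and \<open>n q \<equiv> 1\<close> modulo \<open>p\<close>, then multiplication by \<open>z R\<^sub>n\<close> shifts the
  index by \<open>n\<close>. Evaluating the minors with this rule gives \<open>1/\<tau>\<^sub>1 = \<plusminus> j z\<^sup>2 R\<^sub>n / 2\<close> and
  \<open>1/\<tau>\<^sub>2 = \<plusminus> 4 j z\<^sup>2 R\<^sub>n\<^sup>2 / P'(z)\<close>, and each point of the character variety comes from two
  opposite roots. The form \<open>\<Sum>\<^sub>z j f(z) g(z) / P'(z)\<close> has the \<open>R\<^sub>i\<close>, \<open>0 < i < p\<close>, as an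
  orthogonal basis. Up to a factor, the sum of \<open>1/\<tau>\<^sub>2\<close> is the value of the form at \<open>z R\<^sub>n = R\<^bsub>n-1\<^esub> -
  R\<^bsub>n+1\<^esub>\<close> taken twice, and the norms of the two terms are opposite. The sum of \<open>1/\<tau>\<^sub>1\<close> is a quarter of
  the trace of multiplication by \<open>j z\<^sup>2 R\<^sub>n\<close>, which has few diagonal entries in this basis.\<close>

section \<open>The recursive sequences\<close>

definition altsgn :: "int \<Rightarrow> complex" where
  "altsgn i = (if even i then 1 else - 1)"

lemma altsgn_simps [simp]:
  "altsgn 0 = 1" "altsgn (i + 1) = - altsgn i" "altsgn (1 + i) = - altsgn i" "altsgn (i - 1) = - altsgn i" "altsgn (- i) = altsgn i"
  "altsgn i * altsgn i = 1"
  by (auto simp: altsgn_def)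

lemma altsgn_add: "altsgn (i + k) = altsgn i * altsgn k"
  by (auto simp: altsgn_def)

lemma div_pred_int:
  fixes m a :: int
  assumes "0 < m" "\<not> m dvd a"
  shows "a div m = (a - 1) div m"
proof -
  have "a mod m \<noteq> 0" using assms by (simp add: dvd_eq_mod_eq_0)
  moreover have "0 \<le> a mod m" "a mod m < m" using assms by simp_all
  ultimately have e: "a - 1 = (a mod m - 1) + (a div m) * m" "0 \<le> a mod m - 1" "a mod m - 1 < m"
    using div_mult_mod_eq[of a m] by linarith+
  show ?thesis using assms e(2,3) by (subst e(1)) simp
qed

fun eps_rec :: "nat \<Rightarrow> nat \<Rightarrow> 'a::comm_ring_1 \<Rightarrow> 'a \<Rightarrow> 'a \<Rightarrow> nat \<Rightarrow> 'a" where
  "eps_rec p q x a b 0 = a"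
| "eps_rec p q x a b (Suc 0) = b"
| "eps_rec p q x a b (Suc (Suc k)) =
    of_int (eps p q (Suc k)) * x * eps_rec p q x a b (Suc k) + eps_rec p q x a b k"

definition eps_int :: "nat \<Rightarrow> nat \<Rightarrow> int \<Rightarrow> complex" where
  "eps_int p q i = altsgn (i * int q div int p)"

lemma eps_int_of_nat: "eps_int p q (int k) = of_int (eps p q k)"
proof -
  have "int k * int q div int p = int (k * q div p)" by (simp add: zdiv_int)
  then show ?thesis by (simp add: eps_int_def eps_def altsgn_def minus_one_power_iff)
qed

lemma two_step_recursion_unique:
  fixes f g :: "int \<Rightarrow> complex"
  assumes f: "\<And>i. f (i + 1) = f (i - 1) + c i * f i"
    and g: "\<And>i. g (i + 1) = g (i - 1) + c i * g i"
    and "f 0 = g 0" "f 1 = g 1"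
  shows "f i = g i"
proof -
  have "f i = g i \<and> f (i + 1) = g (i + 1)"
  proof (induction i rule: int_induct[of _ 0])
    case base
    show ?case using assms by simp
  next
    case (step1 i)
    then show ?case using f[of "i + 1"] g[of "i + 1"] by simp
  next
    case (step2 i)
    then show ?case using f[of i] g[of i] by auto
  qed
  then show ?thesis by simp
qed

lemma two_step_recursion_unique_upto:
  fixes f g :: "int \<Rightarrow> complex"
  assumes f: "\<And>i. 0 < i \<Longrightarrow> i < m \<Longrightarrow> f (i + 1) = f (i - 1) + c i * f i"
    and g: "\<And>i. 0 < i \<Longrightarrow> i < m \<Longrightarrow> g (i + 1) = g (i - 1) + c i * g i"
    and "f 0 = g 0" "f 1 = g 1" and i: "0 \<le> i" "i \<le> m"
  shows "f i = g i"
proof -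
  have "f (int k) = g (int k) \<and> (int k < m \<longrightarrow> f (int k + 1) = g (int k + 1))" if "int k \<le> m" for k
    using that
  proof (induction k)
    case 0
    show ?case using assms by simp
  next
    case (Suc k)
    then show ?case using f[of "int (Suc k)"] g[of "int (Suc k)"] by (simp add: add.commute)
  qed
  from this[of "nat i"] i show ?thesis by simp
qed

locale two_bridge =
  fixes p q :: nat
  assumes q0: "0 < q" and qp: "q < p" and cop: "coprime p q" and op: "odd p" and oq: "odd q"
begin

lemma p0: "0 < p"
  using q0 qp by simp

lemma p3: "3 \<le> p"
proof (rule ccontr)
  assume "\<not> 3 \<le> p"
  then have "p = 2" using q0 qp by linarith
  with op show False by simp
qed

lemma int_dvd_mult_q: "int p dvd i * int q \<longleftrightarrow> int p dvd i"
  using cop by (simp add: coprime_dvd_mult_left_iff)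

lemma eps_int_add_p: "eps_int p q (i + int p) = - eps_int p q i"
proof -
  have "(i + int p) * int q div int p = i * int q div int p + int q"
    using p0 by (simp add: distrib_right)
  then show ?thesis using oq by (simp add: eps_int_def altsgn_def)
qed

lemma eps_int_uminus:
  assumes "\<not> int p dvd i"
  shows "eps_int p q (- i) = - eps_int p q i"
proof -
  have "\<not> int p dvd i * int q" using assms int_dvd_mult_q by simp
  then have "(- (i * int q)) div int p = - (i * int q div int p) - 1"
    using p0 by (simp add: zdiv_zminus1_eq_if dvd_eq_mod_eq_0)
  then show ?thesis by (simp add: eps_int_def altsgn_def)
qed

lemma eps_int_reflect:
  assumes "\<not> int p dvd i"
  shows "eps_int p q (int p - i) = eps_int p q i"
  using eps_int_add_p[of "- i"] eps_int_uminus[OF assms] by simp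

lemma eps_int_add_inverse:
  assumes n: "n * int q = 1 + h * int p" "odd h" and i: "\<not> int p dvd i + n"
  shows "eps_int p q (i + n) = - eps_int p q i"
proof -
  have "\<not> int p dvd (i + n) * int q" using i int_dvd_mult_q by simp
  then have "\<not> int p dvd i * int q + 1"
    using n by (simp add: distrib_right add.assoc[symmetric])
  then have "(i * int q + 1) div int p = i * int q div int p"
    using p0 div_pred_int[of "int p" "i * int q + 1"] by simp
  moreover have "(i + n) * int q div int p = (i * int q + 1) div int p + h"
    using n p0 by (simp add: distrib_right add.assoc[symmetric])
  ultimately show ?thesis using n(2) by (simp add: eps_int_def altsgn_def)
qed

definition n :: int where "n = int (shift p q)"

definition h :: int where "h = (n * int q) div int p"

lemma n_props: "even n" "0 < n" "n < 2 * int p"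
  using shift_props[OF q0 qp cop op oq] by (auto simp: n_def)

lemma n_mult_q: "n * int q = 1 + h * int p" and odd_h: "odd h"
proof -
  have "[shift p q * q = 1] (mod p)" using shift_props[OF q0 qp cop op oq] by simp
  then have "[n * int q = 1] (mod int p)"
    unfolding n_def using cong_int_iff[of "shift p q * q" 1 p] by simp
  then have "n * int q mod int p = 1" using p3 by (simp add: cong_def)
  then show *: "n * int q = 1 + h * int p"
    unfolding h_def using div_mult_mod_eq[of "n * int q" "int p"] by linarith
  have "even (1 + h * int p)" unfolding *[symmetric] using n_props by simp
  then show "odd h" by simp
qed

lemma not_dvd_n: "\<not> int p dvd n"
proof
  assume "int p dvd n"
  then obtain d where d: "n = int p * d" by (elim dvdE)
  then have "0 < d" "d < 2" using n_props p0 by (auto simp: zero_less_mult_iff)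
  then have "d = 1" by simp
  with d n_props op show False by simp
qed

lemma eps_add_n: "\<not> int p dvd i + n \<Longrightarrow> eps_int p q (i + n) = - eps_int p q i"
  using eps_int_add_inverse[OF n_mult_q odd_h] .

lemma eps_1: "eps_int p q 1 = 1"
  using q0 qp by (simp add: eps_int_def)

lemma eps_sq [simp]: "eps_int p q i * eps_int p q i = 1"
  by (simp add: eps_int_def)

lemma eps_n: "eps_int p q n = - 1"
  using eps_add_n[of 0] not_dvd_n by (simp add: eps_int_def)

end

locale parabolic_root = two_bridge +
  fixes z :: complex
  assumes root: "eps_rec p q z 0 1 p = 0"
begin

definition R :: "int \<Rightarrow> complex" where
  "R i = eps_rec p q z 0 1 (nat \<bar>i\<bar>)"

definition R' :: "int \<Rightarrow> complex" where
  "R' i = eps_rec p q z 1 0 (nat \<bar>i\<bar>)"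

definition j :: complex where "j = R (int p - 1)"

definition Q :: complex where "Q = R' (int p - 1)"

lemma R_0 [simp]: "R 0 = 0" and R_1 [simp]: "R 1 = 1" and R_minus_1 [simp]: "R (- 1) = 1"
  by (simp_all add: R_def)

lemma R'_0 [simp]: "R' 0 = 1" and R'_1 [simp]: "R' 1 = 0"
  by (simp_all add: R'_def)

lemma R_uminus [simp]: "R (- i) = R i"
  by (simp add: R_def)

lemma R_p [simp]: "R (int p) = 0"
  using root by (simp add: R_def)

lemma eps_rec_step:
  "0 < i \<Longrightarrow> eps_rec p q z a b (nat (i + 1)) =
    eps_rec p q z a b (nat (i - 1)) + eps_int p q i * z * eps_rec p q z a b (nat i)"
proof -
  assume "0 < i"
  then obtain k where i: "i = int (Suc k)" using gr0_implies_Suc zero_less_imp_eq_int by metis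
  have "nat (i + 1) = Suc (Suc k)" "nat (i - 1) = k" "nat i = Suc k" by (simp_all add: i)
  then show ?thesis
    using eps_int_of_nat[of p q "Suc k"] by (simp add: i add.commute)
qed

lemma R_rec_pos: "0 < i \<Longrightarrow> R (i + 1) = R (i - 1) + eps_int p q i * z * R i"
  using eps_rec_step[of i 0 1] by (simp add: R_def)

lemma R'_rec: "0 < i \<Longrightarrow> R' (i + 1) = R' (i - 1) + eps_int p q i * z * R' i"
  using eps_rec_step[of i 1 0] by (simp add: R'_def)

lemma R_add_p_nat: "R (int p + int k) = - altsgn (int k) * j * R (int k)"
proof -
  have "R (int p + int k) = - altsgn (int k) * j * R (int k) \<and>
    R (int p + int (Suc k)) = - altsgn (int (Suc k)) * j * R (int (Suc k))"
  proof (induction k)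
    case 0
    show ?case using R_rec_pos[of "int p"] p0 by (simp add: j_def altsgn_def)
  next
    case (Suc k)
    let ?i = "int (Suc k)"
    have "R (int p + int (Suc (Suc k))) = R (int p + int k) + eps_int p q (int p + ?i) * z * R (int p + ?i)"
      using R_rec_pos[of "int p + ?i"] by (simp add: algebra_simps)
    also have "\<dots> = - altsgn (int k) * j * R (int k) + (- eps_int p q ?i) * z * (- altsgn ?i * j * R ?i)"
      using Suc.IH eps_int_add_p[of ?i] by (simp add: add.commute)
    also have "\<dots> = - altsgn (int k) * j * (R (int k) + eps_int p q ?i * z * R ?i)"
      by (simp add: algebra_simps)
    also have "R (int k) + eps_int p q ?i * z * R ?i = R (int (Suc (Suc k)))"
      using R_rec_pos[of ?i] by (simp add: algebra_simps)
    finally show ?case using Suc.IH by (simp add: altsgn_def)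
  qed
  then show ?thesis by simp
qed

lemma R_dvd: "int p dvd i \<Longrightarrow> R i = 0"
proof -
  have *: "R (int (m * p)) = 0" for m
  proof (induction m)
    case (Suc m)
    then show ?case using R_add_p_nat[of "m * p"] by simp
  qed simp
  assume "int p dvd i"
  then obtain d where "i = int p * d" by (elim dvdE)
  then have "\<bar>i\<bar> = int (nat \<bar>d\<bar> * p)" by (simp add: abs_mult mult.commute)
  moreover have "R i = R \<bar>i\<bar>" by (simp add: R_def)
  ultimately show ?thesis using * by (simp only:)
qed

lemma R_rec: "R (i + 1) = R (i - 1) + eps_int p q i * z * R i"
proof -
  consider "0 < i" | "i = 0" | "i < 0" by linarith
  then show ?thesis
  proof cases
    case 3
    have "R (- i + 1) = R (- i - 1) + eps_int p q (- i) * z * R (- i)"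
      using 3 by (intro R_rec_pos) simp
    moreover have "R (- i + 1) = R (i - 1)" "R (- i - 1) = R (i + 1)"
      using R_uminus[of "i - 1"] R_uminus[of "i + 1"] by simp_all
    moreover have "eps_int p q (- i) * z * R (- i) = - eps_int p q i * z * R i"
      by (cases "int p dvd i") (simp_all add: R_dvd eps_int_uminus)
    ultimately show ?thesis by (simp add: algebra_simps)
  qed (simp_all add: R_rec_pos)
qed

lemma R_add_p: "R (i + int p) = - altsgn i * j * R i"
proof (rule two_step_recursion_unique[where c = "\<lambda>i. - eps_int p q i * z"])
  show "R (i + 1 + int p) = R (i - 1 + int p) + - eps_int p q i * z * R (i + int p)" for i
    using R_rec[of "i + int p"] by (simp add: eps_int_add_p algebra_simps)
  show "- altsgn (i + 1) * j * R (i + 1) =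
    - altsgn (i - 1) * j * R (i - 1) + - eps_int p q i * z * (- altsgn i * j * R i)" for i
    using R_rec[of i] by (simp add: algebra_simps)
qed (use R_add_p_nat[of 0] R_add_p_nat[of 1] in \<open>simp_all add: add.commute\<close>)

lemma R_reflect: "R (int p - i) = - altsgn i * j * R i"
  using R_add_p[of "- i"] by simp

lemma j_sq: "j * j = - 1"
proof -
  have "1 = - (j * j)" using R_reflect[of "int p - 1"] op by (simp add: j_def[symmetric] altsgn_def)
  then show ?thesis by (metis minus_minus)
qed

lemma R_add_2p: "R (i + 2 * int p) = R i"
  using R_add_p[of "i + int p"] R_add_p[of i] j_sq op
  by (simp add: altsgn_add altsgn_def algebra_simps split: if_splits) 

lemma j_nz: "j \<noteq> 0"
  using j_sq by auto

text \<open>Multiplication by \<open>z R\<^sub>n\<close> shifts the index by \<open>n\<close>, as multiplication by \<open>z\<close> shifts it by 1.\<close>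

lemma mult_R_n:
  assumes "0 \<le> i" "i \<le> int p"
  shows "z * R n * R i = altsgn i * (R (n + i) - R (n - i))"
proof -
  have "altsgn i * (R (n + i) - R (n - i)) = z * R n * R i"
  proof (rule two_step_recursion_unique_upto[where c = "\<lambda>i. eps_int p q i * z"])
    show "z * R n * R (i + 1) = z * R n * R (i - 1) + eps_int p q i * z * (z * R n * R i)" for i
      using R_rec[of i] by (simp add: algebra_simps)
    show "altsgn 1 * (R (n + 1) - R (n - 1)) = z * R n * R 1"
      using R_rec[of n] by (simp add: eps_n altsgn_def)
    fix i :: int assume i: "0 < i" "i < int p"
    have ni: "\<not> int p dvd i" using i zdvd_not_zless by blast
    have 1: "eps_int p q (n + i) * R (n + i) = - eps_int p q i * R (n + i)"
      by (cases "int p dvd n + i") (simp_all add: R_dvd eps_add_n[of i] add.commute[of n])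
    have 2: "eps_int p q (n - i) * R (n - i) = eps_int p q i * R (n - i)"
      by (cases "int p dvd n - i")
        (use eps_add_n[of "- i"] eps_int_uminus[OF ni] in \<open>simp_all add: R_dvd\<close>)
    have "R (n + (i + 1)) = R (n + (i - 1)) - z * (eps_int p q i * R (n + i))"
      using R_rec[of "n + i"] 1 by (simp add: algebra_simps)
    moreover have "R (n - (i - 1)) = R (n - (i + 1)) + z * (eps_int p q i * R (n - i))"
      using R_rec[of "n - i"] 2 by (simp add: algebra_simps)
    then have "R (n - (i + 1)) = R (n - (i - 1)) - z * (eps_int p q i * R (n - i))"
      by (simp only: eq_diff_eq)
    ultimately have "R (n + (i + 1)) - R (n - (i + 1)) =
        R (n + (i - 1)) - R (n - (i - 1)) - z * eps_int p q i * (R (n + i) - R (n - i))"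
      by (simp only: ring_distribs mult.assoc) simp
    then show "altsgn (i + 1) * (R (n + (i + 1)) - R (n - (i + 1))) =
      altsgn (i - 1) * (R (n + (i - 1)) - R (n - (i - 1))) +
      eps_int p q i * z * (altsgn i * (R (n + i) - R (n - i)))"
      by (simp only: altsgn_simps ring_distribs) (simp add: mult_ac)
  qed (use assms in simp_all)
  then show ?thesis by simp
qed

lemma R_n_add:
  assumes "0 \<le> i" "i \<le> int p"
  shows "altsgn i * R (n + i) = R n * R' i - R (n + 1) * R i"
proof (rule two_step_recursion_unique_upto[where c = "\<lambda>i. eps_int p q i * z" and m = "int p"])
  fix i :: int assume i: "0 < i" "i < int p"
  show "R n * R' (i + 1) - R (n + 1) * R (i + 1) = R n * R' (i - 1) - R (n + 1) * R (i - 1) +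
      eps_int p q i * z * (R n * R' i - R (n + 1) * R i)"
    using R_rec[of i] R'_rec[of i] i by (simp add: algebra_simps)
  have 1: "eps_int p q (n + i) * R (n + i) = - eps_int p q i * R (n + i)"
    by (cases "int p dvd n + i") (simp_all add: R_dvd eps_add_n[of i] add.commute[of n])
  have "R (n + (i + 1)) = R (n + (i - 1)) - z * (eps_int p q i * R (n + i))"
    using R_rec[of "n + i"] 1 by (simp add: algebra_simps)
  then show "altsgn (i + 1) * R (n + (i + 1)) =
      altsgn (i - 1) * R (n + (i - 1)) + eps_int p q i * z * (altsgn i * R (n + i))"
    by (simp only: altsgn_simps ring_distribs) (simp add: mult_ac)
qed (use assms in \<open>simp_all add: altsgn_def\<close>)

lemma R_n_Q: "R n * Q = j * (R (n + 1) + R (n - 1))"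
proof -
  have "altsgn (int p - 1) = 1" using op by (simp add: altsgn_def)
  then have "R (n + (int p - 1)) = R n * Q - R (n + 1) * j"
    using R_n_add[of "int p - 1"] p0 by (simp add: Q_def j_def)
  moreover have "R (n + (int p - 1)) = j * R (n - 1)"
    using R_add_p[of "n - 1"] n_props by (simp add: altsgn_def algebra_simps)
  ultimately show ?thesis by (simp add: algebra_simps)
qed

end

lemma sum_periodic_step:
  fixes F :: "int \<Rightarrow> complex"
  assumes F: "\<And>i. F (i + m) = F i" and m: "0 < m"
  shows "sum F {a + 1..<a + 1 + m} = sum F {a..<a + m}"
proof -
  have "{a + 1..<a + 1 + m} = insert (a + m) {a + 1..<a + m}" "{a..<a + m} = insert a {a + 1..<a + m}"
    using m by auto
  then show ?thesis using F[of a] by simp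
qed

lemma sum_periodic_interval:
  fixes F :: "int \<Rightarrow> complex"
  assumes F: "\<And>i. F (i + m) = F i" and m: "0 < m"
  shows "sum F {a..<a + m} = sum F {b..<b + m}"
proof -
  have *: "sum F {a..<a + m} = sum F {0..<m}" for a
  proof (induction a rule: int_induct[of _ 0])
    case (step1 i)
    then show ?case using sum_periodic_step[of F m i] F m by simp
  next
    case (step2 i)
    then show ?case using sum_periodic_step[of F m "i - 1"] F m by (simp add: algebra_simps)
  qed simp
  show ?thesis unfolding *[of a] *[of b] ..
qed

lemma sum_periodic_shift:
  fixes F :: "int \<Rightarrow> complex"
  assumes F: "\<And>i. F (i + m) = F i" and m: "0 < m"
  shows "(\<Sum>i\<in>{a..<a + m}. F (i + s)) = sum F {b..<b + m}"
proof -
  have "(\<Sum>i\<in>{a..<a + m}. F (i + s)) = sum F {a + s..<a + s + m}"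
    by (rule sum.reindex_bij_witness[where i = "\<lambda>i. i - s" and j = "\<lambda>i. i + s"]) auto
  also have "\<dots> = sum F {b..<b + m}" using F m by (rule sum_periodic_interval)
  finally show ?thesis .
qed

lemma sum_uminus_interval:
  fixes F :: "int \<Rightarrow> complex"
  shows "(\<Sum>i\<in>{1..<m}. F (- i)) = sum F {1 - m..<0}"
  by (rule sum.reindex_bij_witness[where i = uminus and j = uminus]) auto

context parabolic_root
begin

definition G :: "int \<Rightarrow> complex" where "G k = R (k - 1) + R (k + 1)"

definition S :: complex where "S = (\<Sum>k | k \<in> {1..<int p} \<and> odd k. eps_int p q k * G k)"

lemma G_uminus: "G (- k) = G k"
proof -
  have "R (- k - 1) = R (k + 1)" "R (- k + 1) = R (k - 1)"
    using R_uminus[of "k + 1"] R_uminus[of "k - 1"] by simp_all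
  then show ?thesis by (simp add: G_def)
qed

lemma G_add_2p: "G (k + 2 * int p) = G k"
  using R_add_2p[of "k - 1"] R_add_2p[of "k + 1"] by (simp add: G_def algebra_simps)

definition E :: "int \<Rightarrow> complex" where
  "E k = (if odd k \<and> \<not> int p dvd k then eps_int p q k else 0)"

definition I :: "int \<Rightarrow> complex" where
  "I k = (if odd k \<and> int p dvd k then 1 else 0)"

lemma eps_add_2p: "eps_int p q (k + 2 * int p) = eps_int p q k"
  using eps_int_add_p[of k] eps_int_add_p[of "k + int p"] by (simp add: algebra_simps)

lemma E_add_2p: "E (k + 2 * int p) = E k" and I_add_2p: "I (k + 2 * int p) = I k"
  using eps_add_2p by (auto simp: E_def I_def)

lemma E_uminus: "E (- k) = - E k"
  by (auto simp: E_def eps_int_uminus)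

lemma eps_add_odd_p:
  assumes "odd m"
  shows "eps_int p q (i + m * int p) = - eps_int p q i"
proof -
  have *: "eps_int p q (i + (2 * d) * int p) = eps_int p q i" for d i
  proof (induction d rule: int_induct[of _ 0])
    case (step1 d)
    then show ?case using eps_add_2p[of "i + (2 * d) * int p"] by (simp add: algebra_simps)
  next
    case (step2 d)
    then show ?case using eps_add_2p[of "i + (2 * (d - 1)) * int p"] by (simp add: algebra_simps)
  qed simp
  obtain d where "m = 2 * d + 1" using assms by (elim oddE)
  then show ?thesis
    using *[of "i + int p" d] eps_int_add_p[of i] by (simp add: algebra_simps)
qed

lemma E_add_n: "E k + E (k + n) = I k - I (k + n)"
proof (cases "odd k")
  case odd: True
  consider "int p dvd k" | "int p dvd k + n" "\<not> int p dvd k" | "\<not> int p dvd k" "\<not> int p dvd k + n" by blast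
  then show ?thesis
  proof cases
    case 1
    then have "\<not> int p dvd k + n" using not_dvd_n dvd_add_right_iff by blast
    moreover from 1 obtain m where m: "k = int p * m" by (elim dvdE)
    then have "odd m" using odd by simp
    then have "eps_int p q (k + n) = 1" using eps_add_odd_p[of m n] eps_n by (simp add: m algebra_simps)
    ultimately show ?thesis using 1 odd n_props by (simp add: E_def I_def)
  next
    case 2
    from 2 obtain m where m: "k + n = int p * m" by (elim dvdE)
    have "odd (k + n)" using odd n_props by simp
    then have "odd m" unfolding m by simp
    moreover have "k = - n + m * int p" using m by (simp add: mult.commute)
    ultimately have "eps_int p q k = - eps_int p q (- n)"
      using eps_add_odd_p[of m "- n"] by simp
    then have "eps_int p q k = - 1" using eps_int_uminus[OF not_dvd_n] eps_n by simp
    then show ?thesis using 2 odd n_props by (simp add: E_def I_def)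
  next
    case 3
    then show ?thesis using eps_add_n[of k] odd n_props by (simp add: E_def I_def)
  qed
qed (use n_props in \<open>simp add: E_def I_def\<close>)

lemma sum_I:
  assumes "\<And>k. F (k + 2 * int p) = F k"
  shows "(\<Sum>k\<in>{- int p..<int p}. I k * F k) = F (int p)"
proof -
  have "k = - int p" if "k \<in> {- int p..<int p}" "odd k" "int p dvd k" for k
  proof -
    from that(3) obtain m where m: "k = int p * m" by (elim dvdE)
    then have "odd m" using that by simp
    moreover have "int p * - 1 \<le> int p * m" "int p * m < int p * 1" using that(1) unfolding m by simp_all
    then have "- 1 \<le> m" "m < 1" using p0 by (simp_all only: mult_le_cancel_left_pos mult_less_cancel_left_pos of_nat_0_less_iff)
    ultimately have "m = - 1" by presburger
    then show ?thesis using m by simp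
  qed
  then have "(\<Sum>k\<in>{- int p..<int p}. I k * F k) = (\<Sum>k\<in>{- int p}. I k * F k)"
    using p0 by (intro sum.mono_neutral_right) (auto simp: I_def)
  also have "\<dots> = F (int p)" using op assms[of "- int p"] by (simp add: I_def)
  finally show ?thesis .
qed

lemma R_n_S: "z * R n * S = G (int p + n) - G (int p)"
proof -
  let ?W = "{- int p..<int p}"
  have per: "F (k + 2 * int p) = F k \<Longrightarrow> F (k + 2 * int p) = F k" for F :: "int \<Rightarrow> complex" and k .
  have W: "?W = {- int p..<- int p + 2 * int p}" by auto
  have p2: "0 < 2 * int p" using p0 by simp
  have "z * R n * S = (\<Sum>k | k \<in> {1..<int p} \<and> odd k. eps_int p q k * (G (k + n) - G (- k + n)))"
    unfolding S_def sum_distrib_left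
  proof (rule sum.cong)
    fix k assume "k \<in> {k. k \<in> {1..<int p} \<and> odd k}"
    then have k: "1 \<le> k" "k < int p" "odd k" by auto
    have "z * R n * R (k - 1) = R (n + (k - 1)) - R (n - (k - 1))"
      "z * R n * R (k + 1) = R (n + (k + 1)) - R (n - (k + 1))"
      using mult_R_n[of "k - 1"] mult_R_n[of "k + 1"] k by (simp_all add: altsgn_def)
    then have "z * R n * G k = R (n + (k - 1)) - R (n - (k - 1)) + (R (n + (k + 1)) - R (n - (k + 1)))"
      by (simp only: G_def ring_distribs)
    also have "\<dots> = G (k + n) - G (- k + n)" by (simp add: G_def algebra_simps)
    finally have "z * R n * G k = G (k + n) - G (- k + n)" .
    then show "z * R n * (eps_int p q k * G k) = eps_int p q k * (G (k + n) - G (- k + n))"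
      by (simp add: mult_ac)
  qed simp
  also have "\<dots> = (\<Sum>k\<in>{1..<int p}. E k * (G (k + n) - G (- k + n)))"
  proof (rule sum.mono_neutral_cong_left)
    fix k assume "k \<in> {k. k \<in> {1..<int p} \<and> odd k}"
    then have "\<not> int p dvd k" using zdvd_not_zless[of k "int p"] by auto
    then show "eps_int p q k * (G (k + n) - G (- k + n)) = E k * (G (k + n) - G (- k + n))"
      using \<open>k \<in> _\<close> by (simp add: E_def)
  qed (auto simp: E_def)
  also have "\<dots> = (\<Sum>k\<in>{1..<int p}. E k * G (k + n)) + (\<Sum>k\<in>{1..<int p}. E (- k) * G (- k + n))"
    by (simp add: E_uminus algebra_simps sum.distrib sum_subtractf sum_negf)
  also have "(\<Sum>k\<in>{1..<int p}. E (- k) * G (- k + n)) = (\<Sum>k\<in>{1 - int p..<0}. E k * G (k + n))"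
    by (rule sum_uminus_interval)
  also have "(\<Sum>k\<in>{1..<int p}. E k * G (k + n)) + \<dots> = (\<Sum>k\<in>{1 - int p..<0} \<union> {1..<int p}. E k * G (k + n))"
    by (subst sum.union_disjoint) auto
  also have "\<dots> = (\<Sum>k\<in>?W. E k * G (k + n))"
  proof (rule sum.mono_neutral_left)
    show "\<forall>k\<in>?W - ({1 - int p..<0} \<union> {1..<int p}). E k * G (k + n) = 0"
    proof
      fix k assume "k \<in> ?W - ({1 - int p..<0} \<union> {1..<int p})"
      then have "k = - int p \<or> k = 0" by auto
      then show "E k * G (k + n) = 0" by (auto simp: E_def)
    qed
  qed auto
  also have "\<dots> = (\<Sum>k\<in>?W. I k * G (k + n)) - (\<Sum>k\<in>?W. I (k + n) * G (k + n)) - (\<Sum>k\<in>?W. E (k + n) * G (k + n))"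
  proof -
    have "E k * G (k + n) = I k * G (k + n) - I (k + n) * G (k + n) - E (k + n) * G (k + n)" for k
    proof -
      have "E k = I k - I (k + n) - E (k + n)" using E_add_n[of k] by (simp only: eq_diff_eq)
      then show ?thesis by (simp only: left_diff_distrib)
    qed
    then show ?thesis by (simp add: sum_subtractf)
  qed
  also have "(\<Sum>k\<in>?W. I k * G (k + n)) = G (int p + n)"
    using sum_I[of "\<lambda>k. G (k + n)"] G_add_2p[of "_ + n"] by (simp add: algebra_simps)
  also have "(\<Sum>k\<in>?W. I (k + n) * G (k + n)) = (\<Sum>k\<in>?W. I k * G k)"
    unfolding W by (rule sum_periodic_shift[of "\<lambda>k. I k * G k"]) (simp_all add: I_add_2p G_add_2p p2)
  also have "\<dots> = G (int p)"
    by (rule sum_I) (rule G_add_2p)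
  also have "(\<Sum>k\<in>?W. E (k + n) * G (k + n)) = (\<Sum>k\<in>?W. E k * G k)"
    unfolding W by (rule sum_periodic_shift[of "\<lambda>k. E k * G k"]) (simp_all add: E_add_2p G_add_2p p2)
  also have "\<dots> = 0"
  proof -
    have 1: "(\<Sum>k\<in>?W. E k * G k) = (\<Sum>k\<in>{1 - int p..<int p}. E k * G k)"
    proof (rule sum.mono_neutral_right)
      show "\<forall>k\<in>?W - {1 - int p..<int p}. E k * G k = 0"
      proof
        fix k assume "k \<in> ?W - {1 - int p..<int p}"
        then have "k = - int p" by auto
        then show "E k * G k = 0" by (simp add: E_def)
      qed
    qed auto
    have "(\<Sum>k\<in>{1 - int p..<int p}. E k * G k) = (\<Sum>k\<in>{1 - int p..<int p}. - (E k * G k))"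
      by (rule sum.reindex_bij_witness[where i = uminus and j = uminus]) (auto simp: E_uminus G_uminus)
    then show ?thesis unfolding 1 by (simp add: sum_negf)
  qed
  finally show ?thesis by simp
qed

text \<open>The left factor is the minor of the boundary map computing \<open>\<tau>\<^sub>1\<close>.\<close>

lemma minor_mult_R_n: "(Q - z * S) * R n = 2 * j"
proof -
  have "G (int p) = 2 * j"
    using R_add_p[of 1] by (simp add: G_def j_def altsgn_def add.commute)
  moreover have "G (int p + n) = j * (R (n + 1) + R (n - 1))"
    using R_add_p[of "n + 1"] R_add_p[of "n - 1"] n_props
    by (simp add: G_def altsgn_def algebra_simps)
  ultimately have "z * R n * S = R n * Q - 2 * j" using R_n_S R_n_Q by simp
  then show ?thesis by (simp add: algebra_simps)
qed

lemma R_n_nz: "R n \<noteq> 0"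
  using minor_mult_R_n j_nz by auto

definition fox_term :: "int \<Rightarrow> complex" where
  "fox_term k = (if eps_int p q k = 1 then R (k - 1) else - R (k + 1))"

lemma S_split:
  "S = (\<Sum>k | k \<in> {1..<int p} \<and> odd k. fox_term k) + j * (\<Sum>k | k \<in> {1..<int p} \<and> even k. fox_term k)"
proof -
  have "(\<Sum>k | k \<in> {1..<int p} \<and> even k. fox_term k) = (\<Sum>k | k \<in> {1..<int p} \<and> odd k. fox_term (int p - k))"
    using op by (intro sum.reindex_bij_witness[where i = "\<lambda>k. int p - k" and j = "\<lambda>k. int p - k"]) auto
  moreover have "eps_int p q k * G k = fox_term k + j * fox_term (int p - k)" if "k \<in> {1..<int p}" "odd k" for k
  proof -
    have "\<not> int p dvd k" using that zdvd_not_zless[of k "int p"] by auto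
    then have e: "eps_int p q (int p - k) = eps_int p q k" by (rule eps_int_reflect)
    have "j * R (int p - k - 1) = R (k + 1)" "j * R (int p - k + 1) = R (k - 1)"
    proof -
      have "R (int p - (k + 1)) = - (j * R (k + 1))" "R (int p - (k - 1)) = - (j * R (k - 1))"
        using R_reflect[of "k + 1"] R_reflect[of "k - 1"] that by (simp_all add: altsgn_def)
      moreover have "int p - (k + 1) = int p - k - 1" "int p - (k - 1) = int p - k + 1" by simp_all
      moreover have "j * - (j * x) = x" for x using j_sq by (simp add: mult.assoc[symmetric])
      ultimately show "j * R (int p - k - 1) = R (k + 1)" "j * R (int p - k + 1) = R (k - 1)"
        by simp_all
    qed
    moreover have "eps_int p q k = 1 \<or> eps_int p q k = - 1" by (auto simp: eps_int_def altsgn_def)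
    ultimately show ?thesis unfolding fox_term_def e by (auto simp: G_def)
  qed
  ultimately show ?thesis unfolding S_def
    by (simp add: sum_distrib_left sum.distrib[symmetric])
qed

end

lemma poly_eps_rec: "poly (eps_rec p q [:0, 1:] 0 1 k) (x::complex) = eps_rec p q x 0 1 k"
  by (induction k rule: induct_nat_012) (simp_all add: of_int_poly)

lemma sum_pairwise_parity:
  fixes R :: "nat \<Rightarrow> complex"
  assumes "\<And>i. i < k \<Longrightarrow> J (R i)" "J 0" "\<And>x y. J x \<Longrightarrow> J y \<Longrightarrow> J (x + y)" "\<And>x y. J x \<Longrightarrow> J y \<Longrightarrow> J (x * y)"
  shows "\<exists>c. J c \<and> (\<Sum>i<k. R i)\<^sup>2 = (\<Sum>i<k. (R i)\<^sup>2) + 2 * c \<and> J (\<Sum>i<k. R i)"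
  using assms(1)
proof (induction k)
  case 0
  show ?case using assms(2) by (intro exI[of _ 0]) simp
next
  case (Suc k)
  then obtain c where c: "J c" "(\<Sum>i<k. R i)\<^sup>2 = (\<Sum>i<k. (R i)\<^sup>2) + 2 * c" "J (\<Sum>i<k. R i)" by auto
  show ?case
  proof (intro exI conjI)
    show "J (c + (\<Sum>i<k. R i) * R k)" using c Suc.prems assms(3,4) by simp
    show "J (\<Sum>i<Suc k. R i)" using c Suc.prems assms(3) by simp
    show "(\<Sum>i<Suc k. R i)\<^sup>2 = (\<Sum>i<Suc k. (R i)\<^sup>2) + 2 * (c + (\<Sum>i<k. R i) * R k)"
      using c(2) by (simp add: power2_sum algebra_simps)
  qed
qed

context parabolic_root
begin

definition dP :: complex where
  "dP = poly (pderiv (eps_rec p q [:0, 1:] 0 1 p)) z"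

lemma dP_mult_j: "dP * j = (\<Sum>i\<in>{1..<p}. altsgn (int i) * eps_int p q (int i) * (R (int i))\<^sup>2)"
proof -
  define d where "d k = poly (pderiv (eps_rec p q [:0, 1:] 0 1 k)) z" for k
  have rec: "d (Suc (Suc k)) = d k + eps_int p q (int (Suc k)) * (z * d (Suc k) + R (int (Suc k)))" for k
    by (simp add: d_def pderiv_add pderiv_mult pderiv_smult poly_eps_rec R_def eps_int_of_nat of_int_poly
        pderiv_pCons algebra_simps del: of_nat_Suc)
  have "d (Suc k) * R (int k) - d k * R (int (Suc k)) =
    altsgn (int k) * (\<Sum>i\<in>{1..<Suc k}. altsgn (int i) * eps_int p q (int i) * (R (int i))\<^sup>2)" for k
  proof (induction k)
    case 0
    show ?case by (simp add: d_def)
  next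
    case (Suc k)
    let ?i = "int (Suc k)"
    have r: "R (int (Suc (Suc k))) = R (int k) + eps_int p q ?i * z * R ?i"
      using R_rec[of ?i] by (simp add: algebra_simps)
    have "d (Suc (Suc k)) * R ?i - d (Suc k) * R (int (Suc (Suc k))) =
      eps_int p q ?i * (R ?i)\<^sup>2 - (d (Suc k) * R (int k) - d k * R ?i)"
      unfolding rec r by (simp add: algebra_simps power2_eq_square del: of_nat_Suc)
    also have "\<dots> = altsgn ?i * (\<Sum>i\<in>{1..<Suc (Suc k)}. altsgn (int i) * eps_int p q (int i) * (R (int i))\<^sup>2)"
    proof -
      have "altsgn ?i * (altsgn ?i * y) = y" "altsgn ?i = - altsgn (int k)" for y
        by (simp_all add: mult.assoc[symmetric] del: of_nat_Suc) simp
      then show ?thesis unfolding Suc.IH by (simp add: algebra_simps del: of_nat_Suc)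
    qed
    finally show ?case .
  qed
  from this[of "p - 1"] show ?thesis
    using p0 op by (simp add: d_def dP_def j_def altsgn_def of_nat_diff)
qed

text \<open>The lattice spanned by the values \<open>R\<^sub>1, \<dots>, R\<^bsub>p-1\<^esub>\<close> is stable under multiplication
  by \<open>z\<close>; the numbers stabilizing it form a ring in which 2 is not invertible.\<close>

definition integral :: "complex \<Rightarrow> bool" where
  "integral g \<longleftrightarrow> (\<exists>M :: nat \<Rightarrow> nat \<Rightarrow> int. \<forall>i<p - 1.
    g * R (int i + 1) = (\<Sum>k<p - 1. of_int (M i k) * R (int k + 1)))"

lemma integral_of_int: "integral (of_int c)"
  unfolding integral_def
proof (intro exI[of _ "\<lambda>i k. if k = i then c else 0"] allI impI)
  fix i assume "i < p - 1"
  have "(\<Sum>k<p - 1. of_int (if k = i then c else 0) * R (int k + 1)) =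
    (\<Sum>k<p - 1. if k = i then of_int c * R (int i + 1) else 0)"
    by (intro sum.cong) auto
  then show "of_int c * R (int i + 1) = (\<Sum>k<p - 1. of_int (if k = i then c else 0) * R (int k + 1))"
    using \<open>i < p - 1\<close> by simp
qed

lemma integral_add: "integral a \<Longrightarrow> integral b \<Longrightarrow> integral (a + b)"
proof -
  assume "integral a" "integral b"
  from \<open>integral a\<close> obtain M where
    "\<forall>i<p - 1. a * R (int i + 1) = (\<Sum>k<p - 1. of_int (M i k) * R (int k + 1))"
    unfolding integral_def by (elim exE)
  then have M: "\<And>i. i < p - 1 \<Longrightarrow> a * R (int i + 1) = (\<Sum>k<p - 1. of_int (M i k) * R (int k + 1))"
    by simp
  from \<open>integral b\<close> obtain N where
    "\<forall>i<p - 1. b * R (int i + 1) = (\<Sum>k<p - 1. of_int (N i k) * R (int k + 1))"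
    unfolding integral_def by (elim exE)
  then have N: "\<And>i. i < p - 1 \<Longrightarrow> b * R (int i + 1) = (\<Sum>k<p - 1. of_int (N i k) * R (int k + 1))"
    by simp
  show ?thesis unfolding integral_def
  proof (intro exI[of _ "\<lambda>i k. M i k + N i k"] allI impI)
    fix i assume i: "i < p - 1"
    show "(a + b) * R (int i + 1) = (\<Sum>k<p - 1. of_int (M i k + N i k) * R (int k + 1))"
      unfolding distrib_right M[OF i] N[OF i] of_int_add sum.distrib ..
  qed
qed

lemma integral_mult: "integral a \<Longrightarrow> integral b \<Longrightarrow> integral (a * b)"
proof -
  assume "integral a" "integral b"
  from \<open>integral a\<close> obtain M where
    "\<forall>i<p - 1. a * R (int i + 1) = (\<Sum>k<p - 1. of_int (M i k) * R (int k + 1))"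
    unfolding integral_def by (elim exE)
  then have M: "\<And>i. i < p - 1 \<Longrightarrow> a * R (int i + 1) = (\<Sum>k<p - 1. of_int (M i k) * R (int k + 1))"
    by simp
  from \<open>integral b\<close> obtain N where
    "\<forall>i<p - 1. b * R (int i + 1) = (\<Sum>k<p - 1. of_int (N i k) * R (int k + 1))"
    unfolding integral_def by (elim exE)
  then have N: "\<And>i. i < p - 1 \<Longrightarrow> b * R (int i + 1) = (\<Sum>k<p - 1. of_int (N i k) * R (int k + 1))"
    by simp
  have "a * b * R (int i + 1) = (\<Sum>k<p - 1. of_int (\<Sum>l<p - 1. N i l * M l k) * R (int k + 1))"
    if "i < p - 1" for i
  proof -
    have "a * b * R (int i + 1) = (\<Sum>l<p - 1. of_int (N i l) * (a * R (int l + 1)))"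
      unfolding mult.assoc N[OF that] sum_distrib_left by (simp only: mult.left_commute)
    also have "\<dots> = (\<Sum>l<p - 1. \<Sum>k<p - 1. of_int (N i l) * (of_int (M l k) * R (int k + 1)))"
      by (intro sum.cong refl) (simp only: M lessThan_iff sum_distrib_left)
    also have "\<dots> = (\<Sum>k<p - 1. \<Sum>l<p - 1. of_int (N i l) * (of_int (M l k) * R (int k + 1)))"
      by (rule sum.swap)
    finally show ?thesis by (simp only: of_int_sum of_int_mult sum_distrib_right mult.assoc)
  qed
  then show ?thesis unfolding integral_def by (intro exI allI impI)
qed

lemma integral_uminus: "integral a \<Longrightarrow> integral (- a)"
  using integral_mult[OF integral_of_int[of "- 1"], of a] by simp

lemma integral_diff: "integral a \<Longrightarrow> integral b \<Longrightarrow> integral (a - b)"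
  using integral_add[OF _ integral_uminus, of a b] by simp

lemma integral_eps: "integral (eps_int p q i)"
  using integral_of_int[of 1] integral_of_int[of "- 1"] by (simp add: eps_int_def altsgn_def)

lemma integral_z: "integral z"
proof -
  define c :: "nat \<Rightarrow> int" where "c i = (if eps_int p q (int i + 1) = 1 then 1 else - 1)" for i
  have c: "of_int (c i) = eps_int p q (int i + 1)" for i
    by (auto simp: c_def eps_int_def altsgn_def)
  let ?M = "\<lambda>i k. if k = Suc i then c i else if Suc k = i then - c i else 0"
  have "z * R (int i + 1) = (\<Sum>k<p - 1. of_int (?M i k) * R (int k + 1))" if i: "i < p - 1" for i
  proof -
    have "(\<Sum>k<p - 1. of_int (?M i k) * R (int k + 1)) =
      (\<Sum>k<p - 1. if k = Suc i then of_int (c i) * R (int i + 2) else 0) -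
      (\<Sum>k<p - 1. if Suc k = i then of_int (c i) * R (int i) else 0)"
      unfolding sum_subtractf[symmetric] by (intro sum.cong) (auto simp: add.commute)
    also have "(\<Sum>k<p - 1. if k = Suc i then of_int (c i) * R (int i + 2) else 0) = of_int (c i) * R (int i + 2)"
    proof (cases "Suc i < p - 1")
      case False
      with i have "int i + 2 = int p" by linarith
      then show ?thesis using False by simp
    qed simp
    also have "(\<Sum>k<p - 1. if Suc k = i then of_int (c i) * R (int i) else 0) = of_int (c i) * R (int i)"
    proof (cases i)
      case (Suc l)
      then show ?thesis using i by simp
    qed simp
    finally have "(\<Sum>k<p - 1. of_int (?M i k) * R (int k + 1)) = eps_int p q (int i + 1) * (R (int i + 2) - R (int i))"
      by (simp add: c right_diff_distrib)
    also have "R (int i + 2) - R (int i) = eps_int p q (int i + 1) * (z * R (int i + 1))"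
      using R_rec[of "int i + 1"] by (simp add: algebra_simps)
    finally show ?thesis by (simp add: mult.assoc[symmetric])
  qed
  then show ?thesis unfolding integral_def by (intro exI allI impI)
qed

lemma integral_R: "integral (R (int k))"
proof (induction k rule: induct_nat_012)
  case 0
  show ?case using integral_of_int[of 0] by simp
next
  case 1
  show ?case using integral_of_int[of 1] by simp
next
  case (ge2 k)
  have "R (int (Suc (Suc k))) = R (int k) + eps_int p q (int (Suc k)) * z * R (int (Suc k))"
    using R_rec[of "int (Suc k)"] by (simp add: algebra_simps)
  then show ?case using ge2 integral_add integral_mult integral_z integral_eps by metis
qed

lemma not_integral_half: "\<not> integral (1 / 2)"
proof
  assume "integral (1 / 2)"
  then obtain M :: "nat \<Rightarrow> nat \<Rightarrow> int" where
    "\<forall>i<p - 1. 1 / 2 * R (int i + 1) = (\<Sum>k<p - 1. of_int (M i k) * R (int k + 1))"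
    unfolding integral_def by (elim exE)
  then have M: "\<And>i. i < p - 1 \<Longrightarrow> 1 / 2 * R (int i + 1) = (\<Sum>k<p - 1. of_int (M i k) * R (int k + 1))"
    by simp
  define A :: "int mat" where "A = mat (p - 1) (p - 1) (\<lambda>(i, k). (if i = k then 1 else 0) - 2 * M i k)"
  have A: "A \<in> carrier_mat (p - 1) (p - 1)" by (simp add: A_def)
  define v where "v = vec (p - 1) (\<lambda>i. R (int i + 1))"
  have "map_mat of_int A *\<^sub>v v = 0\<^sub>v (p - 1)"
  proof (rule eq_vecI)
    fix i assume "i < dim_vec (0\<^sub>v (p - 1) :: complex vec)"
    then have i: "i < p - 1" by simp
    have "(map_mat of_int A *\<^sub>v v) $ i =
      (\<Sum>k<p - 1. of_int ((if i = k then 1 else 0) - 2 * M i k) * R (int k + 1))"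
      using i A by (simp add: scalar_prod_def v_def A_def lessThan_atLeast0)
    also have "\<dots> = (\<Sum>k<p - 1. (if i = k then R (int i + 1) else 0)) - 2 * (\<Sum>k<p - 1. of_int (M i k) * R (int k + 1))"
      unfolding sum_distrib_left sum_subtractf[symmetric] by (intro sum.cong) (auto simp: left_diff_distrib)
    also have "\<dots> = R (int i + 1) - 2 * (1 / 2 * R (int i + 1))" unfolding M[OF i] using i by simp
    also have "\<dots> = 0" by simp
    finally show "(map_mat of_int A *\<^sub>v v) $ i = 0\<^sub>v (p - 1) $ i" using i by simp
  qed (simp add: A_def)
  moreover have "v \<noteq> 0\<^sub>v (p - 1)"
  proof
    assume "v = 0\<^sub>v (p - 1)"
    then have "v $ 0 = 0" using p3 by simp
    then show False using p3 by (simp add: v_def)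
  qed
  ultimately have "det (map_mat of_int A :: complex mat) = 0"
    using A by (subst det_0_iff_vec_prod_zero[of _ "p - 1"]) (auto simp: v_def intro!: exI[of _ v])
  then have d: "det A = 0" by simp
  have "map_mat of_int A = (1\<^sub>m (p - 1) :: bit mat)"
    by (rule eq_matI) (auto simp: A_def)
  then have "of_int (det A) = (1 :: bit)"
    by (metis of_int_hom.hom_det det_one)
  with d show False by simp
qed

lemma dP_nz: "dP \<noteq> 0"
proof
  assume "dP = 0"
  define m where "m = (p - 1) div 2"
  have m: "p = 2 * m + 1" using op unfolding m_def by (elim oddE) simp
  define f where "f i = altsgn (int i) * eps_int p q (int i) * (R (int i))\<^sup>2" for i
  have refl: "f (p - i) = f i" if "0 < i" "i < p" for i
  proof -
    have "\<not> int p dvd int i" using that zdvd_not_zless[of "int i" "int p"] by auto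
    then have "eps_int p q (int (p - i)) = eps_int p q (int i)"
      using that eps_int_reflect[of "int i"] by (simp add: of_nat_diff)
    moreover have "(R (int (p - i)))\<^sup>2 = - (R (int i))\<^sup>2"
    proof -
      have "(R (int (p - i)))\<^sup>2 = (altsgn (int i) * altsgn (int i)) * (j * j) * (R (int i))\<^sup>2"
        using R_reflect[of "int i"] that by (simp add: of_nat_diff power2_eq_square mult_ac)
      then show ?thesis using j_sq by simp
    qed
    moreover have "altsgn (int (p - i)) = - altsgn (int i)"
      using op that by (simp add: altsgn_def)
    ultimately show ?thesis by (simp add: f_def)
  qed
  have "0 = (\<Sum>i\<in>{1..<p}. f i)" using dP_mult_j \<open>dP = 0\<close> by (simp add: f_def)
  also have "{1..<p} = {1..<Suc m} \<union> {Suc m..<p}" using m by auto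
  also have "(\<Sum>i\<in>\<dots>. f i) = (\<Sum>i\<in>{1..<Suc m}. f i) + (\<Sum>i\<in>{Suc m..<p}. f i)"
    by (rule sum.union_disjoint) auto
  also have "(\<Sum>i\<in>{Suc m..<p}. f i) = (\<Sum>i\<in>{1..<Suc m}. f (p - i))"
    using m by (intro sum.reindex_bij_witness[where i = "\<lambda>i. p - i" and j = "\<lambda>i. p - i"]) auto
  also have "\<dots> = (\<Sum>i\<in>{1..<Suc m}. f i)" using m by (intro sum.cong refl) auto
  finally have "(\<Sum>i\<in>{1..<Suc m}. f i) = 0" by simp
  then have f0: "(\<Sum>i<m. f (Suc i)) = 0"
    by (simp add: sum.atLeast_Suc_lessThan_Suc_shift lessThan_atLeast0 del: sum.op_ivl_Suc)
  let ?r = "\<lambda>i. R (int (Suc i))"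
  have even_diff: "\<exists>c. integral c \<and> (if b then x else - x) = x + 2 * c" if "integral x" for b x
    using that integral_uminus[OF that] integral_of_int[of 0]
    by (intro exI[of _ "if b then 0 else - x"]) auto
  have "\<exists>c. integral c \<and> (\<Sum>i<k. f (Suc i)) = (\<Sum>i<k. (?r i)\<^sup>2) + 2 * c" for k
  proof (induction k)
    case 0
    show ?case using integral_of_int[of 0] by (intro exI[of _ 0]) simp
  next
    case (Suc k)
    then obtain c where c: "integral c" "(\<Sum>i<k. f (Suc i)) = (\<Sum>i<k. (?r i)\<^sup>2) + 2 * c" by blast
    have "integral ((?r k)\<^sup>2)" unfolding power2_eq_square by (intro integral_mult integral_R)
    moreover have "f (Suc k) = (if altsgn (int (Suc k)) * eps_int p q (int (Suc k)) = 1 then (?r k)\<^sup>2 else - (?r k)\<^sup>2)"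
      unfolding f_def by (auto simp: eps_int_def altsgn_def simp del: of_nat_Suc)
    ultimately obtain c' where "integral c'" "f (Suc k) = (?r k)\<^sup>2 + 2 * c'"
      using even_diff[of "(?r k)\<^sup>2" "altsgn (int (Suc k)) * eps_int p q (int (Suc k)) = 1"] by auto
    then show ?case using c by (intro exI[of _ "c + c'"]) (simp add: integral_add algebra_simps)
  qed
  from this[of m] obtain c where c: "integral c" "0 = (\<Sum>i<m. (?r i)\<^sup>2) + 2 * c"
    unfolding f0 by blast
  then have c2: "(\<Sum>i<m. (?r i)\<^sup>2) = - (2 * c)" by (simp only: eq_neg_iff_add_eq_0)
  obtain c' where c': "integral c'" "(\<Sum>i<m. ?r i)\<^sup>2 = (\<Sum>i<m. (?r i)\<^sup>2) + 2 * c'" "integral (\<Sum>i<m. ?r i)"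
    using sum_pairwise_parity[of m integral ?r, OF integral_R _ integral_add integral_mult] integral_of_int[of 0]
    by auto
  have "\<exists>d. integral d \<and> z * (\<Sum>i<k. ?r i) = 1 + R (int k) + R (int k + 1) + 2 * d" for k
  proof (induction k)
    case 0
    show ?case using integral_of_int[of "- 1"] by (intro exI[of _ "- 1"]) simp
  next
    case (Suc k)
    then obtain d where d: "integral d" "z * (\<Sum>i<k. ?r i) = 1 + R (int k) + R (int k + 1) + 2 * d" by blast
    let ?b = "eps_int p q (int k + 1) = 1"
    have "R (int k + 2) - R (int k) = eps_int p q (int k + 1) * (z * ?r k)"
      using R_rec[of "int k + 1"] by (simp add: algebra_simps)
    then have "eps_int p q (int k + 1) * (R (int k + 2) - R (int k)) = z * ?r k"
      by (simp add: mult.assoc[symmetric])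
    then have zr: "z * ?r k = (if ?b then R (int k + 2) - R (int k) else - (R (int k + 2) - R (int k)))"
      by (auto simp: eps_int_def altsgn_def split: if_splits)
    have i: "integral (R (int k + 2))" "integral (R (int k))" "integral (R (int k + 1))"
      using integral_R[of "k + 2"] integral_R[of k] integral_R[of "k + 1"] by (simp_all add: add.commute)
    let ?d = "d + (if ?b then 0 else R (int k)) - (if ?b then 0 else R (int k + 2)) - (if ?b then R (int k) else R (int k)) + (if ?b then R (int k) else 0)"
    show ?case
    proof (intro exI conjI)
      show "integral (d + (if ?b then 0 else R (int k) - R (int k + 2)))"
        using d(1) i integral_of_int[of 0] by (auto intro!: integral_add integral_diff)
      show "z * (\<Sum>i<Suc k. ?r i) = 1 + R (int (Suc k)) + R (int (Suc k) + 1) +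
          2 * (d + (if ?b then 0 else R (int k) - R (int k + 2)))"
        using d(2) zr by (auto simp: algebra_simps)
    qed
  qed
  from this[of m] obtain d where d: "integral d" "z * (\<Sum>i<m. ?r i) = 1 + R (int m) + R (int m + 1) + 2 * d" by blast
  have im: "integral (R (int m))" "integral (R (int m + 1))"
    using integral_R[of m] integral_R[of "m + 1"] by (simp_all add: add.commute)
  have sq: "R (int m + 1) * R (int m + 1) = - (R (int m) * R (int m))"
  proof -
    have "int m + 1 = int p - int m" using m by simp
    then have "R (int m + 1) * R (int m + 1) = (altsgn (int m) * altsgn (int m)) * (j * j) * (R (int m) * R (int m))"
      using R_reflect[of "int m"] by (simp only: mult_minus_left mult_minus_right minus_minus mult_ac)
    then show ?thesis using j_sq by simp
  qed
  let ?t = "z * (\<Sum>i<m. ?r i)"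
  have "?t * ?t = z * z * ((\<Sum>i<m. ?r i)\<^sup>2)" by (simp add: power2_eq_square mult_ac)
  also have "\<dots> = 2 * (z * z * (c' - c))" unfolding c'(2) c2 by (simp add: algebra_simps)
  finally have t2: "?t * ?t = 2 * (z * z * (c' - c))" .
  let ?a = "R (int m)" and ?b = "R (int m + 1)"
  have "?t * ?t = 1 + (?a * ?a + ?b * ?b) + 2 * (?a + ?b + ?a * ?b + 2 * d * (1 + ?a + ?b + d))"
    unfolding d(2) by (simp add: algebra_simps)
  then have "1 = 2 * (z * z * (c' - c) - (?a + ?b + ?a * ?b + 2 * d * (1 + ?a + ?b + d)))"
    unfolding t2 sq by (simp only: right_diff_distrib) simp
  moreover have "integral (z * z * (c' - c) - (?a + ?b + ?a * ?b + 2 * d * (1 + ?a + ?b + d)))"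
    using integral_of_int[of 2] integral_of_int[of 1] im d(1) c(1) c'(1) integral_z
    by (intro integral_diff integral_add integral_mult) simp_all
  moreover have "x = 1 / 2" if "1 = 2 * x" for x :: complex
    unfolding that by simp
  ultimately show False using not_integral_half by metis
qed

end

lemma sum_roots_div_pderiv:
  fixes P f :: "complex poly"
  assumes simple: "\<And>z. poly P z = 0 \<Longrightarrow> poly (pderiv P) z \<noteq> 0" and f: "degree f < degree P"
  shows "(\<Sum>z | poly P z = 0. poly f z / poly (pderiv P) z) = coeff f (degree P - 1) / lead_coeff P"
proof -
  define Z where "Z = {z. poly P z = 0}"
  define c where "c = lead_coeff P"
  have P0: "P \<noteq> 0" using f by auto
  then have c0: "c \<noteq> 0" by (simp add: c_def)
  have fin: "finite Z" unfolding Z_def using P0 by (rule poly_roots_finite)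
  have "rsquarefree P" using simple by (auto simp: rsquarefree_roots)
  then have P: "P = smult c (\<Prod>z\<in>Z. [:- z, 1:])"
    using complex_poly_decompose_rsquarefree by (simp add: c_def Z_def)
  have deg: "degree P = card Z"
    using c0 by (subst P) (simp add: degree_prod_sum_eq)
  define L where "L w = (\<Prod>z\<in>Z - {w}. [:- z, 1:])" for w
  have PL: "P = smult c ([:- w, 1:] * L w)" if "w \<in> Z" for w
    unfolding P L_def using fin that by (simp add: prod.remove)
  have dP: "poly (pderiv P) w = c * poly (L w) w" if "w \<in> Z" for w
    by (subst PL[OF that])
      (simp only: pderiv_smult pderiv_mult poly_smult poly_add poly_mult, simp add: pderiv_pCons)
  have L_other: "poly (L w) v = 0" if "v \<in> Z" "v \<noteq> w" for v w
    using fin that by (auto simp: L_def poly_prod)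
  have L_deg: "degree (L w) = card Z - 1" if "w \<in> Z" for w
    using that fin by (simp add: L_def degree_prod_sum_eq)
  have L_lead: "coeff (L w) (card Z - 1) = 1" if "w \<in> Z" for w
  proof -
    have "lead_coeff (L w) = 1" unfolding L_def by (simp add: lead_coeff_prod)
    then show ?thesis using L_deg[OF that] by simp
  qed
  define g where "g = (\<Sum>w\<in>Z. smult (c * poly f w / poly (pderiv P) w) (L w))"
  have gz: "poly g v = poly f v" if "v \<in> Z" for v
  proof -
    have "poly g v = (\<Sum>w\<in>Z. if w = v then poly f v else 0)"
      unfolding g_def poly_sum
    proof (rule sum.cong)
      fix w assume "w \<in> Z"
      then show "poly (smult (c * poly f w / poly (pderiv P) w) (L w)) v = (if w = v then poly f v else 0)"
        using L_other[OF that, of w] simple[of w] dP[of w] c0 by (auto simp: Z_def)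
    qed simp
    then show ?thesis using that fin by simp
  qed
  have "card Z > 0" using f deg by simp
  have "degree g \<le> card Z - 1"
    unfolding g_def by (rule degree_sum_le[OF fin]) (simp add: L_deg le_trans[OF degree_smult_le])
  then have degfg: "degree (f - g) < card Z"
    using f deg \<open>card Z > 0\<close> degree_diff_le_max[of f g] by auto
  have "f - g = 0"
  proof (rule ccontr)
    assume "f - g \<noteq> 0"
    then have "card {x. poly (f - g) x = 0} \<le> degree (f - g)" "finite {x. poly (f - g) x = 0}"
      using card_poly_roots_bound poly_roots_finite by blast+
    moreover have "Z \<subseteq> {x. poly (f - g) x = 0}" using gz by auto
    ultimately have "card Z \<le> degree (f - g)" using card_mono le_trans by blast
    with degfg show False by simp
  qed
  then have "coeff f (card Z - 1) = coeff g (card Z - 1)" by simp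
  also have "\<dots> = (\<Sum>w\<in>Z. c * poly f w / poly (pderiv P) w * coeff (L w) (card Z - 1))"
    unfolding g_def by (simp only: coeff_sum coeff_smult)
  also have "\<dots> = (\<Sum>w\<in>Z. c * (poly f w / poly (pderiv P) w))"
    by (intro sum.cong refl) (simp only: L_lead mult_1_right times_divide_eq_right)
  also have "\<dots> = c * (\<Sum>w\<in>Z. poly f w / poly (pderiv P) w)"
    by (simp only: sum_distrib_left)
  finally have "(\<Sum>w\<in>Z. poly f w / poly (pderiv P) w) = coeff f (card Z - 1) / c"
    using c0 by simp
  then show ?thesis unfolding c_def deg[symmetric] unfolding Z_def .
qed

context two_bridge
begin

abbreviation RP :: "nat \<Rightarrow> complex poly" where "RP \<equiv> eps_rec p q [:0, 1:] 0 1"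

definition Z :: "complex set" where "Z = {z. eps_rec p q z 0 1 p = 0}"

lemma Z_root: "z \<in> Z \<Longrightarrow> parabolic_root p q z"
  by unfold_locales (simp add: Z_def)

definition eps_prod :: "nat \<Rightarrow> complex" where
  "eps_prod k = (\<Prod>i\<in>{1..<Suc k}. eps_int p q (int i))"

lemma eps_prod_Suc: "eps_prod (Suc k) = eps_prod k * eps_int p q (int (Suc k))"
  by (simp add: eps_prod_def)

lemma eps_prod_sq: "eps_prod k * eps_prod k = 1"
  unfolding eps_prod_def prod.distrib[symmetric] by (simp del: prod.op_ivl_Suc)

lemma eps_prod_nz: "eps_prod k \<noteq> 0"
  using eps_prod_sq[of k] by auto

lemma RP_degree_coeff: "degree (RP (Suc k)) \<le> k \<and> coeff (RP (Suc k)) k = eps_prod k"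
proof (induction k rule: induct_nat_012)
  case (ge2 k)
  let ?f = "of_int (eps p q (Suc (Suc k))) * [:0, 1:] * RP (Suc (Suc k))"
  have f: "?f = pCons 0 (smult (eps_int p q (int (Suc (Suc k)))) (RP (Suc (Suc k))))"
    by (simp add: of_int_poly eps_int_of_nat[symmetric] mult.commute del: of_nat_Suc)
  have "degree ?f \<le> Suc (Suc k)"
    unfolding f using ge2 by (intro degree_pCons_le[THEN le_trans]) (simp add: le_trans[OF degree_smult_le])
  then have 1: "degree (RP (Suc (Suc (Suc k)))) \<le> Suc (Suc k)"
    using ge2(1) by (simp only: eps_rec.simps) (intro degree_add_le; linarith)
  have "coeff (RP (Suc k)) (Suc (Suc k)) = 0" using ge2(1) by (intro coeff_eq_0) linarith
  then have "coeff (RP (Suc (Suc (Suc k)))) (Suc (Suc k)) = coeff ?f (Suc (Suc k))"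
    by (simp only: eps_rec.simps coeff_add add_0_right)
  also have "\<dots> = eps_prod (Suc (Suc k))"
    unfolding f using ge2(2) by (simp add: eps_prod_Suc mult.commute del: of_nat_Suc)
  finally show ?case using 1 by blast
next
  case 1
  show ?case by (simp add: of_int_poly eps_prod_def eps_int_of_nat[of p q 1, simplified])
qed (simp add: eps_prod_def)

lemma RP_degree: "degree (RP (Suc k)) = k"
  using RP_degree_coeff[of k] eps_prod_nz[of k] le_degree[of "RP (Suc k)" k] by force

lemma Z_eq: "Z = {z. poly (RP p) z = 0}"
  by (simp add: Z_def poly_eps_rec)

lemma degree_RP_p: "degree (RP p) = p - 1" and lead_RP_p: "lead_coeff (RP p) = eps_prod (p - 1)"
  and RP_p_nz: "RP p \<noteq> 0"
proof -
  obtain k where k: "p = Suc k" using p0 gr0_implies_Suc by blast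
  have "degree (RP (Suc k)) = k" "lead_coeff (RP (Suc k)) = eps_prod k"
    using RP_degree[of k] RP_degree_coeff[of k] by (simp_all del: eps_rec.simps)
  then show "degree (RP p) = p - 1" and 2: "lead_coeff (RP p) = eps_prod (p - 1)"
    by (simp_all only: k[symmetric]) (simp_all only: k diff_Suc_1)
  show "RP p \<noteq> 0"
  proof
    assume "RP p = 0"
    then have "eps_prod (p - 1) = 0" using 2 by simp
    then show False using eps_prod_nz by simp
  qed
qed

lemma finite_Z: "finite Z"
  unfolding Z_eq using RP_p_nz by (rule poly_roots_finite)

lemma sum_Z:
  assumes "degree f < p - 1"
  shows "(\<Sum>z\<in>Z. poly f z / parabolic_root.dP p q z) = coeff f (p - 2) / eps_prod (p - 1)"
proof -
  have "(\<Sum>z\<in>Z. poly f z / poly (pderiv (RP p)) z) = coeff f (degree (RP p) - 1) / lead_coeff (RP p)"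
    unfolding Z_eq
  proof (rule sum_roots_div_pderiv)
    fix z assume "poly (RP p) z = 0"
    then have "z \<in> Z" by (simp add: Z_eq)
    then interpret parabolic_root p q z by (rule Z_root)
    show "poly (pderiv (RP p)) z \<noteq> 0" using dP_nz by (simp add: dP_def)
  qed (use assms degree_RP_p in simp)
  then show ?thesis unfolding lead_RP_p unfolding degree_RP_p
    by (simp add: parabolic_root.dP_def[OF Z_root] numeral_2_eq_2 cong: sum.cong)
qed

text \<open>The trace form \<open>(f, g) \<mapsto> Tr(j f g / P')\<close> of \<open>V\<close>, where \<open>P = P\<^bsub>p-1\<^esub>\<close>. By Euler's formula it is the
  coefficient of \<open>X\<^bsup>p-2\<^esup>\<close>, which makes the values \<open>R\<^sub>1, \<dots>, R\<^bsub>p-1\<^esub>\<close> orthogonal.\<close>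

definition B :: "int \<Rightarrow> int \<Rightarrow> complex" where
  "B a b = (\<Sum>z\<in>Z. parabolic_root.j p q z * parabolic_root.R p q z a * parabolic_root.R p q z b /
    parabolic_root.dP p q z)"

lemma B_commute: "B a b = B b a"
  by (simp add: B_def mult_ac)

lemma eps_prod_reflect:
  assumes "0 < a" "a < p"
  shows "eps_prod (p - a - 1) * eps_prod (a - 1) / eps_prod (p - 1) = eps_int p q (int a)"
proof -
  have "eps_prod (p - a - 1) = (\<Prod>i\<in>{Suc a..<p}. eps_int p q (int i))"
    unfolding eps_prod_def
  proof (rule prod.reindex_bij_witness[where i = "\<lambda>i. p - i" and j = "\<lambda>i. p - i"])
    fix i assume i: "i \<in> {1..<Suc (p - a - 1)}"
    then have "0 < i" "i < p" by auto
    then have "\<not> int p dvd int i" using zdvd_not_zless[of "int i" "int p"] by auto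
    then show "eps_int p q (int (p - i)) = eps_int p q (int i)"
      using \<open>i < p\<close> eps_int_reflect[of "int i"] by (simp add: of_nat_diff)
  qed (use assms in auto)
  moreover have "eps_prod (a - 1) = (\<Prod>i\<in>{1..<a}. eps_int p q (int i))"
    using assms by (simp add: eps_prod_def)
  moreover have "eps_prod (p - 1) = (\<Prod>i\<in>{1..<a}. eps_int p q (int i)) *
      (eps_int p q (int a) * (\<Prod>i\<in>{Suc a..<p}. eps_int p q (int i)))"
  proof -
    have "{1..<Suc (p - 1)} = {1..<a} \<union> {a..<p}" using assms by auto
    then have "eps_prod (p - 1) = (\<Prod>i\<in>{1..<a}. eps_int p q (int i)) * (\<Prod>i\<in>{a..<p}. eps_int p q (int i))"
      unfolding eps_prod_def by (simp add: prod.union_disjoint)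
    then show ?thesis using assms by (simp add: prod.atLeast_Suc_lessThan)
  qed
  ultimately have "eps_prod (p - 1) = eps_prod (p - a - 1) * eps_prod (a - 1) * eps_int p q (int a)"
    by (simp add: mult_ac)
  then have "eps_prod (p - 1) * eps_int p q (int a) = eps_prod (p - a - 1) * eps_prod (a - 1)"
    by (simp add: mult.assoc)
  then show ?thesis using eps_prod_nz by (simp add: field_simps)
qed

lemma B_small:
  assumes "0 < b" "b \<le> a" "a < p"
  shows "B (int a) (int b) = (if a = b then - altsgn (int a) * eps_int p q (int a) else 0)"
proof -
  define f where "f = smult (- altsgn (int a)) (RP (p - a) * RP b)"
  define k l where "k = p - a - 1" and "l = b - 1"
  then have kl: "p - a = Suc k" "b = Suc l" using assms by simp_all
  have f: "f = smult (- altsgn (int a)) (RP (Suc k) * RP (Suc l))" by (simp only: f_def kl)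
  have nz: "RP (Suc k) \<noteq> 0" for k
    using RP_degree_coeff[of k] eps_prod_nz[of k] by (metis coeff_0)
  have deg: "degree f = k + l"
    unfolding f using nz RP_degree by (simp add: degree_mult_eq altsgn_def del: eps_rec.simps)
  have "lead_coeff f = - altsgn (int a) * (lead_coeff (RP (Suc k)) * lead_coeff (RP (Suc l)))"
    unfolding f by (simp add: lead_coeff_mult del: eps_rec.simps)
  then have lead: "coeff f (k + l) = - altsgn (int a) * (eps_prod k * eps_prod l)"
    unfolding deg RP_degree using RP_degree_coeff by (simp del: eps_rec.simps)
  have "B (int a) (int b) = (\<Sum>z\<in>Z. poly f z / parabolic_root.dP p q z)"
    unfolding B_def
  proof (rule sum.cong)
    fix z assume "z \<in> Z"
    then interpret parabolic_root p q z by (rule Z_root)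
    have "j * R (int a) = - altsgn (int a) * R (int p - int a)"
      unfolding R_reflect[of "int a"] by (simp add: mult.assoc[symmetric])
    moreover have "R (int p - int a) = poly (RP (p - a)) z" "R (int b) = poly (RP b) z"
      using assms by (simp_all add: R_def poly_eps_rec nat_diff_distrib)
    ultimately show "j * R (int a) * R (int b) / dP = poly f z / dP"
      by (simp add: f_def mult.assoc)
  qed simp
  also have "\<dots> = coeff f (p - 2) / eps_prod (p - 1)"
    using assms by (intro sum_Z) (simp add: deg k_def l_def)
  also have "\<dots> = (if a = b then - altsgn (int a) * eps_int p q (int a) else 0)"
  proof (cases "a = b")
    case True
    then have "p - 2 = k + l" using assms unfolding k_def l_def by linarith
    then have "coeff f (p - 2) / eps_prod (p - 1) =
        - altsgn (int a) * (eps_prod (p - a - 1) * eps_prod (a - 1) / eps_prod (p - 1))"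
      using lead True by (simp add: k_def l_def)
    then show ?thesis using eps_prod_reflect[of a] assms True by (simp only: if_True simp_thms)
  next
    case False
    then have "coeff f (p - 2) = 0" using assms by (intro coeff_eq_0) (simp add: deg k_def l_def)
    then show ?thesis using False by simp
  qed
  finally show ?thesis .
qed

definition norm_R :: "int \<Rightarrow> complex" where "norm_R a = B a a"

lemma B_congL:
  assumes "2 * int p dvd a - a' \<or> 2 * int p dvd a + a'"
  shows "B a b = B a' b"
proof -
  have "parabolic_root.R p q z a = parabolic_root.R p q z a'" if "z \<in> Z" for z
  proof -
    interpret parabolic_root p q z using that by (rule Z_root)
    have *: "R (i + 2 * int p * d) = R i" for i d
    proof (induction d rule: int_induct[of _ 0])
      case (step1 d)
      then show ?case using R_add_2p[of "i + 2 * int p * d"] by (simp add: algebra_simps)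
    next
      case (step2 d)
      then show ?case using R_add_2p[of "i + 2 * int p * (d - 1)"] by (simp add: algebra_simps)
    qed simp
    from assms show ?thesis
    proof
      assume "2 * int p dvd a - a'"
      then obtain d where "a - a' = 2 * int p * d" by (elim dvdE)
      then have "a = a' + 2 * int p * d" by simp
      then show ?thesis using *[of a' d] by simp
    next
      assume "2 * int p dvd a + a'"
      then obtain d where "a + a' = 2 * int p * d" by (elim dvdE)
      then have "a = - a' + 2 * int p * d" by simp
      then show ?thesis using *[of "- a'" d] by simp
    qed
  qed
  then show ?thesis by (simp add: B_def cong: sum.cong)
qed

lemma B_congR:
  assumes "2 * int p dvd b - b' \<or> 2 * int p dvd b + b'"
  shows "B a b = B a b'"
  using B_congL[OF assms] B_commute by simp

lemma fold_index:
  obtains a' :: nat where "a' \<le> p" "2 * int p dvd a - int a' \<or> 2 * int p dvd a + int a'"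
proof -
  define r where "r = a mod (2 * int p)"
  have r: "0 \<le> r" "r < 2 * int p" using p0 by (simp_all add: r_def)
  have d: "2 * int p dvd a - r" by (simp add: r_def)
  show thesis
  proof (cases "r \<le> int p")
    case True
    with r d show thesis by (intro that[of "nat r"]) auto
  next
    case False
    have "2 * int p dvd (a - r) + 2 * int p" using d by (intro dvd_add) simp_all
    then have "2 * int p dvd a + (2 * int p - r)" by (simp add: algebra_simps)
    with r False show thesis by (intro that[of "nat (2 * int p - r)"]) auto
  qed
qed

lemma B_dvd: "int p dvd a \<Longrightarrow> B a b = 0"
  by (simp add: B_def parabolic_root.R_dvd[OF Z_root] cong: sum.cong)

lemma B_eq_0:
  assumes "\<not> 2 * int p dvd a - b" "\<not> 2 * int p dvd a + b"
  shows "B a b = 0"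
proof -
  obtain a' where a': "a' \<le> p" "2 * int p dvd a - int a' \<or> 2 * int p dvd a + int a'"
    by (rule fold_index)
  obtain b' where b': "b' \<le> p" "2 * int p dvd b - int b' \<or> 2 * int p dvd b + int b'"
    by (rule fold_index)
  have "a' \<noteq> b'"
  proof
    assume "a' = b'"
    then have "2 * int p dvd a - b \<or> 2 * int p dvd a + b"
      using a'(2) b'(2) dvd_diff[of "2 * int p" "a - int a'" "b - int b'"]
        dvd_add[of "2 * int p" "a - int a'" "b + int b'"] dvd_add[of "2 * int p" "a + int a'" "b - int b'"]
        dvd_diff[of "2 * int p" "a + int a'" "b + int b'"]
      by auto
    with assms show False by simp
  qed
  have "B a b = B (int a') (int b')" using B_congL[OF a'(2)] B_congR[OF b'(2)] by simp
  also have "\<dots> = 0"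
  proof (cases "a' \<in> {0, p} \<or> b' \<in> {0, p}")
    case True
    then show ?thesis using B_dvd[of "int a'" "int b'"] B_dvd[of "int b'" "int a'"] B_commute by auto
  next
    case False
    with a' b' \<open>a' \<noteq> b'\<close> B_small[of b' a'] B_small[of a' b'] B_commute[of "int a'" "int b'"]
    show ?thesis by (cases "b' < a'") auto
  qed
  finally show ?thesis .
qed

lemma B_eq: "B a b = (if 2 * int p dvd a - b \<or> 2 * int p dvd a + b then norm_R b else 0)"
  using B_eq_0[of a b] B_congL[of a b b] by (auto simp: norm_R_def)

lemma norm_R_add_p: "norm_R (a + int p) = - norm_R a"
proof -
  have "parabolic_root.j p q z * parabolic_root.R p q z (a + int p) * parabolic_root.R p q z (a + int p) /
      parabolic_root.dP p q z = - (parabolic_root.j p q z * parabolic_root.R p q z a * parabolic_root.R p q z a /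
      parabolic_root.dP p q z)" if "z \<in> Z" for z
  proof -
    interpret parabolic_root p q z using that by (rule Z_root)
    have "R (a + int p) * R (a + int p) = (altsgn a * altsgn a) * (j * j) * (R a * R a)"
      unfolding R_add_p by (simp only: mult_minus_left mult_minus_right minus_minus mult_ac)
    then show ?thesis by (simp add: mult.assoc j_sq)
  qed
  then show ?thesis by (simp add: norm_R_def B_def sum_negf cong: sum.cong)
qed

lemma norm_R_eq:
  assumes "\<not> int p dvd a"
  shows "norm_R a = - altsgn a * eps_int p q a * altsgn (a div int p)"
proof -
  define r m where "r = a mod int p" and "m = a div int p"
  have a: "a = r + m * int p" by (simp add: r_def m_def)
  have r: "0 < r" "r < int p"
    using assms p0 by (simp_all add: r_def dvd_eq_mod_eq_0 order.not_eq_order_implies_strict)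
  have "norm_R (r + m * int p) = - altsgn (r + m * int p) * eps_int p q (r + m * int p) * altsgn m"
  proof (induction m rule: int_induct[of _ 0])
    case base
    obtain s where s: "r = int s" using r zero_less_imp_eq_int by blast
    show ?case using B_small[of s s] r by (simp add: s norm_R_def)
  next
    case (step1 m)
    have e: "r + (m + 1) * int p = (r + m * int p) + int p" by (simp add: algebra_simps)
    show ?case unfolding e norm_R_add_p step1 eps_int_add_p altsgn_add[of _ "int p"]
      using op by (simp add: altsgn_def)
  next
    case (step2 m)
    have e: "r + m * int p = (r + (m - 1) * int p) + int p" by (simp add: algebra_simps)
    show ?case using step2(2) unfolding e norm_R_add_p eps_int_add_p altsgn_add[of _ "int p"]
      using op by (simp add: altsgn_def)
  qed
  then show ?thesis unfolding a[symmetric] m_def[symmetric] .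
qed

end

locale two_bridge' = two_bridge +
  assumes q1: "q \<noteq> 1"
begin

lemma q2: "q + 2 \<le> p" "3 \<le> q"
proof -
  have "p \<noteq> q + 1" using op oq by auto
  then show "q + 2 \<le> p" using qp by simp
  have "q \<noteq> 2" using oq by auto
  then show "3 \<le> q" using q0 q1 by linarith
qed

lemma not_dvd_n_pm: "\<not> int p dvd n + 1" "\<not> int p dvd n - 1"
proof -
  have 1: "\<not> int p dvd int q + 1" using q2 zdvd_not_zless[of "int q + 1" "int p"] by simp
  have 2: "\<not> int p dvd int q - 1" using q2 zdvd_not_zless[of "int q - 1" "int p"] by simp
  show "\<not> int p dvd n + 1"
  proof
    assume "int p dvd n + 1"
    then have "int p dvd (n + 1) * int q" by simp
    moreover have "(n + 1) * int q = (int q + 1) + h * int p" using n_mult_q by (simp add: algebra_simps)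
    ultimately have "int p dvd int q + 1" by simp
    with 1 show False by simp
  qed
  show "\<not> int p dvd n - 1"
  proof
    assume "int p dvd n - 1"
    then have "int p dvd (n - 1) * int q" by simp
    moreover have "(n - 1) * int q = h * int p - (int q - 1)" using n_mult_q by (simp add: algebra_simps)
    ultimately have "int p dvd h * int p - (int q - 1)" by simp
    then have "int p dvd int q - 1" using dvd_diff[of "int p" "h * int p" "h * int p - (int q - 1)"] by simp
    with 2 show False by simp
  qed
qed

lemma sum_adjoint:
  "(\<Sum>z\<in>Z. parabolic_root.j p q z * z\<^sup>2 * (parabolic_root.R p q z n)\<^sup>2 / parabolic_root.dP p q z) = 0"
proof -
  have "(\<Sum>z\<in>Z. parabolic_root.j p q z * z\<^sup>2 * (parabolic_root.R p q z n)\<^sup>2 / parabolic_root.dP p q z) =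
    B (n + 1) (n + 1) - 2 * B (n + 1) (n - 1) + B (n - 1) (n - 1)"
    unfolding B_def sum_distrib_left sum_subtractf[symmetric] sum.distrib[symmetric]
  proof (rule sum.cong)
    fix z assume "z \<in> Z"
    then interpret parabolic_root p q z by (rule Z_root)
    have "z * R n = - (R (n + 1) - R (n - 1))"
      using mult_R_n[of 1] p0 by (simp add: altsgn_def)
    then have "z\<^sup>2 * (R n)\<^sup>2 = (R (n + 1) - R (n - 1))\<^sup>2" by (metis power2_minus power_mult_distrib)
    then have "j * z\<^sup>2 * (R n)\<^sup>2 / dP = j * (R (n + 1) - R (n - 1))\<^sup>2 / dP" by (simp only: mult.assoc)
    also have "j * (R (n + 1) - R (n - 1))\<^sup>2 = j * R (n + 1) * R (n + 1) - 2 * (j * R (n + 1) * R (n - 1)) +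
        j * R (n - 1) * R (n - 1)"
      by (simp add: power2_eq_square algebra_simps)
    finally show "j * z\<^sup>2 * (R n)\<^sup>2 / dP = j * R (n + 1) * R (n + 1) / dP -
        2 * (j * R (n + 1) * R (n - 1) / dP) + j * R (n - 1) * R (n - 1) / dP"
      by (simp add: diff_divide_distrib add_divide_distrib)
  qed simp
  also have "B (n + 1) (n - 1) = 0"
  proof (rule B_eq_0)
    have "\<not> 2 * int p dvd 2" using p3 zdvd_not_zless[of 2 "2 * int p"] by simp
    then show "\<not> 2 * int p dvd n + 1 - (n - 1)" by simp
    show "\<not> 2 * int p dvd n + 1 + (n - 1)" using not_dvd_n by (simp add: mult_2[symmetric])
  qed
  also have "B (n + 1) (n + 1) = - B (n - 1) (n - 1)"
  proof -
    have d: "(n + 1) div int p = (n - 1) div int p"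
      using div_pred_int[of "int p" "n + 1"] div_pred_int[of "int p" n] not_dvd_n not_dvd_n_pm p0 by simp
    have "eps_int p q (n + 1) = - 1"
      using eps_add_n[of 1] not_dvd_n_pm eps_1 by (simp add: add.commute)
    moreover have "eps_int p q (n - 1) = 1"
    proof -
      have "\<not> int p dvd 1" using p3 by simp
      then have "eps_int p q (- 1) = - 1" using eps_int_uminus[of 1] eps_1 by simp
      then show ?thesis using eps_add_n[of "- 1"] not_dvd_n_pm by (simp add: add.commute)
    qed
    ultimately show ?thesis
      using norm_R_eq[of "n + 1"] norm_R_eq[of "n - 1"] not_dvd_n_pm
      by (simp add: norm_R_def[symmetric] d)
  qed
  finally show ?thesis by simp
qed

definition A :: int where "A = (n - int p - 1) div 2"

lemma A: "2 * A = n - int p - 1"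
  using n_props op by (simp add: A_def)

lemma n_neq: "n \<noteq> int p + 1" "n \<noteq> int p - 1"
  using not_dvd_n_pm by auto

lemma not_dvd_A: "\<not> int p dvd A" "\<not> int p dvd A + 1"
proof -
  show "\<not> int p dvd A"
  proof
    assume "int p dvd A"
    then have "int p dvd 2 * A + (int p)" by simp
    then show False using not_dvd_n_pm by (simp add: A)
  qed
  show "\<not> int p dvd A + 1"
  proof
    assume "int p dvd A + 1"
    then have "int p dvd 2 * (A + 1) + int p" using dvd_add[OF dvd_mult dvd_refl] by blast
    moreover have "2 * (A + 1) + int p = n + 1" using A by simp
    ultimately show False using not_dvd_n_pm by (simp only:)
  qed
qed

lemma eps_A: "eps_int p q (A + 1) = - eps_int p q A"
proof -
  have "even (h - int q)" "odd (int q)" using odd_h oq by simp_all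
  then obtain u v where u: "h - int q = 2 * u" and v: "int q = 2 * v + 1" by (elim evenE oddE)
  have "2 * A * int q = n * int q - (int p + 1) * int q" unfolding A by (simp add: algebra_simps)
  also have "\<dots> = (h - int q) * int p + (1 - int q)" unfolding n_mult_q by (simp add: algebra_simps)
  finally have A1: "A * int q = u * int p - v" unfolding u by (simp add: v)
  have v': "0 < v" "v + 1 < int p" using q2 v by simp_all
  have "A * int q = (int p - v) + (u - 1) * int p" using A1 by (simp add: algebra_simps)
  then have "A * int q div int p = u - 1" using v' by simp
  moreover have "(A + 1) * int q = (v + 1) + u * int p" using A1 v by (simp add: algebra_simps)
  then have "(A + 1) * int q div int p = u" using v' by simp
  ultimately show ?thesis by (simp add: eps_int_def)
qed

lemma norm_R_A: "norm_R (A + 1) = norm_R A" "norm_R A \<in> {1, - 1}"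
proof -
  have "(A + 1) div int p = A div int p" using div_pred_int[of "int p" "A + 1"] not_dvd_A p0 by simp
  then show "norm_R (A + 1) = norm_R A"
    using norm_R_eq[of A] norm_R_eq[of "A + 1"] not_dvd_A eps_A by simp
  show "norm_R A \<in> {1, - 1}"
    using norm_R_eq[of A] not_dvd_A by (auto simp: eps_int_def altsgn_def)
qed

lemma sum_indicator:
  fixes g :: "int \<Rightarrow> complex"
  assumes "\<And>i. g (i + int p) = g i"
  shows "(\<Sum>i\<in>{0..<int p}. (if int p dvd i - c then 1 else 0) * g i) = g c"
proof -
  have "(\<Sum>i\<in>{0..<0 + int p}. (if int p dvd (i + c) - c then 1 else 0) * g (i + c)) =
      (\<Sum>i\<in>{0..<0 + int p}. (if int p dvd i - c then 1 else 0) * g i)"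
  proof (rule sum_periodic_shift)
    fix i
    have e: "i + int p - c = i - c + int p" by simp
    show "(if int p dvd i + int p - c then 1 else 0) * g (i + int p) = (if int p dvd i - c then 1 else 0) * g i"
      unfolding e by (simp add: assms)
  qed (use p0 in simp)
  then have "(\<Sum>i\<in>{0..<int p}. (if int p dvd i - c then 1 else 0) * g i) =
      (\<Sum>i\<in>{0..<int p}. (if int p dvd i then 1 else 0) * g (i + c))" by simp
  also have "\<dots> = (\<Sum>i\<in>{0}. (if int p dvd i then 1 else 0) * g (i + c))"
  proof (rule sum.mono_neutral_right)
    show "\<forall>i\<in>{0..<int p} - {0}. (if int p dvd i then 1 else 0) * g (i + c) = 0"
      using zdvd_not_zless by auto
  qed (use p0 in auto)
  finally show ?thesis by simp
qed

text \<open>The trace is computed in the basis \<open>R\<^sub>1, \<dots>, R\<^bsub>p-1\<^esub>\<close>, which is orthogonal for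
  \<^const>\<open>B\<close>; only four products have a diagonal entry.\<close>

lemma sum_tautological:
  "(\<Sum>z\<in>Z. parabolic_root.j p q z * z\<^sup>2 * parabolic_root.R p q z n) \<in> {4, - 4}"
proof -
  define t where "t i = - altsgn i * (B (int p + i + 1) (n + i) - B (int p + i + 1) (n - i) -
    B (int p + i - 1) (n + i) + B (int p + i - 1) (n - i))" for i
  define term_of where "term_of i z = - altsgn (int i) * (
      parabolic_root.j p q z * parabolic_root.R p q z (int p + int i + 1) * parabolic_root.R p q z (n + int i) / parabolic_root.dP p q z -
      parabolic_root.j p q z * parabolic_root.R p q z (int p + int i + 1) * parabolic_root.R p q z (n - int i) / parabolic_root.dP p q z -
      parabolic_root.j p q z * parabolic_root.R p q z (int p + int i - 1) * parabolic_root.R p q z (n + int i) / parabolic_root.dP p q z +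
      parabolic_root.j p q z * parabolic_root.R p q z (int p + int i - 1) * parabolic_root.R p q z (n - int i) / parabolic_root.dP p q z)"
    for i :: nat and z
  have 1: "parabolic_root.j p q z * z\<^sup>2 * parabolic_root.R p q z n = (\<Sum>i\<in>{1..<p}. term_of i z)"
    if "z \<in> Z" for z
  proof -
    interpret parabolic_root p q z using that by (rule Z_root)
    have "dP = - j * (dP * j)" using j_sq by (simp add: mult.left_commute)
    then have dP_eq: "dP = (\<Sum>i\<in>{1..<p}. - j * (altsgn (int i) * eps_int p q (int i) * (R (int i))\<^sup>2))"
      unfolding dP_mult_j sum_distrib_left .
    have "j * z\<^sup>2 * R n * dP =
      (\<Sum>i\<in>{1..<p}. j * z\<^sup>2 * R n * (- j * (altsgn (int i) * eps_int p q (int i) * (R (int i))\<^sup>2)))"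
      by (subst dP_eq) (rule sum_distrib_left)
    then have "j * z\<^sup>2 * R n =
      (\<Sum>i\<in>{1..<p}. j * z\<^sup>2 * R n * (- j * (altsgn (int i) * eps_int p q (int i) * (R (int i))\<^sup>2)) / dP)"
      unfolding sum_divide_distrib[symmetric] by (rule iffD2[OF nonzero_eq_divide_eq[OF dP_nz]])
    also have "\<dots> = (\<Sum>i\<in>{1..<p}. - altsgn (int i) * (
        j * R (int p + int i + 1) * R (n + int i) / dP - j * R (int p + int i + 1) * R (n - int i) / dP -
        j * R (int p + int i - 1) * R (n + int i) / dP + j * R (int p + int i - 1) * R (n - int i) / dP))"
    proof (rule sum.cong)
      fix i assume i: "i \<in> {1..<p}"
      let ?i = "int i"
      have a: "z * R n * R ?i = altsgn ?i * (R (n + ?i) - R (n - ?i))"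
        using i by (intro mult_R_n) auto
      have b: "z * R ?i = eps_int p q ?i * (R (?i + 1) - R (?i - 1))"
        using R_rec[of ?i] by (simp add: mult.assoc[symmetric])
      have c: "j * R (?i + 1) = altsgn ?i * R (int p + ?i + 1)" "j * R (?i - 1) = altsgn ?i * R (int p + ?i - 1)"
      proof -
        have e: "int p + ?i + 1 = ?i + 1 + int p" "int p + ?i - 1 = ?i - 1 + int p" by simp_all
        show "j * R (?i + 1) = altsgn ?i * R (int p + ?i + 1)" "j * R (?i - 1) = altsgn ?i * R (int p + ?i - 1)"
          unfolding e R_add_p by (simp_all add: mult.assoc[symmetric])
      qed
      have "j * z\<^sup>2 * R n * (- j * (altsgn ?i * eps_int p q ?i * (R ?i)\<^sup>2)) =
        - altsgn ?i * eps_int p q ?i * j * (j * (z * R ?i)) * (z * R n * R ?i)"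
        by (simp add: power2_eq_square mult_ac)
      also have "\<dots> = - altsgn ?i * (eps_int p q ?i * eps_int p q ?i) * j * (j * R (?i + 1) - j * R (?i - 1)) *
          (altsgn ?i * (R (n + ?i) - R (n - ?i)))"
        unfolding a b by (simp only: right_diff_distrib mult_ac)
      also have "\<dots> = - altsgn ?i * (altsgn ?i * altsgn ?i) * j * (R (int p + ?i + 1) - R (int p + ?i - 1)) *
          (R (n + ?i) - R (n - ?i))"
        unfolding c eps_sq by (simp only: right_diff_distrib mult_ac mult_1_left)
      finally have e: "j * z\<^sup>2 * R n * (- j * (altsgn ?i * eps_int p q ?i * (R ?i)\<^sup>2)) =
          - altsgn ?i * (j * R (int p + ?i + 1) * R (n + ?i) - j * R (int p + ?i + 1) * R (n - ?i) -
        j * R (int p + ?i - 1) * R (n + ?i) + j * R (int p + ?i - 1) * R (n - ?i))"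
        by (simp add: algebra_simps)
      show "j * z\<^sup>2 * R n * (- j * (altsgn ?i * eps_int p q ?i * (R ?i)\<^sup>2)) / dP =
          - altsgn ?i * (j * R (int p + ?i + 1) * R (n + ?i) / dP - j * R (int p + ?i + 1) * R (n - ?i) / dP -
        j * R (int p + ?i - 1) * R (n + ?i) / dP + j * R (int p + ?i - 1) * R (n - ?i) / dP)"
        unfolding e by (simp only: times_divide_eq_right[symmetric] diff_divide_distrib add_divide_distrib)
    qed simp
    finally show ?thesis unfolding term_of_def .
  qed
  have "(\<Sum>z\<in>Z. parabolic_root.j p q z * z\<^sup>2 * parabolic_root.R p q z n) = (\<Sum>z\<in>Z. \<Sum>i\<in>{1..<p}. term_of i z)"
    by (rule sum.cong) (simp_all only: 1)
  also have "\<dots> = (\<Sum>i\<in>{1..<p}. \<Sum>z\<in>Z. term_of i z)" by (rule sum.swap)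
  also have "\<dots> = (\<Sum>i\<in>{1..<p}. t (int i))"
    unfolding term_of_def t_def B_def sum_distrib_left sum_subtractf[symmetric] sum.distrib[symmetric] ..
  also have "\<dots> = (\<Sum>i\<in>{1..<int p}. t i)"
    by (rule sum.reindex_bij_witness[where i = nat and j = int]) auto
  also have "\<dots> = (\<Sum>i\<in>{0..<int p}. t i)"
  proof (rule sum.mono_neutral_left)
    show "\<forall>i\<in>{0..<int p} - {1..<int p}. t i = 0"
    proof
      fix i assume "i \<in> {0..<int p} - {1..<int p}"
      then have "i = 0" by auto
      then show "t i = 0" by (simp add: t_def)
    qed
  qed auto
  also have "\<dots> = (\<Sum>i\<in>{0..<int p}.
      (if int p dvd i - A then 1 else 0) * (altsgn i * norm_R (n - i)) +
      (if int p dvd i - (- A) then 1 else 0) * (altsgn i * norm_R (n + i)) -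
      (if int p dvd i - (- (A + 1)) then 1 else 0) * (altsgn i * norm_R (n + i)) -
      (if int p dvd i - (A + 1) then 1 else 0) * (altsgn i * norm_R (n - i)))"
  proof (rule sum.cong)
    fix i
    have p2: "int p dvd k \<longleftrightarrow> 2 * int p dvd 2 * k" for k by simp
    have small: "\<not> 2 * int p dvd k" if "k \<noteq> 0" "- 2 * int p < k" "k < 2 * int p" for k
      using that zdvd_not_zless[of k "2 * int p"] zdvd_not_zless[of "- k" "2 * int p"] by (cases "0 < k") auto
    have n: "\<not> 2 * int p dvd int p + 1 - n" "\<not> 2 * int p dvd int p - 1 - n"
      "\<not> 2 * int p dvd int p + 1 + n" "\<not> 2 * int p dvd int p - 1 + n"
    proof -
      show "\<not> 2 * int p dvd int p + 1 - n" "\<not> 2 * int p dvd int p - 1 - n"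
        using n_props n_neq p3 by (intro small; simp)+
      have "\<not> 2 * int p dvd int p + 1 + n - 2 * int p" "\<not> 2 * int p dvd int p - 1 + n - 2 * int p"
        using n_props n_neq p3 by (intro small; simp)+
      then show "\<not> 2 * int p dvd int p + 1 + n" "\<not> 2 * int p dvd int p - 1 + n"
        by (metis dvd_diff dvd_refl)+
    qed
    have shift: "2 * int p dvd k + 2 * int p \<longleftrightarrow> 2 * int p dvd k" for k by simp
    have 1: "B (int p + i + 1) (n + i) = (if int p dvd i - (- (A + 1)) then norm_R (n + i) else 0)"
    proof -
      have "int p + i + 1 - (n + i) = int p + 1 - n" "int p + i + 1 + (n + i) = 2 * (i - (- (A + 1))) + 2 * int p"
        using A by simp_all
      then show ?thesis unfolding B_eq p2 using n shift by presburger
    qed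
    have 2: "B (int p + i + 1) (n - i) = (if int p dvd i - A then norm_R (n - i) else 0)"
    proof -
      have "int p + i + 1 + (n - i) = int p + 1 + n" "int p + i + 1 - (n - i) = 2 * (i - A)"
        using A by simp_all
      then show ?thesis unfolding B_eq p2 using n shift by presburger
    qed
    have 3: "B (int p + i - 1) (n + i) = (if int p dvd i - (- A) then norm_R (n + i) else 0)"
    proof -
      have "int p + i - 1 - (n + i) = int p - 1 - n" "int p + i - 1 + (n + i) = 2 * (i - (- A)) + 2 * int p"
        using A by simp_all
      then show ?thesis unfolding B_eq p2 using n shift by presburger
    qed
    have 4: "B (int p + i - 1) (n - i) = (if int p dvd i - (A + 1) then norm_R (n - i) else 0)"
    proof -
      have "int p + i - 1 + (n - i) = int p - 1 + n" "int p + i - 1 - (n - i) = 2 * (i - (A + 1))"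
        using A by simp_all
      then show ?thesis unfolding B_eq p2 using n shift by presburger
    qed
    show "t i = (if int p dvd i - A then 1 else 0) * (altsgn i * norm_R (n - i)) +
      (if int p dvd i - (- A) then 1 else 0) * (altsgn i * norm_R (n + i)) -
      (if int p dvd i - (- (A + 1)) then 1 else 0) * (altsgn i * norm_R (n + i)) -
      (if int p dvd i - (A + 1) then 1 else 0) * (altsgn i * norm_R (n - i))"
      unfolding t_def 1 2 3 4 by (simp add: algebra_simps)
  qed simp
  also have "\<dots> = altsgn A * norm_R (n - A) + altsgn (- A) * norm_R (n + - A) -
      altsgn (- (A + 1)) * norm_R (n + - (A + 1)) - altsgn (A + 1) * norm_R (n - (A + 1))"
  proof -
    have per: "altsgn (i + int p) * norm_R (n + (i + int p)) = altsgn i * norm_R (n + i)"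
      "altsgn (i + int p) * norm_R (n - (i + int p)) = altsgn i * norm_R (n - i)" for i
      using norm_R_add_p[of "n + i"] norm_R_add_p[of "n - (i + int p)"] op
      by (simp_all add: altsgn_def algebra_simps)
    show ?thesis unfolding sum_subtractf sum.distrib
      using sum_indicator[of "\<lambda>i. altsgn i * norm_R (n - i)", OF per(2)]
        sum_indicator[of "\<lambda>i. altsgn i * norm_R (n + i)", OF per(1)] by presburger
  qed
  also have "\<dots> = 2 * altsgn A * (norm_R (n - A) + norm_R (n - A - 1))"
    by (simp add: altsgn_def algebra_simps)
  also have "n - A = (A + 1) + int p" using A by simp
  also have "(A + 1) + int p - 1 = A + int p" by simp
  finally show ?thesis using norm_R_A by (auto simp: norm_R_add_p altsgn_def)
qed

end

section \<open>Two by two matrices and Fox calculus\<close>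

datatype 'a m2 = M2 (e11: 'a) (e12: 'a) (e21: 'a) (e22: 'a)

instantiation m2 :: (comm_ring_1) ring_1
begin

definition "0 = M2 0 0 0 (0 :: 'a)"
definition "1 = M2 1 0 0 (1 :: 'a)"
definition "A + B = M2 (e11 A + e11 B) (e12 A + e12 B) (e21 A + e21 B) (e22 A + e22 (B :: 'a m2))"
definition "A - B = M2 (e11 A - e11 B) (e12 A - e12 B) (e21 A - e21 B) (e22 A - e22 (B :: 'a m2))"
definition "- A = M2 (- e11 A) (- e12 A) (- e21 A) (- e22 (A :: 'a m2))"
definition "A * B = M2 (e11 A * e11 B + e12 A * e21 B) (e11 A * e12 B + e12 A * e22 B)
  (e21 A * e11 B + e22 A * e21 B) (e21 A * e12 B + e22 A * e22 (B :: 'a m2))"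

instance
  by intro_classes
    (auto simp: zero_m2_def one_m2_def plus_m2_def minus_m2_def uminus_m2_def times_m2_def
      algebra_simps intro: m2.expand)

end

lemmas m2_defs = zero_m2_def one_m2_def plus_m2_def minus_m2_def uminus_m2_def times_m2_def

lemma m2_sel [simp]:
  "e11 (A + B) = e11 A + e11 B" "e12 (A + B) = e12 A + e12 B"
  "e21 (A + B) = e21 A + e21 B" "e22 (A + B) = e22 A + e22 B"
  "e11 (A - B) = e11 A - e11 B" "e12 (A - B) = e12 A - e12 B"
  "e21 (A - B) = e21 A - e21 B" "e22 (A - B) = e22 A - e22 B"
  "e11 (- A) = - e11 A" "e12 (- A) = - e12 A" "e21 (- A) = - e21 A" "e22 (- A) = - e22 A"
  "e11 0 = 0" "e12 0 = 0" "e21 0 = 0" "e22 0 = 0"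
  "e11 1 = 1" "e12 1 = 0" "e21 1 = 0" "e22 1 = 1"
  "e11 (A * B) = e11 A * e11 B + e12 A * e21 B" "e12 (A * B) = e11 A * e12 B + e12 A * e22 B"
  "e21 (A * B) = e21 A * e11 B + e22 A * e21 B" "e22 (A * B) = e21 A * e12 B + e22 A * e22 B"
  by (simp_all add: m2_defs)

definition mat_m2 :: "'a m2 \<Rightarrow> 'a mat" where
  "mat_m2 A = mat_of_rows_list 2 [[e11 A, e12 A], [e21 A, e22 A]]"

lemma mat_m2_carrier [simp]: "mat_m2 A \<in> carrier_mat 2 2" "dim_row (mat_m2 A) = 2" "dim_col (mat_m2 A) = 2"
  by (simp_all add: mat_m2_def mat_of_rows_list_def numeral_2_eq_2)

lemma mat_m2_index [simp]:
  "mat_m2 A $$ (0, 0) = e11 A" "mat_m2 A $$ (0, Suc 0) = e12 A"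
  "mat_m2 A $$ (Suc 0, 0) = e21 A" "mat_m2 A $$ (Suc 0, Suc 0) = e22 A"
  by (simp_all add: mat_m2_def mat_of_rows_list_def)

lemma mat2_eqI:
  assumes "A \<in> carrier_mat 2 2" "B \<in> carrier_mat 2 2"
    "A $$ (0, 0) = B $$ (0, 0)" "A $$ (0, 1) = B $$ (0, 1)"
    "A $$ (1, 0) = B $$ (1, 0)" "A $$ (1, 1) = B $$ (1, 1)"
  shows "A = B"
  using assms by (intro eq_matI) (auto simp: less_2_cases_iff)

lemma mat_m2_inj: "mat_m2 A = mat_m2 B \<longleftrightarrow> A = B"
proof
  assume eq: "mat_m2 A = mat_m2 B"
  have "mat_m2 A $$ (i, k) = mat_m2 B $$ (i, k)" for i k unfolding eq ..
  from this[of 0 0] this[of 0 "Suc 0"] this[of "Suc 0" 0] this[of "Suc 0" "Suc 0"]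
  show "A = B" by (simp add: m2.expand)
qed simp

lemma mat_m2_mult: "mat_m2 (A * B) = mat_m2 A * mat_m2 B"
proof (rule mat2_eqI)
  have i: "(mat_m2 A * mat_m2 B) $$ (i, k) = mat_m2 A $$ (i, 0) * mat_m2 B $$ (0, k) + mat_m2 A $$ (i, 1) * mat_m2 B $$ (1, k)"
    if "i < 2" "k < 2" for i k
    using that by (simp add: scalar_prod_def numeral_2_eq_2)
  show "mat_m2 A * mat_m2 B \<in> carrier_mat 2 2" by (rule mult_carrier_mat[of _ _ 2]) simp_all
  show "mat_m2 (A * B) $$ (0, 0) = (mat_m2 A * mat_m2 B) $$ (0, 0)"
    "mat_m2 (A * B) $$ (0, 1) = (mat_m2 A * mat_m2 B) $$ (0, 1)"
    "mat_m2 (A * B) $$ (1, 0) = (mat_m2 A * mat_m2 B) $$ (1, 0)"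
    "mat_m2 (A * B) $$ (1, 1) = (mat_m2 A * mat_m2 B) $$ (1, 1)"
    by (simp_all add: i del: index_mult_mat)
qed simp

lemma mat_m2_one: "mat_m2 1 = 1\<^sub>m 2"
  by (rule mat2_eqI) simp_all

lemma mat_m2_surj:
  assumes "A \<in> carrier_mat 2 2"
  shows "A = mat_m2 (M2 (A $$ (0, 0)) (A $$ (0, 1)) (A $$ (1, 0)) (A $$ (1, 1)))"
  by (rule mat2_eqI) (use assms in simp_all)

lemma of_int_m2: "of_int c = M2 (of_int c) 0 0 (of_int c :: 'a::comm_ring_1)"
proof (induction c rule: int_induct[of _ 0])
  case (step1 i)
  then show ?case by (simp add: m2_defs)
next
  case (step2 i)
  then show ?case by (simp add: m2_defs)
qed (simp add: m2_defs)

lemma map_m2_hom: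
  assumes "comm_ring_hom f"
  shows "map_m2 f (A + B) = map_m2 f A + map_m2 f B" "map_m2 f (A * B) = map_m2 f A * map_m2 f B"
    "map_m2 f (- A) = - map_m2 f A" "map_m2 f 0 = 0" "map_m2 f 1 = 1" "map_m2 f (of_int c) = of_int c"
proof -
  interpret comm_ring_hom f by fact
  show "map_m2 f (A + B) = map_m2 f A + map_m2 f B" "map_m2 f (A * B) = map_m2 f A * map_m2 f B"
    "map_m2 f (- A) = - map_m2 f A" "map_m2 f 0 = 0" "map_m2 f 1 = 1" "map_m2 f (of_int c) = of_int c"
    by (cases A; cases B; simp add: m2_defs hom_distribs of_int_m2)+
qed

definition det_m2 :: "'a::comm_ring_1 m2 \<Rightarrow> 'a" where
  "det_m2 A = e11 A * e22 A - e12 A * e21 A"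

lemma det_m2_mult: "det_m2 (A * B) = det_m2 A * det_m2 B"
  by (simp add: det_m2_def algebra_simps)

fun gen_m2 :: "'a::comm_ring_1 \<Rightarrow> gen \<Rightarrow> 'a m2" where
  "gen_m2 x U = M2 1 x 0 1"
| "gen_m2 x V = M2 1 0 x 1"

definition letter_m2 :: "'a::comm_ring_1 \<Rightarrow> letter \<Rightarrow> 'a m2" where
  "letter_m2 x l = gen_m2 (if snd l then x else - x) (fst l)"

definition word_m2 :: "'a::comm_ring_1 \<Rightarrow> word \<Rightarrow> 'a m2" where
  "word_m2 x a = foldr (\<lambda>l A. letter_m2 x l * A) a 1"

lemma word_m2_Nil [simp]: "word_m2 x [] = 1" and
  word_m2_Cons [simp]: "word_m2 x (l # a) = letter_m2 x l * word_m2 x a"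
  by (simp_all add: word_m2_def)

lemma gen_mat_m2: "gen_mat x g = mat_m2 (gen_m2 x g)"
  by (cases g) (simp_all add: mat_m2_def)

lemma word_mat_m2: "word_mat x a = mat_m2 (word_m2 x a)"
proof (induction a)
  case (Cons l a)
  have "word_mat x (l # a) = letter_mat x l * word_mat x a" by (simp add: word_mat_def)
  then show ?case using Cons by (simp add: mat_m2_mult letter_mat_def letter_m2_def gen_mat_m2)
qed (simp add: word_mat_def mat_m2_one)

lemma word_m2_append: "word_m2 x (a @ b) = word_m2 x a * word_m2 x b"
  by (induction a) (simp_all add: mult.assoc)

lemma letter_m2_flip: "letter_m2 x l * letter_m2 x (flip l) = 1" "letter_m2 x (flip l) * letter_m2 x l = 1"
  by (cases l; cases "fst l"; simp add: letter_m2_def m2_defs)+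

lemma letter_m2_inverse:
  "letter_m2 x (g, True) * letter_m2 x (g, False) = 1" "letter_m2 x (g, False) * letter_m2 x (g, True) = 1"
  "letter_m2 x (g, True) * (letter_m2 x (g, False) * A) = A" "letter_m2 x (g, False) * (letter_m2 x (g, True) * A) = A"
  using letter_m2_flip[of x "(g, True)"] by (simp_all add: mult.assoc[symmetric])

lemma word_m2_winv: "word_m2 x (winv a) * word_m2 x a = 1" "word_m2 x a * word_m2 x (winv a) = 1"
proof (induction a)
  case (Cons l a)
  have w: "winv (l # a) = winv a @ [flip l]" by (simp add: winv_def)
  {
    case 1
    have "word_m2 x (winv (l # a)) * word_m2 x (l # a) =
      word_m2 x (winv a) * (letter_m2 x (flip l) * letter_m2 x l) * word_m2 x a"
      by (simp add: w word_m2_append mult.assoc)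
    then show ?case using Cons by (simp add: letter_m2_flip)
  next
    case 2
    have "word_m2 x (l # a) * word_m2 x (winv (l # a)) =
      letter_m2 x l * (word_m2 x a * word_m2 x (winv a)) * letter_m2 x (flip l)"
      by (simp add: w word_m2_append mult.assoc)
    then show ?case using Cons by (simp add: letter_m2_flip)
  }
qed (simp_all add: winv_def)

lemma word_m2_det: "det_m2 (word_m2 x a) = 1"
proof (induction a)
  case (Cons l a)
  have "det_m2 (letter_m2 x l) = 1"
    by (cases "fst l") (simp_all add: letter_m2_def det_m2_def)
  then show ?case using Cons by (simp add: det_m2_mult)
qed (simp add: det_m2_def)

lemma word_m2_pres_eq:
  assumes "pres_eq P a b" "\<And>r. r \<in> P \<Longrightarrow> word_m2 x r = 1"
  shows "word_m2 x a = word_m2 x b"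
  using assms by induction (auto simp: word_m2_append letter_m2_flip)

lemma map_m2_word:
  assumes "comm_ring_hom f"
  shows "map_m2 f (word_m2 x a) = word_m2 (f x) a"
proof (induction a)
  case (Cons l a)
  interpret comm_ring_hom f by fact
  have "map_m2 f (letter_m2 x l) = letter_m2 (f x) l"
    by (cases "fst l") (simp_all add: letter_m2_def hom_distribs)
  then show ?case using Cons by (simp add: map_m2_hom[OF assms])
qed (simp add: map_m2_hom[OF assms])

definition fox_sum :: "'a::comm_ring_1 \<Rightarrow> group_ring \<Rightarrow> 'a m2" where
  "fox_sum x s = (\<Sum>(c, b)\<leftarrow>s. of_int c * word_m2 x b)"

definition ad_sum :: "'a::comm_ring_1 \<Rightarrow> group_ring \<Rightarrow> 'a m2 \<Rightarrow> 'a m2" where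
  "ad_sum x s \<xi> = (\<Sum>(c, b)\<leftarrow>s. of_int c * (word_m2 x b * \<xi> * word_m2 x (winv b)))"

lemma fox_sum_append: "fox_sum x (s @ t) = fox_sum x s + fox_sum x t"
  by (simp add: fox_sum_def)

lemma ad_sum_append: "ad_sum x (s @ t) \<xi> = ad_sum x s \<xi> + ad_sum x t \<xi>"
  by (simp add: ad_sum_def)

lemma of_int_m2_commute: "of_int c * A = A * (of_int c :: 'a::comm_ring_1 m2)"
  by (rule m2.expand) (simp add: of_int_m2 mult.commute)

lemma fox_sum_shift: "fox_sum x (map (\<lambda>(c, b). (c, l # b)) s) = letter_m2 x l * fox_sum x s"
proof (induction s)
  case (Cons t s)
  obtain c b where t: "t = (c, b)" by (cases t)
  have "of_int c * (letter_m2 x l * word_m2 x b) = letter_m2 x l * (of_int c * word_m2 x b)"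
    unfolding mult.assoc[symmetric] of_int_m2_commute[of c "letter_m2 x l"] ..
  then show ?case using Cons by (simp add: fox_sum_def t distrib_left)
qed (simp add: fox_sum_def)

lemma ad_sum_shift:
  "ad_sum x (map (\<lambda>(c, b). (c, l # b)) s) \<xi> = letter_m2 x l * ad_sum x s \<xi> * letter_m2 x (flip l)"
proof (induction s)
  case (Cons t s)
  obtain c b where t: "t = (c, b)" by (cases t)
  have w: "winv (l # b) = winv b @ [flip l]" by (simp add: winv_def)
  have "of_int c * (letter_m2 x l * word_m2 x b * \<xi> * (word_m2 x (winv b) * letter_m2 x (flip l))) =
      letter_m2 x l * (of_int c * (word_m2 x b * \<xi> * word_m2 x (winv b))) * letter_m2 x (flip l)"
    unfolding mult.assoc[symmetric] of_int_m2_commute[of c "letter_m2 x l"] ..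
  then show ?case using Cons by (simp add: ad_sum_def t w word_m2_append distrib_left distrib_right)
qed (simp add: ad_sum_def)

lemma fox_sum_Cons:
  "fox_sum x (fox g (l # a)) = fox_sum x (fox g [l]) + letter_m2 x l * fox_sum x (fox g a)"
  by (simp add: fox_sum_append fox_sum_shift)

lemma fox_sum_fox_append:
  "fox_sum x (fox g (a @ b)) = fox_sum x (fox g a) + word_m2 x a * fox_sum x (fox g b)"
proof (induction a)
  case (Cons l a)
  then show ?case
    using fox_sum_Cons[of x g l "a @ b"] fox_sum_Cons[of x g l a] by (simp add: algebra_simps)
qed (simp add: fox_sum_def)

lemma fox_sum_winv: "fox_sum x (fox g (winv a)) = - (word_m2 x (winv a) * fox_sum x (fox g a))"
proof -
  have "fox_sum x (fox g (winv a @ a)) = 0"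
  proof (induction a)
    case (Cons l a)
    have w: "winv (l # a) @ (l # a) = winv a @ [flip l, l] @ a" by (simp add: winv_def)
    have 1: "fox_sum x (fox g [flip l, l]) = 0"
      by (cases l; cases "snd l"; cases "fst l = g")
        (auto simp: fox_sum_def letter_m2_flip letter_m2_flip(1)[of x "(g, True)", simplified] algebra_simps)
    have 2: "word_m2 x [flip l, l] = 1" by (simp add: letter_m2_flip)
    have "fox_sum x (fox g (winv (l # a) @ (l # a))) = fox_sum x (fox g (winv a @ a))"
      unfolding w fox_sum_fox_append 1 2 by simp
    then show ?case using Cons by simp
  qed (simp add: winv_def fox_sum_def)
  then show ?thesis by (simp add: fox_sum_fox_append eq_neg_iff_add_eq_0)
qed

text \<open>The crossed homomorphism \<open>c(ab) = c(a) + Ad(a) c(b)\<close> with given values on the generators.\<close>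

fun cross :: "'a::comm_ring_1 \<Rightarrow> (gen \<Rightarrow> 'a m2) \<Rightarrow> word \<Rightarrow> 'a m2" where
  "cross x \<xi> [] = 0"
| "cross x \<xi> (l # a) =
    (if snd l then \<xi> (fst l) else - (letter_m2 x l * \<xi> (fst l) * letter_m2 x (flip l))) +
    letter_m2 x l * cross x \<xi> a * letter_m2 x (flip l)"

lemma ad_sum_fox_Cons:
  "ad_sum x (fox g (l # a)) \<xi> =
    (if fst l = g then if snd l then \<xi> else - (letter_m2 x l * \<xi> * letter_m2 x (flip l)) else 0) +
    letter_m2 x l * ad_sum x (fox g a) \<xi> * letter_m2 x (flip l)"
proof -
  have "winv [l] = [flip l]" "winv [] = []" by (simp_all add: winv_def)
  then have "ad_sum x [(1, [])] \<xi> = \<xi>" "ad_sum x [(- 1, [l])] \<xi> = - (letter_m2 x l * \<xi> * letter_m2 x (flip l))"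
    "ad_sum x [] \<xi> = 0"
    by (simp_all add: ad_sum_def)
  then show ?thesis by (simp add: ad_sum_append ad_sum_shift)
qed

lemma cross_fox: "cross x \<xi> a = ad_sum x (fox U a) (\<xi> U) + ad_sum x (fox V a) (\<xi> V)"
proof (induction a)
  case (Cons l a)
  then show ?case
    by (cases "fst l") (simp_all add: ad_sum_fox_Cons distrib_left distrib_right del: fox.simps)
qed (simp add: ad_sum_def)

lemma cross_append:
  "cross x \<xi> (a @ b) = cross x \<xi> a + word_m2 x a * cross x \<xi> b * word_m2 x (winv a)"
proof (induction a)
  case (Cons l a)
  have w: "winv (l # a) = winv a @ [flip l]" by (simp add: winv_def)
  show ?case by (simp add: Cons w word_m2_append distrib_left distrib_right mult.assoc)
qed (simp add: winv_def)

lemma cross_pres_eq: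
  assumes "pres_eq {} a b"
  shows "cross x \<xi> a = cross x \<xi> b"
proof -
  have w: "word_m2 x a' = word_m2 x b'" if "pres_eq {} a' b'" for a' b'
    using that by (rule word_m2_pres_eq) simp
  have wi: "word_m2 x (winv a') = word_m2 x (winv b')" if "pres_eq {} a' b'" for a' b'
  proof -
    have "word_m2 x (winv a') = word_m2 x (winv a') * (word_m2 x b' * word_m2 x (winv b'))"
      by (simp add: word_m2_winv)
    also have "\<dots> = word_m2 x (winv a') * word_m2 x a' * word_m2 x (winv b')"
      by (simp add: w[OF that] mult.assoc)
    finally show ?thesis by (simp add: word_m2_winv)
  qed
  from assms show ?thesis
  proof induction
    case (pres_mult a a' b b')
    then show ?case by (simp add: cross_append w[of a a'] wi[of a a'])
  next
    case (pres_cancel l)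
    obtain g b where "l = (g, b)" by (cases l)
    then show ?case by (cases b) (simp_all add: mult.assoc letter_m2_inverse)
  qed auto
qed

lemma cross_principal:
  assumes "\<And>g. \<xi> g = letter_m2 x (g, True) * \<eta> * letter_m2 x (g, False) - \<eta>"
  shows "cross x \<xi> a = word_m2 x a * \<eta> * word_m2 x (winv a) - \<eta>"
proof (induction a)
  case (Cons l a)
  obtain g b where l: "l = (g, b)" by (cases l)
  have w: "winv ((g, b) # a) = winv a @ [(g, \<not> b)]" by (simp add: winv_def)
  show ?case unfolding l w
    by (cases b) (simp_all add: Cons word_m2_append assms[of g] left_diff_distrib right_diff_distrib mult.assoc letter_m2_inverse)
qed (simp add: winv_def)

section \<open>The knot group representation at a root\<close>

context two_bridge
begin

lemma letter_eps:
  "letter_m2 x (g, even (k * q div p)) = gen_m2 (of_int (eps p q k) * x) g"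
  by (simp add: letter_m2_def eps_def minus_one_power_iff)

lemma wword_prefix:
  fixes x :: "'a::comm_ring_1"
  assumes "k \<le> p - 1"
  defines "r \<equiv> eps_rec p q x 0 1" and "s \<equiv> eps_rec p q x 1 0"
  shows "word_m2 x (take k (wword p q)) =
    (if even k then M2 (r (Suc k)) (r k) (s (Suc k)) (s k) else M2 (r k) (r (Suc k)) (s k) (s (Suc k)))"
  using assms(1)
proof (induction k)
  case 0
  show ?case by (simp add: r_def s_def m2_defs)
next
  case (Suc k)
  have "take (Suc k) (wword p q) = take k (wword p q) @ [wword p q ! k]"
    using Suc.prems by (intro take_Suc_conv_app_nth) simp
  moreover have "wword p q ! k = (if even k then U else V, even (Suc k * q div p))"
    using Suc.prems q0 qp cop op oq by (intro nth_wword) simp_all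
  ultimately have "word_m2 x (take (Suc k) (wword p q)) =
      word_m2 x (take k (wword p q)) * gen_m2 (of_int (eps p q (Suc k)) * x) (if even k then U else V)"
    by (simp add: word_m2_append letter_eps del: mult_Suc)
  moreover have "r (Suc (Suc k)) = of_int (eps p q (Suc k)) * x * r (Suc k) + r k"
    "s (Suc (Suc k)) = of_int (eps p q (Suc k)) * x * s (Suc k) + s k"
    by (simp_all add: r_def s_def)
  ultimately show ?case using Suc by (simp add: m2_defs algebra_simps)
qed

lemma word_m2_wword:
  fixes x :: "'a::comm_ring_1"
  shows "word_m2 x (wword p q) = M2 (eps_rec p q x 0 1 p) (eps_rec p q x 0 1 (p - 1))
    (eps_rec p q x 1 0 p) (eps_rec p q x 1 0 (p - 1))"
  using wword_prefix[of "p - 1" x] op p0 by simp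

end

definition swap_gen :: "letter \<Rightarrow> letter" where
  "swap_gen l = (if fst l = U then V else U, snd l)"

lemma word_m2_swap:
  "word_m2 x (map swap_gen a) =
    M2 (e22 (word_m2 x a)) (e21 (word_m2 x a)) (e12 (word_m2 x a)) (e11 (word_m2 x a))"
proof (induction a)
  case (Cons l a)
  have "letter_m2 x (swap_gen l) = M2 (e22 (letter_m2 x l)) (e21 (letter_m2 x l)) (e12 (letter_m2 x l)) (e11 (letter_m2 x l))"
    by (cases "fst l") (simp_all add: letter_m2_def swap_gen_def)
  then show ?case using Cons by (simp add: m2_defs algebra_simps)
qed (simp add: m2_defs)

lemma word_m2_winv_eq:
  "word_m2 x (winv a) = M2 (e22 (word_m2 x a)) (- e12 (word_m2 x a)) (- e21 (word_m2 x a)) (e11 (word_m2 x a))"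
proof -
  let ?A = "word_m2 x a"
  let ?B = "M2 (e22 ?A) (- e12 ?A) (- e21 ?A) (e11 ?A)"
  have "e11 ?A * e22 ?A - e12 ?A * e21 ?A = 1" using word_m2_det[of x a] by (simp add: det_m2_def)
  then have "?A * ?B = 1"
    by (intro m2.expand) (simp add: algebra_simps)
  then have "word_m2 x (winv a) = word_m2 x (winv a) * (?A * ?B)" by simp
  then show ?thesis by (simp only: mult.assoc[symmetric] word_m2_winv mult_1_left)
qed

lemma e21_conj_F: "e21 (word_m2 x a * M2 0 0 1 0 * word_m2 x (winv a)) = (e22 (word_m2 x a))\<^sup>2"
  by (simp add: word_m2_winv_eq power2_eq_square)

definition sc :: "'a::comm_ring_1 \<Rightarrow> 'a m2" where "sc c = M2 c 0 0 c"

lemma sc_commute: "A * sc c = sc c * A"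
  by (rule m2.expand) (simp add: sc_def mult.commute)

lemma ad_sum_add: "ad_sum x s (\<xi> + \<eta>) = ad_sum x s \<xi> + ad_sum x s \<eta>"
  by (induction s) (auto simp: ad_sum_def distrib_left distrib_right)

lemma ad_sum_sc: "ad_sum x s (sc c * \<xi>) = sc c * ad_sum x s \<xi>"
proof (induction s)
  case (Cons t s)
  obtain d b where t: "t = (d, b)" by (cases t)
  have "of_int d * (word_m2 x b * (sc c * \<xi>) * word_m2 x (winv b)) =
      sc c * (of_int d * (word_m2 x b * \<xi> * word_m2 x (winv b)))"
    unfolding mult.assoc[symmetric] sc_commute[of "word_m2 x b"] of_int_m2_commute[of d "sc c"]
    unfolding mult.assoc sc_commute[symmetric] by (simp add: mult.assoc[symmetric] sc_commute)
  then show ?case using Cons by (simp add: ad_sum_def t distrib_left)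
qed (simp add: ad_sum_def)

lemma ad_sum_zero [simp]: "ad_sum x s 0 = 0"
  by (induction s) (auto simp: ad_sum_def)

lemma ad_sum_trace:
  assumes "e11 \<xi> + e22 \<xi> = 0"
  shows "e11 (ad_sum x s \<xi>) + e22 (ad_sum x s \<xi>) = 0"
proof (induction s)
  case (Cons t s)
  obtain d b where t: "t = (d, b)" by (cases t)
  let ?A = "word_m2 x b"
  have d: "e11 ?A * e22 ?A - e12 ?A * e21 ?A = 1" using word_m2_det[of x b] by (simp add: det_m2_def)
  have "e11 (?A * \<xi> * word_m2 x (winv b)) + e22 (?A * \<xi> * word_m2 x (winv b)) =
    (e11 ?A * e22 ?A - e12 ?A * e21 ?A) * (e11 \<xi> + e22 \<xi>)"
    by (simp add: word_m2_winv_eq algebra_simps)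
  then have 0: "e11 (?A * \<xi> * word_m2 x (winv b)) + e22 (?A * \<xi> * word_m2 x (winv b)) = 0" using assms by simp
  have "e11 (of_int d * (?A * \<xi> * word_m2 x (winv b))) + e22 (of_int d * (?A * \<xi> * word_m2 x (winv b))) =
     of_int d * (e11 (?A * \<xi> * word_m2 x (winv b)) + e22 (?A * \<xi> * word_m2 x (winv b)))"
    by (simp only: of_int_m2 m2_sel m2.sel) (simp add: algebra_simps)
  then have "e11 (of_int d * (?A * \<xi> * word_m2 x (winv b))) + e22 (of_int d * (?A * \<xi> * word_m2 x (winv b))) = 0"
    by (simp only: 0 mult_zero_right)
  then show ?case using Cons by (simp add: ad_sum_def t algebra_simps add_eq_0_iff del: m2_sel(15-))
qed (simp add: ad_sum_def)

lemma cross_winv: "cross x \<xi> (winv a) = - (word_m2 x (winv a) * cross x \<xi> a * word_m2 x a)"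
proof -
  have "cross x \<xi> (winv a @ a) = cross x \<xi> []"
    by (rule cross_pres_eq) (rule pres_eq_winv_left)
  then show ?thesis by (simp add: cross_append eq_neg_iff_add_eq_0)
qed

definition sl2_E :: "complex m2" where "sl2_E = M2 0 1 0 0"
definition sl2_H :: "complex m2" where "sl2_H = M2 (1 / 2) 0 0 (- 1 / 2)"
definition sl2_F :: "complex m2" where "sl2_F = M2 0 0 1 0"

lemmas sl2_defs = sl2_E_def sl2_H_def sl2_F_def

lemma sl2_expand:
  assumes "e11 A + e22 A = 0"
  shows "A = sc (e12 A) * sl2_E + sc (2 * e11 A) * sl2_H + sc (e21 A) * sl2_F"
  using assms by (intro m2.expand) (auto simp: sc_def sl2_defs eq_neg_iff_add_eq_0 add.commute)

lemma cross_deriv: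
  "cross z (case_gen sl2_E sl2_F) a =
    map_m2 (\<lambda>f. poly (pderiv f) z) (word_m2 [:0, 1:] a) * word_m2 z (winv a)"
proof (induction a)
  case Nil
  show ?case by (simp add: m2_defs)
next
  case (Cons l a)
  let ?d = "map_m2 (\<lambda>f :: complex poly. poly (pderiv f) z)" and ?e = "map_m2 (\<lambda>f :: complex poly. poly f z)"
  have prod: "?d (A * B) = ?d A * ?e B + ?e A * ?d B" for A B
    by (cases A; cases B) (simp add: m2_defs pderiv_add pderiv_mult algebra_simps)
  have hom: "comm_ring_hom (\<lambda>f :: complex poly. poly f z)" by unfold_locales simp_all
  have e: "?e (word_m2 [:0, 1:] b) = word_m2 z b" for b
    using map_m2_word[OF hom, of "[:0, 1:]" b] by simp
  have el: "?e (letter_m2 [:0, 1:] l) = letter_m2 z l"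
    using e[of "[l]"] by simp
  have w: "winv (l # a) = winv a @ [flip l]" by (simp add: winv_def)
  have dl: "?d (letter_m2 [:0, 1:] l) * letter_m2 z (flip l) =
      (if snd l then case_gen sl2_E sl2_F (fst l) else - (letter_m2 z l * case_gen sl2_E sl2_F (fst l) * letter_m2 z (flip l)))"
    by (cases "fst l") (simp_all add: letter_m2_def m2_defs sl2_defs pderiv_pCons)
  have "?d (word_m2 [:0, 1:] (l # a)) * word_m2 z (winv (l # a)) =
    ?d (letter_m2 [:0, 1:] l) * (word_m2 z a * word_m2 z (winv a)) * letter_m2 z (flip l) +
    letter_m2 z l * (?d (word_m2 [:0, 1:] a) * word_m2 z (winv a)) * letter_m2 z (flip l)"
    by (simp add: prod e el w word_m2_append distrib_right mult.assoc)
  then show ?case using Cons dl by (simp add: word_m2_winv)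
qed

context parabolic_root
begin

lemma word_m2_w: "word_m2 z (wword p q) = M2 0 j j Q"
proof -
  have 1: "eps_rec p q z 0 1 (p - 1) = j" "eps_rec p q z 1 0 (p - 1) = Q"
    using p0 by (simp_all add: j_def Q_def R_def R'_def nat_diff_distrib)
  have W: "word_m2 z (wword p q) = M2 0 j (eps_rec p q z 1 0 p) Q"
    using word_m2_wword[of z] root 1 by simp
  have "- (j * eps_rec p q z 1 0 p) = 1"
    using word_m2_det[of z "wword p q"] by (simp add: W det_m2_def)
  then have "j * (- (j * eps_rec p q z 1 0 p)) = j" by simp
  then have "eps_rec p q z 1 0 p = j" using j_sq by (simp add: mult.assoc[symmetric])
  then show ?thesis using W by simp
qed

lemma word_m2_w_inv: "word_m2 z (winv (wword p q)) = M2 Q (- j) (- j) 0"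
  by (simp add: word_m2_winv_eq word_m2_w)

lemma wu_winv: "M2 0 j j Q * M2 1 z 0 1 * M2 Q (- j) (- j) 0 = M2 1 0 z 1"
  using j_sq by (simp add: times_m2_def algebra_simps)

lemma word_m2_relator: "word_m2 z (relator p q) = 1"
proof -
  have "word_m2 z (relator p q) = (M2 0 j j Q * M2 1 z 0 1 * M2 Q (- j) (- j) 0) * M2 1 0 (- z) 1"
    by (simp add: relator_def word_m2_append word_m2_w word_m2_w_inv letter_m2_def mult.assoc)
  then show ?thesis unfolding wu_winv by (simp add: m2_defs)
qed

lemma rev_wword: "rev (wword p q) = map swap_gen (wword p q)"
proof (rule nth_equalityI)
  fix i assume "i < length (rev (wword p q))"
  then have i: "i < p - 1" by simp
  have "rev (wword p q) ! i = wword p q ! (p - 2 - i)"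
    using i by (simp add: rev_nth numeral_2_eq_2)
  also have "\<dots> = (if even (p - 2 - i) then U else V, even (Suc (p - 2 - i) * q div p))"
    using i by (intro nth_wword) simp
  also have "Suc (p - 2 - i) = p - Suc i" using i by simp
  also have "even ((p - Suc i) * q div p) \<longleftrightarrow> even (Suc i * q div p)"
    using i by (intro even_eps_reflect[OF q0 qp cop op oq]) simp_all
  also have "even (p - 2 - i) \<longleftrightarrow> odd i" using i op by auto
  finally show "rev (wword p q) ! i = map swap_gen (wword p q) ! i"
    using i by (simp add: nth_wword swap_gen_def)
qed simp

lemma word_m2_rev_w: "word_m2 z (rev (wword p q)) = M2 Q j j 0"
  by (simp add: rev_wword word_m2_swap word_m2_w)

lemma relator_prefix:
  assumes "k < 2 * p"
  shows "e11 (word_m2 z (take k (relator p q))) = (if even k then R (int k + 1) else R (int k)) \<and>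
    e12 (word_m2 z (take k (relator p q))) = (if even k then R (int k) else R (int k + 1))"
  using assms
proof (induction k)
  case (Suc k)
  let ?b = "even ((Suc k * q - 1) div p)"
  have "take (Suc k) (relator p q) = take k (relator p q) @ [relator p q ! k]"
    using Suc.prems by (intro take_Suc_conv_app_nth) (simp add: length_relator[OF q0 qp cop op oq])
  moreover have "relator p q ! k = (if even k then U else V, ?b)"
    using Suc.prems by (intro nth_relator[OF q0 qp cop op oq]) simp
  ultimately have "word_m2 z (take (Suc k) (relator p q)) =
      word_m2 z (take k (relator p q)) * gen_m2 (if ?b then z else - z) (if even k then U else V)"
    by (simp add: word_m2_append letter_m2_def del: mult_Suc)
  moreover have "(if ?b then z else - z) * R (int k + 1) = eps_int p q (int k + 1) * z * R (int k + 1)"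
  proof (cases "int p dvd int k + 1")
    case True
    then show ?thesis by (simp add: R_dvd)
  next
    case False
    then have "\<not> p dvd Suc k" using int_dvd_int_iff[of p "Suc k"] by (simp add: add.commute)
    then have "\<not> p dvd Suc k * q" using coprime_dvd_mult_left_iff[OF cop] by blast
    then have "(Suc k * q - 1) div p = Suc k * q div p" using p0 by (intro div_pred) simp_all
    then have "?b \<longleftrightarrow> eps_int p q (int k + 1) = 1"
      using eps_int_of_nat[of p q "Suc k"] by (simp add: eps_def minus_one_power_iff add.commute del: mult_Suc)
    moreover have "eps_int p q (int k + 1) = 1 \<or> eps_int p q (int k + 1) = - 1"
      by (auto simp: eps_int_def altsgn_def)
    ultimately show ?thesis by auto
  qed
  moreover have "R (int k + 2) = R (int k) + eps_int p q (int k + 1) * z * R (int k + 1)"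
    using R_rec[of "int k + 1"] by (simp add: algebra_simps)
  ultimately show ?case using Suc by (cases "even k") (simp_all add: algebra_simps)
qed simp

lemma sum_odd_even_step:
  fixes f :: "int \<Rightarrow> complex"
  shows "(\<Sum>i | i \<in> {1..<int (Suc k) + 1} \<and> P i. f i) =
    (\<Sum>i | i \<in> {1..<int k + 1} \<and> P i. f i) + (if P (int k + 1) then f (int k + 1) else 0)"
proof -
  have "finite {i. i \<in> {1..<int k + 1} \<and> P i}"
    by (rule finite_subset[of _ "{1..int k}"]) auto
  moreover have "{i. i \<in> {1..<int (Suc k) + 1} \<and> P i} =
      (if P (int k + 1) then insert (int k + 1) {i. i \<in> {1..<int k + 1} \<and> P i} else {i. i \<in> {1..<int k + 1} \<and> P i})"
  proof -
    have "i < 2 + int k \<longleftrightarrow> i < 1 + int k \<or> i = 1 + int k" for i by auto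
    then show ?thesis by (auto simp: add.commute)
  qed
  ultimately show ?thesis by simp
qed

lemma fox_prefix:
  assumes "k \<le> p - 1"
  shows "e12 (fox_sum z (fox U (take k (wword p q)))) = (\<Sum>i | i \<in> {1..<int k + 1} \<and> odd i. fox_term i) \<and>
    e11 (fox_sum z (fox V (take k (wword p q)))) = (\<Sum>i | i \<in> {1..<int k + 1} \<and> even i. fox_term i)"
  using assms
proof (induction k)
  case 0
  have "{i. i \<in> {1..<int 0 + 1} \<and> P i} = {}" for P by auto
  then show ?case by (simp add: fox_sum_def)
next
  case (Suc k)
  let ?b = "even (Suc k * q div p)"
  let ?W = "word_m2 z (take k (wword p q))"
  have t: "take (Suc k) (wword p q) = take k (wword p q) @ [wword p q ! k]"
    using Suc.prems by (intro take_Suc_conv_app_nth) simp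
  have l: "wword p q ! k = (if even k then U else V, ?b)"
    using Suc.prems by (intro nth_wword) simp_all
  have b: "?b \<longleftrightarrow> eps_int p q (int k + 1) = 1"
    using eps_int_of_nat[of p q "Suc k"] by (simp add: eps_def minus_one_power_iff add.commute del: mult_Suc)
  have "eps_int p q (int k + 1) = 1 \<or> eps_int p q (int k + 1) = - 1"
    by (auto simp: eps_int_def altsgn_def)
  then have r: "R (int k + 2) = R (int k) + (if ?b then z else - z) * R (int k + 1)"
    using R_rec[of "int k + 1"] b by (auto simp: algebra_simps)
  have rs: "eps_rec p q z 0 1 k = R (int k)" "eps_rec p q z 0 1 (Suc k) = R (int k + 1)"
    by (simp_all add: R_def nat_add_distrib)
  have W: "e11 ?W = (if even k then R (int k + 1) else R (int k))" "e12 ?W = (if even k then R (int k) else R (int k + 1))"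
    using wword_prefix[of k z] Suc.prems rs by simp_all
  have ft: "fox_term (int k + 1) = (if ?b then R (int k) else - R (int k + 2))"
  proof -
    have e: "int k + 1 + 1 = int k + 2" "int k + 1 - 1 = int k" by simp_all
    show ?thesis unfolding fox_term_def e b ..
  qed
  show ?case
  proof (cases "even k")
    case True
    have "e12 (?W * fox_sum z (fox U [(U, ?b)])) = fox_term (int k + 1)"
      unfolding ft using W True r by (cases ?b) (auto simp: fox_sum_def letter_m2_def algebra_simps)
    moreover have "fox_sum z (fox V [(U, ?b)]) = 0" by (simp add: fox_sum_def)
    ultimately show ?thesis using Suc True
      unfolding t l fox_sum_fox_append sum_odd_even_step by (simp del: mult_Suc fox.simps)
  next
    case False
    have "e11 (?W * fox_sum z (fox V [(V, ?b)])) = fox_term (int k + 1)"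
      unfolding ft using W False r by (cases ?b) (auto simp: fox_sum_def letter_m2_def algebra_simps)
    moreover have "fox_sum z (fox U [(V, ?b)]) = 0" by (simp add: fox_sum_def)
    ultimately show ?thesis using Suc False
      unfolding t l fox_sum_fox_append sum_odd_even_step by (simp del: mult_Suc fox.simps)
  qed
qed

lemma fox_relator:
  defines "u \<equiv> fox_sum z (fox U (relator p q))" and "v \<equiv> fox_sum z (fox V (relator p q))"
  shows "(e12 u * e21 v - e11 v * e22 u) * R n = 2 * j"
proof -
  let ?w = "wword p q"
  let ?W = "M2 0 j j Q" and ?u = "M2 1 z 0 1" and ?v = "M2 1 0 z 1" and ?Wi = "M2 Q (- j) (- j) 0"
  have words: "word_m2 z [(U, True)] = ?u" "word_m2 z [(V, False)] = M2 1 0 (- z) 1"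
    by (simp_all add: letter_m2_def)
  have fu: "fox_sum z (fox U [(U, True)]) = 1" "fox_sum z (fox U [(V, False)]) = 0"
    "fox_sum z (fox V [(U, True)]) = 0" "fox_sum z (fox V [(V, False)]) = - M2 1 0 (- z) 1"
    by (simp_all add: fox_sum_def letter_m2_def)
  have key: "?W * (?u * (?Wi * A)) = ?v * A" for A
    by (simp only: mult.assoc[symmetric] wu_winv)
  have u: "u = fox_sum z (fox U ?w) + ?W - ?v * fox_sum z (fox U ?w)"
    unfolding u_def relator_def fox_sum_fox_append word_m2_append words fu fox_sum_winv word_m2_w word_m2_w_inv
    by (simp add: distrib_left right_diff_distrib mult.assoc key)
  have v: "v = fox_sum z (fox V ?w) - ?v * fox_sum z (fox V ?w) - 1"
  proof -
    have "?v * M2 1 0 (- z) 1 = 1" by (simp add: m2_defs)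
    then show ?thesis
      unfolding v_def relator_def fox_sum_fox_append word_m2_append words fu fox_sum_winv word_m2_w word_m2_w_inv
      by (simp add: distrib_left right_diff_distrib mult.assoc key)
  qed
  have "int (p - 1) + 1 = int p" using p0 by simp
  then have S: "S = e12 (fox_sum z (fox U ?w)) + j * e11 (fox_sum z (fox V ?w))"
    using fox_prefix[of "p - 1"] by (simp add: S_split)
  have "e12 u * e21 v - e11 v * e22 u = Q - z * S"
    unfolding u v S by (simp add: algebra_simps)
  then show ?thesis using minor_mult_R_n by simp
qed

definition C :: "gen \<Rightarrow> complex m2 \<Rightarrow> complex m2" where
  "C g \<xi> = ad_sum z (fox g (relator p q)) \<xi>"

lemma C_add: "C g (\<xi> + \<eta>) = C g \<xi> + C g \<eta>"
  by (simp add: C_def ad_sum_add)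

lemma C_sc: "C g (sc c * \<xi>) = sc c * C g \<xi>"
  by (simp add: C_def ad_sum_sc)

lemma cross_relator: "cross z \<xi> (relator p q) = C U (\<xi> U) + C V (\<xi> V)"
  unfolding C_def by (rule cross_fox)

lemma C_principal:
  "C U (letter_m2 z (U, True) * \<eta> * letter_m2 z (U, False) - \<eta>) +
   C V (letter_m2 z (V, True) * \<eta> * letter_m2 z (V, False) - \<eta>) = 0"
proof -
  define \<xi> where "\<xi> g = letter_m2 z (g, True) * \<eta> * letter_m2 z (g, False) - \<eta>" for g
  have "word_m2 z (winv (relator p q)) = 1"
    by (simp add: word_m2_winv_eq word_m2_relator m2_defs)
  then have "cross z \<xi> (relator p q) = 0"
    using cross_principal[of \<xi> z \<eta> "relator p q"] by (simp add: \<xi>_def word_m2_relator)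
  then show ?thesis by (simp add: cross_relator \<xi>_def)
qed

lemma z_nz: "z \<noteq> 0"
proof
  assume "z = 0"
  have "eps_rec p q 0 0 (1::complex) (Suc (2 * k)) = 1" for k
    by (induction k) simp_all
  moreover have "p = Suc (2 * (p div 2))" using op by simp
  ultimately have "eps_rec p q z 0 1 p = 1" using \<open>z = 0\<close> by metis
  then show False using root by simp
qed

lemma C_relations:
  "C V sl2_F = C U sl2_E" "C U sl2_H = sc (z / 2) * C U sl2_E" "C V sl2_H = - (sc (z / 2) * C U sl2_E)"
proof -
  have "sc (- z) * C U sl2_E + sc z * C V sl2_F = 0"
  proof -
    have "letter_m2 z (U, True) * sl2_H * letter_m2 z (U, False) - sl2_H = sc (- z) * sl2_E"
      "letter_m2 z (V, True) * sl2_H * letter_m2 z (V, False) - sl2_H = sc z * sl2_F"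
      by (simp_all add: letter_m2_def sl2_defs sc_def m2_defs)
    then show ?thesis using C_principal[of sl2_H] by (simp add: C_sc)
  qed
  then have "sc (1 / z) * (sc (- z) * C U sl2_E + sc z * C V sl2_F) = 0" by simp
  moreover have "sc (1 / z) * (sc z * A) = A" "sc (1 / z) * (sc (- z) * A) = - A" for A :: "complex m2"
    using z_nz by (simp_all add: sc_def times_m2_def uminus_m2_def)
  ultimately show F: "C V sl2_F = C U sl2_E" by (simp add: distrib_left)
  have z2: "sc (1 / (2 * z)) * (sc (2 * z) * A) = A" "sc (1 / (2 * z)) * (sc (- 2 * z) * A) = - A"
      "sc (1 / (2 * z)) * (sc (- (z * z)) * A) = - (sc (z / 2) * A)" for A :: "complex m2"
    using z_nz by (simp_all add: sc_def times_m2_def uminus_m2_def)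
  have "sc (2 * z) * C U sl2_H + sc (- (z * z)) * C U sl2_E = 0"
  proof -
    have "letter_m2 z (U, True) * sl2_F * letter_m2 z (U, False) - sl2_F = sc (2 * z) * sl2_H + sc (- (z * z)) * sl2_E"
      "letter_m2 z (V, True) * sl2_F * letter_m2 z (V, False) - sl2_F = 0"
      by (simp_all add: letter_m2_def sl2_defs sc_def m2_defs)
    then show ?thesis using C_principal[of sl2_F] by (simp add: C_sc C_add) (simp add: C_def)
  qed
  then have "sc (1 / (2 * z)) * (sc (2 * z) * C U sl2_H + sc (- (z * z)) * C U sl2_E) = 0" by simp
  then show "C U sl2_H = sc (z / 2) * C U sl2_E" unfolding distrib_left z2 by simp
  have "sc (- 2 * z) * C V sl2_H + sc (- (z * z)) * C V sl2_F = 0"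
  proof -
    have "letter_m2 z (U, True) * sl2_E * letter_m2 z (U, False) - sl2_E = 0"
      "letter_m2 z (V, True) * sl2_E * letter_m2 z (V, False) - sl2_E = sc (- 2 * z) * sl2_H + sc (- (z * z)) * sl2_F"
      by (simp_all add: letter_m2_def sl2_defs sc_def m2_defs)
    then show ?thesis using C_principal[of sl2_E] by (simp add: C_sc C_add) (simp add: C_def)
  qed
  then have "sc (1 / (2 * z)) * (sc (- 2 * z) * C V sl2_H + sc (- (z * z)) * C V sl2_F) = 0" by simp
  then have eq: "- C V sl2_H + - (sc (z / 2) * C U sl2_E) = 0" unfolding distrib_left z2 F .
  have "C V sl2_H = - (- C V sl2_H + - (sc (z / 2) * C U sl2_E)) - sc (z / 2) * C U sl2_E" by simp
  then show "C V sl2_H = - (sc (z / 2) * C U sl2_E)" unfolding eq by simp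
qed

lemma cross_relator_eq:
  "cross z \<xi> (relator p q) = cross z \<xi> (wword p q) - M2 1 0 z 1 * cross z \<xi> (wword p q) * M2 1 0 (- z) 1 +
    M2 0 j j Q * \<xi> U * M2 Q (- j) (- j) 0 - \<xi> V"
proof -
  let ?W = "M2 0 j j Q" and ?Wi = "M2 Q (- j) (- j) 0" and ?u = "M2 1 z 0 1" and ?ui = "M2 1 (- z) 0 1"
    and ?v = "M2 1 0 z 1" and ?vi = "M2 1 0 (- z) 1" and ?X = "cross z \<xi> (wword p q)"
  have words: "word_m2 z [(U, True)] = ?u" "word_m2 z [(V, False)] = ?vi" "winv [(U, True)] = [(U, False)]"
    "word_m2 z [(U, False)] = ?ui" "winv [(V, False)] = [(V, True)]" "word_m2 z [(V, True)] = ?v"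
    "word_m2 z (winv (winv (wword p q))) = ?W" "letter_m2 z (V, False) = ?vi" "letter_m2 z (V, True) = ?v"
    by (simp_all add: letter_m2_def winv_def[of "[_]"] word_m2_w)
  have c: "cross z \<xi> [(U, True)] = \<xi> U" "cross z \<xi> [(V, False)] = - (?vi * \<xi> V * ?v)"
    by (simp_all add: words)
  have inv: "?vi * ?v = 1" "?v * ?vi = 1" "?Wi * ?W = 1" "?u * ?ui = 1"
    using j_sq by (simp_all add: m2_defs)
  have vi: "?W * ?ui * ?Wi = ?vi" using j_sq by (simp add: times_m2_def algebra_simps)
  have "cross z \<xi> (relator p q) = ?X + ?W * (\<xi> U + ?u * (- (?Wi * ?X * ?W) + ?Wi * (- (?vi * \<xi> V * ?v)) * ?W) * ?ui) * ?Wi"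
    unfolding relator_def cross_append cross_winv words c word_m2_w word_m2_w_inv ..
  also have "\<dots> = ?X + ?W * \<xi> U * ?Wi - (?W * ?u * ?Wi) * ?X * (?W * ?ui * ?Wi) -
      (?W * ?u * ?Wi) * (?vi * \<xi> V * ?v) * (?W * ?ui * ?Wi)"
    by (simp add: distrib_left distrib_right left_diff_distrib right_diff_distrib mult.assoc)
  also have "\<dots> = ?X + ?W * \<xi> U * ?Wi - ?v * ?X * ?vi - (?v * ?vi) * \<xi> V * (?v * ?vi)"
    unfolding wu_winv vi by (simp only: mult.assoc)
  finally show ?thesis by (simp add: inv)
qed

lemma C_V_E: "e12 (C V sl2_E) = - 1"
proof -
  have "cross z (case_gen 0 sl2_E) (relator p q) = C V sl2_E"
    by (simp add: cross_relator) (simp add: C_def)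
  moreover have "e12 (cross z (case_gen 0 sl2_E) (relator p q)) = - 1"
    unfolding cross_relator_eq by (simp add: sl2_defs)
  ultimately show ?thesis by simp
qed

lemma C_U_E: "e12 (C U sl2_E) = 0" "e11 (C U sl2_E) = - (j * z * dP) / 2"
proof -
  let ?T = "cross z (case_gen sl2_E sl2_F) (relator p q)"
  have T: "?T = C U sl2_E + C U sl2_E"
    by (simp add: cross_relator C_relations(1))
  let ?X = "cross z (case_gen sl2_E sl2_F) (wword p q)"
  have "e12 ?X = - j * dP"
    unfolding cross_deriv word_m2_w_inv by (simp add: m2.map_sel word_m2_wword dP_def)
  then have "e11 ?T = - (j * z * dP)" "e12 ?T = 0"
    unfolding cross_relator_eq by (simp_all add: sl2_defs)
  then show "e12 (C U sl2_E) = 0" "e11 (C U sl2_E) = - (j * z * dP) / 2"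
    unfolding T by (auto simp: field_simps)
qed

definition f2 :: "complex m2 \<Rightarrow> complex" where
  "f2 \<xi> = e21 (ad_sum z (torus_chain p q) \<xi>)"

lemma f2_F: "f2 sl2_F = - (R n)\<^sup>2"
proof -
  define t where "t = take (shift p q - 1) (relator p q)"
  have sh: "even (shift p q)" "0 < shift p q" "shift p q < 2 * p"
    using shift_props[OF q0 qp cop op oq] by simp_all
  then have t12: "e12 (word_m2 z t) = R n"
    using relator_prefix[of "shift p q - 1"] unfolding t_def by (simp add: n_def of_nat_diff)
  have "ad_sum z (torus_chain p q) sl2_F =
    word_m2 z (rev (wword p q) @ [(V, True)] @ winv t) * sl2_F * word_m2 z (winv (rev (wword p q) @ [(V, True)] @ winv t)) -
    word_m2 z (rev (wword p q)) * sl2_F * word_m2 z (winv (rev (wword p q)))"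
    by (simp add: ad_sum_def torus_chain_def t_def)
  then have "f2 sl2_F = (e22 (word_m2 z (rev (wword p q) @ [(V, True)] @ winv t)))\<^sup>2 -
      (e22 (word_m2 z (rev (wword p q))))\<^sup>2"
    unfolding f2_def sl2_F_def m2_sel e21_conj_F[symmetric] by simp
  also have "e22 (word_m2 z (rev (wword p q) @ [(V, True)] @ winv t)) = - (j * R n)"
    by (simp add: word_m2_append word_m2_rev_w letter_m2_def word_m2_winv_eq t12)
  also have "(- (j * R n))\<^sup>2 = j * j * (R n)\<^sup>2" by (simp add: power2_eq_square mult_ac)
  finally show ?thesis by (simp add: word_m2_rev_w j_sq)
qed

lemma f2_cross: "f2 (cross z \<xi> (relator p q)) = 0"
proof -
  let ?r = "relator p q" and ?l = "longitude p q" and ?u = "[(U, True)]"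
  let ?X = "cross z \<xi> ?r"
  have winv_r: "word_m2 z (winv ?r) = 1"
    by (simp add: word_m2_winv_eq word_m2_relator m2_defs)
  have conj: "cross z \<xi> (g @ ?r @ winv g) = word_m2 z g * ?X * word_m2 z (winv g)"
    "cross z \<xi> (g @ winv ?r @ winv g) = - (word_m2 z g * ?X * word_m2 z (winv g))" for g
  proof -
    have c: "word_m2 z g * (word_m2 z (winv g) * A) = A" for A
      by (simp add: mult.assoc[symmetric] word_m2_winv)
    show "cross z \<xi> (g @ ?r @ winv g) = word_m2 z g * ?X * word_m2 z (winv g)"
      "cross z \<xi> (g @ winv ?r @ winv g) = - (word_m2 z g * ?X * word_m2 z (winv g))"
      by (simp_all add: cross_append cross_winv word_m2_relator winv_r distrib_left distrib_right left_diff_distrib right_diff_distrib mult.assoc c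
          word_m2_winv)
  qed
  have triv: "word_m2 z (g @ ?r @ winv g) = 1" "word_m2 z (winv (g @ ?r @ winv g)) = 1" for g
    by (simp_all add: word_m2_append word_m2_relator word_m2_winv winv_append winv_r)
  define g1 g2 where "g1 = rev (wword p q) @ [(V, True)] @ winv (take (shift p q - 1) ?r)" and "g2 = rev (wword p q)"
  have tc: "torus_chain p q = [(1, g1), (- 1, g2)]" by (simp add: torus_chain_def g1_def g2_def)
  have "cross z \<xi> (relator_prod ?r (torus_chain p q)) = cross z \<xi> ((g1 @ ?r @ winv g1) @ (g2 @ winv ?r @ winv g2))"
    unfolding tc relator_prod_def by simp
  also have "\<dots> = ad_sum z (torus_chain p q) ?X"
    unfolding cross_append[of _ _ "g1 @ _"] conj triv tc by (simp add: ad_sum_def)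
  finally have 1: "cross z \<xi> (?u @ ?l @ winv ?u @ winv ?l) = ad_sum z (torus_chain p q) ?X"
    by (rule trans[OF cross_pres_eq[OF torus_chain[OF q0 qp cop op oq]]])
  define b where "b = Q * j + j * Q"
  have l: "word_m2 z ?l = M2 (- 1) b 0 (- 1)"
    by (simp add: longitude_def word_m2_append word_m2_rev_w word_m2_w times_m2_def j_sq b_def)
  have u: "word_m2 z ?u = M2 1 z 0 1" by (simp add: letter_m2_def)
  have "e21 (cross z \<xi> (?u @ ?l @ winv ?u @ winv ?l)) = 0"
    unfolding cross_append[of _ _ _ "_ @ _"] cross_append[of _ _ "winv _"] cross_winv word_m2_winv_eq l u winv_winv
    by (simp add: algebra_simps)
  then show ?thesis unfolding f2_def 1 .
qed

end

section \<open>Minors and evaluation\<close>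

lemma pick_set:
  assumes "sorted_wrt (<) xs" "i < length xs"
  shows "pick (set xs) i = xs ! i"
  using assms(2)
proof (induction i)
  case 0
  have "(LEAST a. a \<in> set xs) = xs ! 0"
  proof (rule Least_equality)
    fix y assume "y \<in> set xs"
    then obtain k where "k < length xs" "y = xs ! k" by (auto simp: in_set_conv_nth)
    then show "xs ! 0 \<le> y" using assms(1) by (cases k) (auto simp: sorted_wrt_iff_nth_less less_imp_le)
  qed (use 0 in auto)
  then show ?case by simp
next
  case (Suc i)
  then have IH: "pick (set xs) i = xs ! i" by simp
  have "(LEAST a. a \<in> set xs \<and> xs ! i < a) = xs ! Suc i"
  proof (rule Least_equality)
    show "xs ! Suc i \<in> set xs \<and> xs ! i < xs ! Suc i"
      using Suc.prems assms(1) by (auto simp: sorted_wrt_iff_nth_less)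
    fix y assume "y \<in> set xs \<and> xs ! i < y"
    then obtain k where k: "k < length xs" "y = xs ! k" "xs ! i < xs ! k" by (auto simp: in_set_conv_nth)
    have "i < k"
    proof (rule ccontr)
      assume "\<not> i < k"
      then have "xs ! k \<le> xs ! i"
        using assms(1) Suc.prems by (cases "k = i") (auto simp: sorted_wrt_iff_nth_less less_imp_le)
      with k show False by simp
    qed
    then show "xs ! Suc i \<le> y"
      using assms(1) k by (cases "k = Suc i") (auto simp: sorted_wrt_iff_nth_less less_imp_le)
  qed
  then show ?case by (simp add: IH)
qed

lemma submatrix_set:
  assumes "sorted_wrt (<) xs" "sorted_wrt (<) ys" "set xs \<subseteq> {..<dim_row A}" "set ys \<subseteq> {..<dim_col A}"
  shows "submatrix A (set xs) (set ys) = mat (length xs) (length ys) (\<lambda>(i, j). A $$ (xs ! i, ys ! j))"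
proof -
  have d: "distinct zs" if "sorted_wrt (<) zs" for zs :: "nat list"
    using that by (simp add: strict_sorted_iff)
  have "{i. i < dim_row A \<and> i \<in> set xs} = set xs" "{i. i < dim_col A \<and> i \<in> set ys} = set ys"
    using assms by auto
  then have c: "card {i. i < dim_row A \<and> i \<in> set xs} = length xs" "card {i. i < dim_col A \<and> i \<in> set ys} = length ys"
    using d[OF assms(1)] d[OF assms(2)] by (simp_all add: distinct_card)
  show ?thesis unfolding submatrix_def c
    by (rule eq_matI) (auto simp: pick_set[OF assms(1)] pick_set[OF assms(2)])
qed

lemma finite_nat_set_as_list:
  assumes "finite (S :: nat set)"
  obtains xs where "sorted_wrt (<) xs" "set xs = S" "length xs = card S"
  using assms that[of "sorted_list_of_set S"] by simp

lemma det_1: "det (mat (Suc 0) (Suc 0) f) = f (0, 0)"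
  by (subst det_single) auto

lemma det_2: "det (mat 2 2 f) = f (0, 0) * f (1, 1) - f (0, 1) * (f (1, 0) :: 'a::comm_ring_1)"
  by (simp add: laplace_expansion_row[of _ 2 0] cofactor_def mat_delete_def numeral_2_eq_2 det_1)

lemma det_3: "det (mat 3 3 f) = f (0, 0) * (f (1, 1) * f (2, 2) - f (1, 2) * f (2, 1)) -
   f (0, 1) * (f (1, 0) * f (2, 2) - f (1, 2) * f (2, 0)) +
   f (0, 2) * (f (1, 0) * f (2, 1) - f (1, 1) * (f (2, 0) :: 'a::comm_ring_1))"
proof -
  have del: "mat_delete (mat 3 3 f) 0 k = mat 2 2 (\<lambda>(i, l). f (Suc i, if l < k then l else Suc l))" for k
    by (rule eq_matI) (auto simp: mat_delete_def)
  have c: "cofactor (mat 3 3 f) 0 k = (- 1) ^ k * (f (1, if 0 < k then 0 else 1) * f (2, if 1 < k then 1 else 2) -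
      f (1, if 1 < k then 1 else 2) * f (2, if 0 < k then 0 else 1))" for k
    unfolding cofactor_def del det_2 by (simp add: numeral_2_eq_2)
  have s: "sum g {..<3::nat} = g 0 + g 1 + g 2" for g :: "nat \<Rightarrow> 'a"
    by (simp add: numeral_3_eq_3 numeral_2_eq_2)
  have "det (mat 3 3 f) = (\<Sum>k<3. mat 3 3 f $$ (0, k) * cofactor (mat 3 3 f) 0 k)"
    by (rule laplace_expansion_row) simp_all
  then show ?thesis unfolding s c by (simp add: algebra_simps)
qed

definition ev :: "complex \<Rightarrow> rat poly \<Rightarrow> complex" where
  "ev z f = poly (map_poly of_rat f) z"

lemma ev_hom: "comm_ring_hom (ev z)"
proof -
  interpret of_rat: map_poly_comm_ring_hom "of_rat :: rat \<Rightarrow> complex"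
    by unfold_locales (simp_all add: of_rat_add of_rat_mult)
  show ?thesis
    by unfold_locales (simp_all add: ev_def of_rat.hom_add of_rat.hom_mult)
qed

lemma ev_simps [simp]:
  "ev z (f + g) = ev z f + ev z g" "ev z (f - g) = ev z f - ev z g" "ev z (f * g) = ev z f * ev z g"
  "ev z (- f) = - ev z f" "ev z 0 = 0" "ev z 1 = 1" "ev z (of_int c) = of_int c" "ev z (numeral k) = numeral k"
  "ev z [:0, 1:] = z"
proof -
  interpret comm_ring_hom "ev z" by (rule ev_hom)
  show "ev z (f + g) = ev z f + ev z g" "ev z (f - g) = ev z f - ev z g" "ev z (f * g) = ev z f * ev z g"
    "ev z (- f) = - ev z f" "ev z 0 = 0" "ev z 1 = 1" "ev z (of_int c) = of_int c" "ev z (numeral k) = numeral k"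
    by (simp_all add: hom_distribs)
  show "ev z [:0, 1:] = z" by (simp add: ev_def map_poly_pCons)
qed

lemma ev_prod: "ev z (prod f A) = prod (\<lambda>i. ev z (f i)) A"
  by (induction A rule: infinite_finite_induct) simp_all

lemma ev_det: "ev z (det A) = det (map_mat (ev z) A)"
proof -
  interpret comm_ring_hom "ev z" by (rule ev_hom)
  show ?thesis by simp
qed

lemma ev_minor:
  assumes "sorted_wrt (<) xs" "sorted_wrt (<) ys" "Rs ! i = set xs" "minor_cols Ds Rs i = set ys"
    "set xs \<subseteq> {..<dim_row (Ds ! i)}" "set ys \<subseteq> {..<dim_col (Ds ! i)}"
  shows "ev z (minor Ds Rs i) = det (mat (length xs) (length ys) (\<lambda>(k, l). ev z ((Ds ! i) $$ (xs ! k, ys ! l))))"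
proof -
  have "map_mat (ev z) (mat (length xs) (length ys) (\<lambda>(k, l). (Ds ! i) $$ (xs ! k, ys ! l))) =
      mat (length xs) (length ys) (\<lambda>(k, l). ev z ((Ds ! i) $$ (xs ! k, ys ! l)))"
    by (rule eq_matI) auto
  then show ?thesis
    unfolding minor_def assms(3,4) submatrix_set[OF assms(1,2,5,6)] ev_det by simp
qed

lemma ev_cong:
  assumes "[f = g] (mod P)" "ev z P = 0"
  shows "ev z f = ev z g"
proof -
  have "P dvd f - g" using assms(1) by (simp add: cong_iff_dvd_diff)
  then obtain d where "f - g = P * d" by (elim dvdE)
  then have "f = g + P * d" by (simp add: algebra_simps)
  then show ?thesis using assms(2) by simp
qed

lemma unit_mod_ev: "unit_mod P f \<Longrightarrow> ev z P = 0 \<Longrightarrow> ev z f \<noteq> 0"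
  unfolding unit_mod_def using ev_cong[of "f * _" 1 P z] by auto

lemma unit_modI:
  assumes "P \<noteq> 0" "\<And>z. ev z P = 0 \<Longrightarrow> ev z f \<noteq> 0"
  shows "unit_mod P f"
proof -
  define g where "g = gcd f P"
  have g0: "g \<noteq> 0" using assms(1) by (simp add: g_def)
  have "degree g = 0"
  proof (rule ccontr)
    assume "degree g \<noteq> 0"
    then have "\<not> constant (poly (map_poly of_rat g :: complex poly))"
      by (simp add: constant_degree of_rat_hom.degree_map_poly_hom)
    then obtain z :: complex where z: "ev z g = 0"
      unfolding ev_def using fundamental_theorem_of_algebra by blast
    have "g dvd f" "g dvd P" by (simp_all add: g_def)
    then obtain a b where "f = g * a" "P = g * b" by (elim dvdE)
    then show False using assms(2)[of z] z by simp
  qed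
  then obtain c where c: "g = [:c:]" by (elim degree_eq_zeroE)
  with g0 have c0: "c \<noteq> 0" by simp
  obtain s t where "s * f + t * P = g"
    using bezout_coefficients_fst_snd[of f P] unfolding g_def by blast
  then have "[:1 / c:] * (s * f + t * P) = 1" using c c0 by (simp add: one_pCons)
  then have "f * ([:1 / c:] * s) - 1 = P * (- [:1 / c:] * t)" by (simp add: algebra_simps)
  then have "[f * ([:1 / c:] * s) = 1] (mod P)" unfolding cong_iff_dvd_diff by (rule dvdI)
  then show ?thesis unfolding unit_mod_def by blast
qed

lemma of_rat_eps_rec:
  assumes "comm_ring_hom f"
  shows "f (eps_rec p q x a b k) = eps_rec p q (f x) (f a) (f b) k"
proof -
  interpret comm_ring_hom f by fact
  show ?thesis by (induction k rule: induct_nat_012) (simp_all add: hom_distribs)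
qed

lemma Vmod_eq:
  assumes "0 < p"
  shows "Vmod p q = eps_rec p q [:0, 1:] 0 1 p"
proof -
  have "map_poly of_int (Ppoly p q k) = eps_rec p q ([:0, 1:] :: rat poly) 0 1 (Suc k)" for k
  proof (induction k rule: induct_nat_012)
    case 1
    show ?case by (simp add: of_int_poly hom_distribs)
  next
    case (ge2 k)
    have e: "map_poly of_int [:0, eps p q (Suc (Suc k)):] = of_int (eps p q (Suc (Suc k))) * ([:0, 1:] :: rat poly)"
      by (simp add: of_int_poly hom_distribs)
    show ?case
      unfolding Ppoly.simps of_int_poly_hom.hom_add of_int_poly_hom.hom_mult ge2 e
      by (simp only: eps_rec.simps(3)[of p q _ _ _ "Suc k"])
  qed simp
  from this[of "p - 1"] assms show ?thesis by (simp add: Vmod_def)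
qed

lemma ev_Vmod: "0 < p \<Longrightarrow> ev z (Vmod p q) = eps_rec p q z 0 1 p"
  using of_rat_eps_rec[OF ev_hom, of z p q "[:0, 1:]" 0 1 p] by (simp add: Vmod_eq)

context two_bridge
begin

lemma Z_ev: "z \<in> Z \<longleftrightarrow> ev z (Vmod p q) = 0"
  using p0 by (simp add: Z_def ev_Vmod)

lemma Vmod_nz: "Vmod p q \<noteq> 0"
proof
  assume "Vmod p q = 0"
  then have "Z = UNIV" by (auto simp: Z_ev)
  then show False using finite_Z infinite_UNIV_char_0 by metis
qed

lemma Z_nonempty: "Z \<noteq> {}"
proof -
  have "\<not> constant (poly (RP p))" using p3 by (simp add: constant_degree degree_RP_p)
  then show ?thesis unfolding Z_eq using fundamental_theorem_of_algebra by blast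
qed

lemma unit_mod_iff: "unit_mod (Vmod p q) f \<longleftrightarrow> (\<forall>z\<in>Z. ev z f \<noteq> 0)"
  using unit_mod_ev unit_modI[OF Vmod_nz] by (auto simp: Z_ev)

lemma torsion_exists:
  assumes "row_sets (Vmod p q) Ds Rs"
  shows "is_torsion (Vmod p q) Ds (torsion (Vmod p q) Ds)"
proof -
  let ?a = "\<Prod>i | i < length Ds \<and> even i. minor Ds Rs i" and ?b = "\<Prod>i | i < length Ds \<and> odd i. minor Ds Rs i"
  have "\<forall>z\<in>Z. ev z ?a \<noteq> 0"
    using assms by (auto simp: ev_prod row_sets_def unit_mod_iff)
  then obtain c where c: "[?a * c = 1] (mod Vmod p q)"
    unfolding unit_mod_iff[symmetric] unit_mod_def by blast
  have "[?b * c * ?a = 1 * ?b] (mod Vmod p q)"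
    using cong_scalar_left[OF c, of ?b] by (simp add: mult_ac)
  then have "is_torsion (Vmod p q) Ds (?b * c)"
    unfolding is_torsion_def using assms by (intro exI[of _ Rs] exI[of _ 1]) simp
  then show ?thesis unfolding torsion_def by (rule someI)
qed

end

section \<open>The torsions at a root\<close>

lemma ring_mat_carrier:
  assumes "\<And>a. rep a \<in> carrier_mat m m"
  shows "ring_mat m rep s \<in> carrier_mat m m"
  by (induction s) (use assms in \<open>auto simp: ring_mat_def\<close>)

lemma ring_mat_Cons: "ring_mat m rep ((c, a) # s) = of_int c \<cdot>\<^sub>m rep a + ring_mat m rep s"
  by (simp add: ring_mat_def)

lemma ev_m2_word: "map_m2 (ev z) (word_m2 [:0, 1:] a) = word_m2 z a"
  using map_m2_word[OF ev_hom, of z "[:0, 1:]" a] by simp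

lemma rho1_m2: "rho1 a = mat_m2 (word_m2 [:0, 1:] a)"
  by (simp add: rho1_def word_mat_m2)

definition entry :: "nat \<Rightarrow> nat \<Rightarrow> 'a m2 \<Rightarrow> 'a" where
  "entry i k A = (if i = 0 then if k = 0 then e11 A else e12 A else if k = 0 then e21 A else e22 A)"

lemma entry_map: "entry i k (map_m2 f A) = f (entry i k A)"
  by (cases A) (simp add: entry_def)

lemma entry_mat: "i < 2 \<Longrightarrow> k < 2 \<Longrightarrow> mat_m2 A $$ (i, k) = entry i k A"
  by (auto simp: entry_def less_2_cases_iff)

lemma ev_ring_mat_rho1:
  assumes "i < 2" "k < 2"
  shows "ev z (ring_mat 2 rho1 s $$ (i, k)) = entry i k (fox_sum z s)"
proof (induction s)
  case Nil
  show ?case using assms by (simp add: ring_mat_def fox_sum_def entry_def)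
next
  case (Cons t s)
  obtain c a where t: "t = (c, a)" by (cases t)
  have car: "ring_mat 2 rho1 s \<in> carrier_mat 2 2" by (rule ring_mat_carrier) (simp add: rho1_m2)
  have "ring_mat 2 rho1 (t # s) $$ (i, k) = of_int c * rho1 a $$ (i, k) + ring_mat 2 rho1 s $$ (i, k)"
    using assms car by (simp add: t ring_mat_Cons rho1_m2)
  moreover have "ev z (rho1 a $$ (i, k)) = entry i k (word_m2 z a)"
    using assms by (simp add: rho1_m2 entry_mat entry_map[of i k "ev z", symmetric] ev_m2_word)
  ultimately have "ev z (ring_mat 2 rho1 (t # s) $$ (i, k)) = of_int c * entry i k (word_m2 z a) + entry i k (fox_sum z s)"
    using Cons by simp
  also have "\<dots> = entry i k (of_int c * word_m2 z a + fox_sum z s)"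
    by (simp add: entry_def of_int_m2)
  finally show ?case by (simp add: t fox_sum_def)
qed

lemma D0_index:
  assumes "\<And>a. rep a \<in> carrier_mat m m" "i < 2 * m" "k < m"
  shows "D0 m rep $$ (i, k) = (if i < m then ring_mat m rep [(1, [(U, True)]), (- 1, [])] $$ (i, k)
    else ring_mat m rep [(1, [(V, True)]), (- 1, [])] $$ (i - m, k))"
  using assms ring_mat_carrier[of rep m "[(1, [(U, True)]), (- 1, [])]"]
    ring_mat_carrier[of rep m "[(1, [(V, True)]), (- 1, [])]"]
  by (auto simp: D0_def append_rows_def)

lemma D0_dim:
  assumes "\<And>a. rep a \<in> carrier_mat m m"
  shows "dim_row (D0 m rep) = 2 * m" "dim_col (D0 m rep) = m"
  using assms ring_mat_carrier[of rep m "[(1, [(U, True)]), (- 1, [])]"]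
    ring_mat_carrier[of rep m "[(1, [(V, True)]), (- 1, [])]"]
  by (auto simp: D0_def append_rows_def)

lemma D1_index:
  assumes "\<And>a. rep a \<in> carrier_mat m m" "i < m" "k < 2 * m"
  shows "D1 p q m rep $$ (i, k) = (if k < m then ring_mat m rep (fox U (relator p q)) $$ (i, k)
    else ring_mat m rep (fox V (relator p q)) $$ (i, k - m))"
proof -
  have d: "dim_row (ring_mat m rep s) = m" "dim_col (ring_mat m rep s) = m" for s
    using ring_mat_carrier[of rep m s] assms(1) by auto
  show ?thesis using assms(2,3) by (simp add: D1_def d)
qed

lemma D1_dim:
  assumes "\<And>a. rep a \<in> carrier_mat m m"
  shows "dim_row (D1 p q m rep) = m" "dim_col (D1 p q m rep) = 2 * m"
proof -
  have d: "dim_row (ring_mat m rep s) = m" "dim_col (ring_mat m rep s) = m" for s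
    using ring_mat_carrier[of rep m s] assms(1) by auto
  show "dim_row (D1 p q m rep) = m" "dim_col (D1 p q m rep) = 2 * m" by (simp_all add: D1_def d)
qed

lemma rho1_carrier: "rho1 a \<in> carrier_mat 2 2"
  by (simp add: rho1_m2)

lemma rho2_carrier: "rho2 a \<in> carrier_mat 3 3"
  by (simp add: rho2_def)

lemma D0_rho1:
  assumes "i < 4" "k < 2"
  shows "ev z (D0 2 rho1 $$ (i, k)) = (if i = 0 \<and> k = 1 \<or> i = 3 \<and> k = 0 then z else 0)"
proof -
  have "ev z (D0 2 rho1 $$ (i, k)) =
    (if i < 2 then entry i k (fox_sum z [(1, [(U, True)]), (- 1, [])])
     else entry (i - 2) k (fox_sum z [(1, [(V, True)]), (- 1, [])]))"
    using assms by (auto simp: D0_index rho1_carrier ev_ring_mat_rho1)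
  moreover have "i \<in> {0, 1, 2, 3}" "k \<in> {0, 1}" using assms by auto
  ultimately show ?thesis by (auto simp: fox_sum_def letter_m2_def entry_def)
qed

lemma length_2_sorted:
  assumes "length xs = 2" "sorted_wrt (<) (xs :: nat list)"
  obtains a b where "xs = [a, b]" "a < b"
proof -
  from assms(1) obtain a b where "xs = [a, b]" by (auto simp: length_Suc_conv numeral_2_eq_2)
  with assms(2) that show thesis by simp
qed

lemma length_3_sorted:
  assumes "length xs = 3" "sorted_wrt (<) (xs :: nat list)"
  obtains a b c where "xs = [a, b, c]" "a < b" "b < c"
proof -
  from assms(1) obtain a b c where "xs = [a, b, c]" by (auto simp: length_Suc_conv numeral_3_eq_3)
  with assms(2) that show thesis by simp
qed

context parabolic_root
begin

lemma tau1_minors: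
  assumes Ds: "Ds = [D0 2 rho1, D1 p q 2 rho1]" and Rs: "Rs ! 0 = {0, 3}" "Rs ! 1 = {0, 1}"
  shows "ev z (minor Ds Rs 0) = - (z * z)" "ev z (minor Ds Rs 1) * R n = 2 * j"
proof -
  have "ev z (minor Ds Rs 0) = det (mat (length [0, 3::nat]) (length [0, 1::nat]) (\<lambda>(k, l). ev z ((Ds ! 0) $$ ([0, 3] ! k, [0, 1] ! l))))"
    using D0_dim[of rho1 2] rho1_carrier
    by (intro ev_minor) (auto simp: Ds Rs Rs(2)[simplified] minor_cols_def)
  also have "\<dots> = det (mat 2 2 (\<lambda>(k, l). ev z ((Ds ! 0) $$ ([0, 3] ! k, [0, 1] ! l))))" by (simp add: numeral_2_eq_2)
  finally show "ev z (minor Ds Rs 0) = - (z * z)" by (simp add: det_2 Ds D0_rho1)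
  have "{..<4} - {0, 3} = {1, 2::nat}" by auto
  then have "ev z (minor Ds Rs 1) = det (mat (length [0, 1::nat]) (length [1, 2::nat]) (\<lambda>(k, l). ev z ((Ds ! 1) $$ ([0, 1] ! k, [1, 2] ! l))))"
    using D1_dim[of rho1 2] rho1_carrier
    by (intro ev_minor) (auto simp: Ds Rs Rs(2)[simplified] minor_cols_def)
  also have "\<dots> = det (mat 2 2 (\<lambda>(k, l). ev z ((Ds ! 1) $$ ([0, 1] ! k, [1, 2] ! l))))" by (simp add: numeral_2_eq_2)
  finally show "ev z (minor Ds Rs 1) * R n = 2 * j"
    using fox_relator by (simp add: det_2 Ds D1_index rho1_carrier ev_ring_mat_rho1 entry_def)
qed

end

context two_bridge
begin

lemma row_sets_tau1:
  assumes "row_sets (Vmod p q) [D0 2 rho1, D1 p q 2 rho1] Rs"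
  shows "Rs ! 0 = {0, 3} \<and> Rs ! 1 = {0, 1}"
proof -
  let ?Ds = "[D0 2 rho1, D1 p q 2 rho1]"
  have dims: "dim_row (D0 2 rho1) = 4" "dim_col (D0 2 rho1) = 2" "dim_row (D1 p q 2 rho1) = 2"
    using D0_dim[of rho1 2] D1_dim[of rho1 2 p q] rho1_carrier by simp_all
  have len: "length Rs = 2" using assms by (simp add: row_sets_def)
  then have "last Rs = Rs ! 1" by (cases Rs) (auto simp: length_Suc_conv)
  then have R1: "Rs ! 1 = {0, 1}" using assms by (auto simp: row_sets_def dims)
  have R0: "Rs ! 0 \<subseteq> {..<4}" "card (Rs ! 0) = 2" "unit_mod (Vmod p q) (minor ?Ds Rs 0)"
    using assms by (simp_all add: row_sets_def dims minor_cols_def All_less_Suc)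
  obtain xs where xs: "sorted_wrt (<) xs" "set xs = Rs ! 0" "length xs = card (Rs ! 0)"
    using R0(1) finite_nat_set_as_list[of "Rs ! 0"] finite_subset by blast
  then obtain a b where ab: "xs = [a, b]" "a < b" using R0(2) length_2_sorted[of xs] by auto
  then have b: "b < 4" using xs R0(1) by auto
  obtain z where z: "z \<in> Z" using Z_nonempty by auto
  then interpret parabolic_root p q z by (rule Z_root)
  have "ev z (minor ?Ds Rs 0) = det (mat (length xs) (length [0, 1::nat]) (\<lambda>(k, l). ev z ((?Ds ! 0) $$ (xs ! k, [0, 1] ! l))))"
    using xs R0(1) by (intro ev_minor) (auto simp: minor_cols_def dims)
  also have "\<dots> = det (mat 2 2 (\<lambda>(k, l). ev z ((?Ds ! 0) $$ (xs ! k, [0, 1] ! l))))" by (simp add: numeral_2_eq_2 ab)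
  also have "\<dots> = (if a = 0 \<and> b = 3 then - (z * z) else 0)"
  proof -
    have "a < 4" using ab b by simp
    then show ?thesis using ab b by (simp add: det_2 D0_rho1)
  qed
  finally have "ev z (minor ?Ds Rs 0) = (if a = 0 \<and> b = 3 then - (z * z) else 0)" .
  moreover have "ev z (minor ?Ds Rs 0) \<noteq> 0" using R0(3) z by (simp add: unit_mod_iff)
  ultimately have "a = 0" "b = 3" by (auto split: if_splits)
  then show ?thesis using R1 xs ab by auto
qed

lemma tau1_value:
  obtains s :: complex where "s \<in> {1, - 1}"
    "\<And>z. z \<in> Z \<Longrightarrow> 1 / ev z (tau1 p q) = s * (parabolic_root.j p q z * z\<^sup>2 * parabolic_root.R p q z n) / 2"
proof -
  let ?Ds = "[D0 2 rho1, D1 p q 2 rho1]"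
  have dims: "dim_row (D0 2 rho1) = 4" "dim_col (D0 2 rho1) = 2" "dim_row (D1 p q 2 rho1) = 2" "dim_col (D1 p q 2 rho1) = 4"
    using D0_dim[of rho1 2] D1_dim[of rho1 2 p q] rho1_carrier by simp_all
  have Rs: "Rs ! 0 = {0, 3} \<Longrightarrow> Rs ! 1 = {0, 1} \<Longrightarrow> z \<in> Z \<Longrightarrow>
      ev z (minor ?Ds Rs 0) = - (z * z) \<and> ev z (minor ?Ds Rs 1) * parabolic_root.R p q z n = 2 * parabolic_root.j p q z" for Rs z
    using parabolic_root.tau1_minors[OF Z_root, of z ?Ds Rs] by blast
  have "row_sets (Vmod p q) ?Ds [{0, 3}, {0, 1}]"
  proof -
    have "ev z (minor ?Ds [{0, 3}, {0, 1}] i) \<noteq> 0" if "z \<in> Z" "i < 2" for z i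
    proof -
      interpret parabolic_root p q z using that(1) by (rule Z_root)
      have "i = 0 \<or> i = 1" using that(2) by auto
      then show ?thesis using Rs[of "[{0, 3}, {0, 1}]" z] that(1) z_nz j_nz by auto
    qed
    then have "unit_mod (Vmod p q) (minor ?Ds [{0, 3}, {0, 1}] i)" if "i < 2" for i
      using that by (simp add: unit_mod_iff)
    moreover have "{..<4} - {0, 3} = {1, 2::nat}" "{..<2} = {0, 1::nat}" by auto
    ultimately show ?thesis
      unfolding row_sets_def by (auto simp: dims minor_cols_def less_2_cases_iff)
  qed
  then obtain Rs s where Rs': "row_sets (Vmod p q) ?Ds Rs" "s \<in> {1, - 1}"
    "[tau1 p q * (\<Prod>i | i < length ?Ds \<and> even i. minor ?Ds Rs i) =
      s * (\<Prod>i | i < length ?Ds \<and> odd i. minor ?Ds Rs i)] (mod Vmod p q)"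
    using torsion_exists unfolding is_torsion_def tau1_def by blast
  have sets: "{i. i < length ?Ds \<and> even i} = {0}" "{i. i < length ?Ds \<and> odd i} = {1}"
    by (auto simp: less_Suc_eq)
  define c :: complex where "c = (if s = 1 then - 1 else 1)"
  have evs: "ev z s = - c" for z using Rs'(2) by (auto simp: c_def)
  show thesis
  proof (rule that)
    show "- c \<in> {1, - 1}" by (simp add: c_def)
    fix z assume z: "z \<in> Z"
    then interpret parabolic_root p q z by (rule Z_root)
    have m: "ev z (minor ?Ds Rs 0) = - (z * z)" "ev z (minor ?Ds Rs 1) * R n = 2 * j"
      using Rs[of Rs z] row_sets_tau1[OF Rs'(1)] z by auto
    have "ev z (tau1 p q * minor ?Ds Rs 0) = ev z (s * minor ?Ds Rs 1)"
      using Rs'(3) z unfolding sets Z_ev by (intro ev_cong) simp_all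
    then have "ev z (tau1 p q) * (z * z) = c * ev z (minor ?Ds Rs 1)" by (simp add: m(1) evs)
    then have "ev z (tau1 p q) * (z * z) * R n = c * (2 * j)" by (simp only: m(2)[symmetric] mult.assoc)
    moreover have c2: "c * c = 1" by (simp add: c_def)
    ultimately have "ev z (tau1 p q) * (- c * (j * z\<^sup>2 * R n) / 2) = - (c * c) * (j * j)"
      by (simp add: power2_eq_square) (simp add: algebra_simps)
    then have "ev z (tau1 p q) * (- c * (j * z\<^sup>2 * R n) / 2) = 1" by (simp add: c2 j_sq)
    then show "1 / ev z (tau1 p q) = - c * (j * z\<^sup>2 * R n) / 2"
      by (metis divide_eq_eq mult.commute mult_zero_left zero_neq_one)
  qed
qed

end

definition crd :: "nat \<Rightarrow> 'a::comm_ring_1 m2 \<Rightarrow> 'a" where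
  "crd i A = [e12 A, 2 * e11 A, e21 A] ! i"

lemma crd_simps [simp]: "crd 0 A = e12 A" "crd (Suc 0) A = 2 * e11 A" "crd 1 A = 2 * e11 A" "crd 2 A = e21 A"
  by (simp_all add: crd_def)

definition sl2_basis_m2 :: "nat \<Rightarrow> rat poly m2" where
  "sl2_basis_m2 k = [M2 0 1 0 0, M2 [:1/2:] 0 0 [:-1/2:], M2 0 0 1 0] ! k"

definition sl2_bas :: "nat \<Rightarrow> complex m2" where
  "sl2_bas k = [sl2_E, sl2_H, sl2_F] ! k"

lemma sl2_bas_simps [simp]: "sl2_bas 0 = sl2_E" "sl2_bas (Suc 0) = sl2_H" "sl2_bas 1 = sl2_H" "sl2_bas 2 = sl2_F"
  by (simp_all add: sl2_bas_def)

lemma lt3: "k < 3 \<Longrightarrow> k = 0 \<or> k = 1 \<or> k = (2::nat)"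
  by auto

lemma sl2_basis_m2: "k < 3 \<Longrightarrow> sl2_basis k = mat_m2 (sl2_basis_m2 k)"
  by (drule lt3) (auto simp: sl2_basis_def sl2_basis_m2_def mat_m2_def)

lemma ev_const: "ev z [:c:] = of_rat c"
  by (simp add: ev_def hom_distribs)

lemma sl2_basis_ev: "k < 3 \<Longrightarrow> map_m2 (ev z) (sl2_basis_m2 k) = sl2_bas k"
  by (drule lt3) (auto simp: sl2_basis_m2_def sl2_bas_def sl2_defs ev_const of_rat_divide of_rat_minus)

lemma rho2_index:
  assumes "i < 3" "k < 3"
  shows "ev z (rho2 a $$ (i, k)) = crd i (word_m2 z a * sl2_bas k * word_m2 z (winv a))"
proof -
  let ?A = "word_m2 [:0, 1:] a * sl2_basis_m2 k * word_m2 [:0, 1:] (winv a)"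
  have "rho2 a $$ (i, k) = sl2_coord (mat_m2 ?A) i"
    using assms by (simp add: rho2_def rho1_m2 sl2_basis_m2 mat_m2_mult)
  also have "\<dots> = crd i ?A" by (simp add: sl2_coord_def crd_def)
  finally have "ev z (rho2 a $$ (i, k)) = crd i (map_m2 (ev z) ?A)"
    using lt3[OF assms(1)] by (cases ?A) auto
  then show ?thesis
    using assms by (simp add: map_m2_hom[OF ev_hom] ev_m2_word sl2_basis_ev)
qed

lemma ev_ring_mat_rho2:
  assumes "i < 3" "k < 3"
  shows "ev z (ring_mat 3 rho2 s $$ (i, k)) = crd i (ad_sum z s (sl2_bas k))"
proof (induction s)
  case Nil
  show ?case using assms lt3[OF assms(1)] by (auto simp: ring_mat_def ad_sum_def)
next
  case (Cons t s)
  obtain c a where t: "t = (c, a)" by (cases t)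
  have car: "ring_mat 3 rho2 s \<in> carrier_mat 3 3" by (rule ring_mat_carrier) (rule rho2_carrier)
  have "ring_mat 3 rho2 (t # s) $$ (i, k) = of_int c * rho2 a $$ (i, k) + ring_mat 3 rho2 s $$ (i, k)"
    using assms car rho2_carrier[of a] by (auto simp: t ring_mat_Cons)
  then have "ev z (ring_mat 3 rho2 (t # s) $$ (i, k)) =
      of_int c * crd i (word_m2 z a * sl2_bas k * word_m2 z (winv a)) + crd i (ad_sum z s (sl2_bas k))"
    using Cons assms by (simp add: rho2_index)
  also have "\<dots> = crd i (of_int c * (word_m2 z a * sl2_bas k * word_m2 z (winv a)) + ad_sum z s (sl2_bas k))"
    using lt3[OF assms(1)] by (auto simp: of_int_m2 algebra_simps)
  finally show ?case by (simp add: t ad_sum_def)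
qed

lemma pair_e1_eq: "pair_e1 = mat 1 3 (\<lambda>(i, k). if k = 2 then 1 else 0)"
proof (rule eq_matI)
  fix i k assume "i < dim_row (mat 1 3 (\<lambda>(i, k). if k = 2 then 1 else 0 :: rat poly))"
    "k < dim_col (mat 1 3 (\<lambda>(i, k). if k = 2 then 1 else 0 :: rat poly))"
  then have ik: "i = 0" "k < 3" by simp_all
  have "mtrace (sl2_basis k * sl2_basis 0) = e11 (sl2_basis_m2 k * sl2_basis_m2 0) + e22 (sl2_basis_m2 k * sl2_basis_m2 0)"
    using ik by (simp add: sl2_basis_m2 mat_m2_mult[symmetric] mtrace_def numeral_2_eq_2)
  also have "\<dots> = (if k = 2 then 1 else 0)"
    using lt3[OF ik(2)] by (auto simp: sl2_basis_m2_def)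
  finally show "pair_e1 $$ (i, k) = mat 1 3 (\<lambda>(i, k). if k = 2 then 1 else 0) $$ (i, k)"
    using ik by (simp add: pair_e1_def)
qed (simp_all add: pair_e1_def)

context two_bridge
begin

definition Ds2 :: "rat poly mat list" where
  "Ds2 = [D0 3 rho2, D1 p q 3 rho2 @\<^sub>r f1_row, four_block_mat (f2_row p q) (0\<^sub>m 1 1) (0\<^sub>m 0 3) (0\<^sub>m 0 1)]"

lemma f1_row_carrier: "f1_row \<in> carrier_mat 1 6"
  by (auto simp: f1_row_def pair_e1_def)

lemma f2_row_carrier: "f2_row p q \<in> carrier_mat 1 3"
  unfolding f2_row_def
proof (rule mult_carrier_mat)
  show "ring_mat 3 rho2 (torus_chain p q) \<in> carrier_mat 3 3"
    by (rule ring_mat_carrier) (rule rho2_carrier)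
qed (simp add: pair_e1_def)

lemma D1_rho2_carrier: "D1 p q 3 rho2 \<in> carrier_mat 3 6"
  using D1_dim[of rho2 3 p q] rho2_carrier by (intro carrier_matI) simp_all

lemma Ds2_dims:
  "dim_row (Ds2 ! 0) = 6" "dim_col (Ds2 ! 0) = 3" "dim_row (Ds2 ! 1) = 4" "dim_col (Ds2 ! 1) = 6"
  "dim_row (Ds2 ! 2) = 1" "dim_col (Ds2 ! 2) = 4"
proof -
  show "dim_row (Ds2 ! 0) = 6" "dim_col (Ds2 ! 0) = 3"
    using D0_dim[of rho2 3] rho2_carrier by (simp_all add: Ds2_def)
  have "D1 p q 3 rho2 @\<^sub>r f1_row \<in> carrier_mat (3 + 1) 6"
    by (intro carrier_append_rows D1_rho2_carrier f1_row_carrier)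
  then show "dim_row (Ds2 ! 1) = 4" "dim_col (Ds2 ! 1) = 6" by (auto simp: Ds2_def)
  show "dim_row (Ds2 ! 2) = 1" "dim_col (Ds2 ! 2) = 4"
    using f2_row_carrier by (auto simp: Ds2_def)
qed

end

context parabolic_root
begin

lemma Ds2_index_0:
  assumes "i < 6" "k < 3"
  shows "ev z (Ds2 ! 0 $$ (i, k)) =
    [[0, - z, - (z * z)], [0, 0, 2 * z], [0, 0, 0], [0, 0, 0], [- 2 * z, 0, 0], [- (z * z), z, 0]] ! i ! k"
proof -
  have "ev z (Ds2 ! 0 $$ (i, k)) =
    (if i < 3 then crd i (ad_sum z [(1, [(U, True)]), (- 1, [])] (sl2_bas k))
     else crd (i - 3) (ad_sum z [(1, [(V, True)]), (- 1, [])] (sl2_bas k)))"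
    using assms by (auto simp: Ds2_def D0_index rho2_carrier ev_ring_mat_rho2)
  moreover have "i \<in> {0, 1, 2, 3, 4, 5}" using assms by auto
  moreover have "winv [(g, b)] = [(g, \<not> b)]" "winv [] = []" for g b by (simp_all add: winv_def)
  ultimately show ?thesis using lt3[OF assms(2)]
    by (auto simp: ad_sum_def letter_m2_def sl2_defs m2_defs)
qed

definition \<beta> :: "nat \<Rightarrow> complex" where "\<beta> i = crd i (C V sl2_E)"
definition \<gamma> :: "nat \<Rightarrow> complex" where "\<gamma> i = crd i (C U sl2_E)"
definition \<phi> :: "nat \<Rightarrow> complex" where "\<phi> i = f2 (sl2_bas i)"

lemma Ds2_index_1:
  assumes "i < 4" "k < 6"
  shows "ev z (Ds2 ! 1 $$ (i, k)) =
    (if i = 3 then if k = 2 then 1 else 0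
     else [\<gamma> i, z / 2 * \<gamma> i, crd i (C U sl2_F), \<beta> i, - (z / 2) * \<gamma> i, \<gamma> i] ! k)"
proof (cases "i = 3")
  case True
  have "Ds2 ! 1 $$ (3, k) = f1_row $$ (0, k)"
    using assms D1_rho2_carrier f1_row_carrier by (auto simp: Ds2_def append_rows_def)
  also have "\<dots> = (if k = 2 then 1 else 0)"
    using assms by (auto simp: f1_row_def pair_e1_eq)
  finally show ?thesis using True by simp
next
  case False
  then have i: "i < 3" using assms by simp
  have "Ds2 ! 1 $$ (i, k) = D1 p q 3 rho2 $$ (i, k)"
    using i assms D1_rho2_carrier f1_row_carrier by (auto simp: Ds2_def append_rows_def)
  then have "ev z (Ds2 ! 1 $$ (i, k)) =
      (if k < 3 then crd i (C U (sl2_bas k)) else crd i (C V (sl2_bas (k - 3))))"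
    using i assms by (auto simp: D1_index rho2_carrier ev_ring_mat_rho2 C_def)
  moreover have "k \<in> {0, 1, 2, 3, 4, 5}" using assms by auto
  moreover have "crd i (sc c * A) = c * crd i A" "crd i (- A) = - crd i A" for c and A :: "complex m2"
    using lt3[OF i] by (auto simp: sc_def)
  ultimately show ?thesis using False by (auto simp: C_relations \<beta>_def \<gamma>_def)
qed

lemma Ds2_index_2:
  assumes "k < 4"
  shows "ev z (Ds2 ! 2 $$ (0, k)) = (if k = 3 then 0 else \<phi> k)"
proof (cases "k = 3")
  case True
  then show ?thesis using f2_row_carrier by (auto simp: Ds2_def)
next
  case False
  then have k: "k < 3" using assms by simp
  have car: "ring_mat 3 rho2 (torus_chain p q) \<in> carrier_mat 3 3"
    by (rule ring_mat_carrier) (rule rho2_carrier)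
  have "Ds2 ! 2 $$ (0, k) = f2_row p q $$ (0, k)"
    using k f2_row_carrier by (auto simp: Ds2_def)
  also have "\<dots> = ring_mat 3 rho2 (torus_chain p q) $$ (2, k)"
  proof -
    have s: "sum g {0..<3::nat} = g 0 + g 1 + g 2" for g :: "nat \<Rightarrow> rat poly"
      by (simp add: numeral_3_eq_3 numeral_2_eq_2)
    show ?thesis using k car by (auto simp: f2_row_def pair_e1_eq scalar_prod_def s)
  qed
  finally show ?thesis using k False by (simp add: ev_ring_mat_rho2 \<phi>_def f2_def)
qed

lemma coords:
  "\<beta> 0 = - 1" "\<gamma> 0 = 0" "\<gamma> 1 = - (j * z * dP)" "\<phi> 2 = - (R n)\<^sup>2"
  "\<phi> 0 = \<phi> 1 * \<beta> 1 + \<phi> 2 * \<beta> 2" "\<phi> 1 * \<gamma> 1 + \<phi> 2 * \<gamma> 2 = 0"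
proof -
  show b: "\<beta> 0 = - 1" and g: "\<gamma> 0 = 0" and "\<gamma> 1 = - (j * z * dP)" and "\<phi> 2 = - (R n)\<^sup>2"
    by (simp_all add: \<beta>_def \<gamma>_def \<phi>_def C_V_E C_U_E f2_F)
  have f2_lin: "f2 A = \<phi> 0 * crd 0 A + \<phi> 1 * crd 1 A + \<phi> 2 * crd 2 A" if "e11 A + e22 A = 0" for A
  proof -
    have "f2 (A + B) = f2 A + f2 B" "f2 (sc c * A) = c * f2 A" for A B c
      by (simp_all add: f2_def ad_sum_add ad_sum_sc) (simp add: sc_def)
    then show ?thesis
      by (subst sl2_expand[OF that]) (simp add: \<phi>_def)
  qed
  have "f2 (C V sl2_E) = 0" "f2 (C U sl2_E) = 0"
    using f2_cross[of "case_gen 0 sl2_E"] f2_cross[of "case_gen sl2_E 0"]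
    by (simp_all add: cross_relator) (simp_all add: C_def)
  moreover have "e11 (C g sl2_E) + e22 (C g sl2_E) = 0" for g
    unfolding C_def by (rule ad_sum_trace) (simp add: sl2_defs)
  ultimately have "\<phi> 0 * \<beta> 0 + \<phi> 1 * \<beta> 1 + \<phi> 2 * \<beta> 2 = 0" "\<phi> 0 * \<gamma> 0 + \<phi> 1 * \<gamma> 1 + \<phi> 2 * \<gamma> 2 = 0"
    using f2_lin[of "C V sl2_E"] f2_lin[of "C U sl2_E"] unfolding \<beta>_def \<gamma>_def by metis+
  then show "\<phi> 0 = \<phi> 1 * \<beta> 1 + \<phi> 2 * \<beta> 2" "\<phi> 1 * \<gamma> 1 + \<phi> 2 * \<gamma> 2 = 0"
    unfolding b g by (simp_all add: algebra_simps)
qed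

end

definition rows0 :: "nat list list" where
  "rows0 = [[0, 1, 4], [0, 1, 5], [0, 4, 5], [1, 4, 5]]"

definition cols1 :: "nat list list" where
  "cols1 = [[2, 3, 5], [2, 3, 4], [1, 2, 3], [0, 2, 3]]"

text \<open>The rows of the second map remaining when row \<open>i\<close> is left out.\<close>

definition rows1 :: "nat list list" where
  "rows1 = [[1, 2, 3], [0, 2, 3], [0, 1, 3]]"

definition sgn0 :: "nat \<Rightarrow> complex" where "sgn0 a = [1, - 1, 1, - 1] ! a"
definition sgn1 :: "nat \<Rightarrow> complex" where "sgn1 i = [- 1, 1, - 1] ! i"

lemma lt4: "k < 4 \<Longrightarrow> k = 0 \<or> k = 1 \<or> k = 2 \<or> k = (3::nat)"
  by auto

context parabolic_root
begin

definition fac :: "nat \<Rightarrow> complex" where "fac a = [1, z / 2, z / 2, - 1] ! a"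

definition sub_minor :: "nat \<Rightarrow> complex" where
  "sub_minor i = [\<beta> 1 * \<gamma> 2 - \<gamma> 1 * \<beta> 2, - \<gamma> 2, - \<gamma> 1] ! i"

lemma sub_minor_eq:
  assumes "i < 3"
  shows "sub_minor i * (4 * z\<^sup>2 * (R n)\<^sup>2) = sgn1 i * (j * dP * (4 * z ^ 3) * \<phi> i)"
proof -
  have g: "\<gamma> 2 * (R n)\<^sup>2 = - (\<phi> 1 * (j * z * dP))"
    using coords(6) unfolding coords(3,4) by (simp add: algebra_simps add_eq_0_iff)
  have "- \<gamma> 2 * (4 * z\<^sup>2 * (R n)\<^sup>2) = - (4 * z\<^sup>2) * (\<gamma> 2 * (R n)\<^sup>2)" by (simp add: algebra_simps)
  also have "\<dots> = j * dP * (4 * z ^ 3) * \<phi> 1"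
    unfolding g by (simp add: power2_eq_square power3_eq_cube)
  finally have 1: "- \<gamma> 2 * (4 * z\<^sup>2 * (R n)\<^sup>2) = j * dP * (4 * z ^ 3) * \<phi> 1" .
  have "(\<beta> 1 * \<gamma> 2 - \<gamma> 1 * \<beta> 2) * (4 * z\<^sup>2 * (R n)\<^sup>2) =
      4 * z\<^sup>2 * (\<beta> 1 * (\<gamma> 2 * (R n)\<^sup>2) + j * z * dP * \<beta> 2 * (R n)\<^sup>2)"
    unfolding coords(3) by (simp add: algebra_simps)
  also have "\<dots> = - (j * dP * (4 * z ^ 3) * \<phi> 0)"
    unfolding g coords(4,5) by (simp add: power2_eq_square power3_eq_cube algebra_simps)
  finally have 0: "(\<beta> 1 * \<gamma> 2 - \<gamma> 1 * \<beta> 2) * (4 * z\<^sup>2 * (R n)\<^sup>2) = - (j * dP * (4 * z ^ 3) * \<phi> 0)" .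
  have 2: "- \<gamma> 1 * (4 * z\<^sup>2 * (R n)\<^sup>2) = - (j * dP * (4 * z ^ 3) * \<phi> 2)"
    unfolding coords(3,4) by (simp add: power2_eq_square power3_eq_cube)
  have d: "sub_minor 0 = \<beta> 1 * \<gamma> 2 - \<gamma> 1 * \<beta> 2" "sub_minor 1 = - \<gamma> 2" "sub_minor 2 = - \<gamma> 1"
    "sgn1 0 = - 1" "sgn1 1 = 1" "sgn1 2 = - 1"
    by (simp_all add: sub_minor_def sgn1_def)
  show ?thesis using lt3[OF assms]
    by (elim disjE) (simp_all only: d 0 1 2 mult_minus1 mult_1_left)
qed

lemma tau2_minors:
  assumes a: "a < 4" and i: "i < 3"
    and Rs: "Rs ! 0 = set (rows0 ! a)" "Rs ! 1 = set (rows1 ! i)" "Rs ! 2 = {0}"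
  shows "ev z (minor Ds2 Rs 0) = 4 * z ^ 3 * fac a"
    "ev z (minor Ds2 Rs 1) = sgn0 a * fac a * sub_minor i" "ev z (minor Ds2 Rs 2) = \<phi> i"
proof -
  have l: "length (rows0 ! a) = 3" "length (cols1 ! a) = 3" "length (rows1 ! i) = 3"
    "sorted_wrt (<) (rows0 ! a)" "sorted_wrt (<) (cols1 ! a)" "sorted_wrt (<) (rows1 ! i)"
    "set (rows0 ! a) \<subseteq> {..<6}" "set (cols1 ! a) \<subseteq> {..<6}" "set (rows1 ! i) \<subseteq> {..<4}"
    "{..<6} - set (rows0 ! a) = set (cols1 ! a)" "{..<4} - set (rows1 ! i) = {i}"
    using lt4[OF a] lt3[OF i] by (auto simp: rows0_def cols1_def rows1_def)
  have "ev z (minor Ds2 Rs 0) = det (mat (length (rows0 ! a)) (length [0, 1, 2::nat]) (\<lambda>(k, l). ev z ((Ds2 ! 0) $$ ((rows0 ! a) ! k, [0, 1, 2] ! l))))"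
    using l Ds2_dims Rs by (intro ev_minor) (auto simp: minor_cols_def)
  also have "\<dots> = det (mat 3 3 (\<lambda>(k, l). ev z ((Ds2 ! 0) $$ ((rows0 ! a) ! k, [0, 1, 2] ! l))))"
    by (simp add: l numeral_3_eq_3)
  also have "\<dots> = 4 * z ^ 3 * fac a"
    using lt4[OF a] by (auto simp: det_3 rows0_def Ds2_index_0 fac_def power3_eq_cube)
  finally show "ev z (minor Ds2 Rs 0) = 4 * z ^ 3 * fac a" .
  have "ev z (minor Ds2 Rs 1) = det (mat (length (rows1 ! i)) (length (cols1 ! a)) (\<lambda>(k, l). ev z ((Ds2 ! 1) $$ ((rows1 ! i) ! k, (cols1 ! a) ! l))))"
    using l Ds2_dims Rs by (intro ev_minor) (auto simp: minor_cols_def)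
  also have "\<dots> = det (mat 3 3 (\<lambda>(k, l). ev z ((Ds2 ! 1) $$ ((rows1 ! i) ! k, (cols1 ! a) ! l))))"
    by (simp only: l)
  also have "\<dots> = sgn0 a * fac a * sub_minor i"
    using lt4[OF a] lt3[OF i] coords(1,2)
    by (auto simp: det_3 rows1_def cols1_def Ds2_index_1[unfolded One_nat_def] fac_def sgn0_def sub_minor_def algebra_simps)
  finally show "ev z (minor Ds2 Rs 1) = sgn0 a * fac a * sub_minor i" .
  have "ev z (minor Ds2 Rs 2) = det (mat (length [0::nat]) (length [i]) (\<lambda>(k, l). ev z ((Ds2 ! 2) $$ ([0] ! k, [i] ! l))))"
    using l Ds2_dims Rs i by (intro ev_minor) (auto simp: minor_cols_def)
  also have "\<dots> = \<phi> i" using i by (simp add: det_1 Ds2_index_2)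
  finally show "ev z (minor Ds2 Rs 2) = \<phi> i" .
qed

end

context two_bridge
begin

lemma row_sets_tau2:
  assumes "row_sets (Vmod p q) Ds2 Rs"
  obtains a i where "a < 4" "i < 3" "Rs ! 0 = set (rows0 ! a)" "Rs ! 1 = set (rows1 ! i)" "Rs ! 2 = {0}"
proof -
  have len: "length Rs = 3" using assms by (simp add: row_sets_def Ds2_def)
  have "last Ds2 = Ds2 ! 2" "length Ds2 = 3" by (simp_all add: Ds2_def)
  moreover have "last Rs = Rs ! 2" using len last_conv_nth[of Rs] by force
  ultimately have R: "Rs ! 2 = {0}" "\<forall>i<3. Rs ! i \<subseteq> {..<dim_row (Ds2 ! i)} \<and>
       card (Rs ! i) = card (minor_cols Ds2 Rs i) \<and> unit_mod (Vmod p q) (minor Ds2 Rs i)"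
    using assms by (auto simp: row_sets_def Ds2_dims)
  have R0: "Rs ! 0 \<subseteq> {..<6}" "card (Rs ! 0) = 3" "unit_mod (Vmod p q) (minor Ds2 Rs 0)"
    using R(2)[rule_format, of 0] by (simp_all add: Ds2_dims minor_cols_def)
  have R1: "Rs ! 1 \<subseteq> {..<4}" "card (Rs ! 1) = 3"
    using R(2)[rule_format, of 1] R0
    by (simp_all add: Ds2_dims Ds2_dims[unfolded One_nat_def] minor_cols_def card_Diff_subset finite_subset)
  have R2: "unit_mod (Vmod p q) (minor Ds2 Rs 2)"
    using R(2)[rule_format, of 2] by simp
  obtain z where z: "z \<in> Z" using Z_nonempty by auto
  then interpret parabolic_root p q z by (rule Z_root)
  obtain xs where xs: "sorted_wrt (<) xs" "set xs = Rs ! 0" "length xs = card (Rs ! 0)"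
    using R0(1) finite_nat_set_as_list[of "Rs ! 0"] finite_subset by blast
  then have "length xs = 3" using R0(2) by simp
  then obtain b c d where bcd: "xs = [b, c, d]" "b < c" "c < d" using length_3_sorted[OF _ xs(1)] by blast
  then have d: "d < 6" using xs R0(1) by auto
  have "ev z (minor Ds2 Rs 0) = det (mat (length xs) (length [0, 1, 2::nat]) (\<lambda>(k, l). ev z ((Ds2 ! 0) $$ (xs ! k, [0, 1, 2] ! l))))"
    using xs R0(1) Ds2_dims by (intro ev_minor) (auto simp: minor_cols_def)
  also have "\<dots> = det (mat 3 3 (\<lambda>(k, l). ev z ((Ds2 ! 0) $$ (xs ! k, [0, 1, 2] ! l))))"
    by (simp add: bcd(1) numeral_3_eq_3)
  finally have m0: "ev z (minor Ds2 Rs 0) = det (mat 3 3 (\<lambda>(k, l). ev z ((Ds2 ! 0) $$ (xs ! k, [0, 1, 2] ! l))))" .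
  have "xs \<in> set rows0"
  proof (rule ccontr)
    assume "xs \<notin> set rows0"
    moreover have "b \<in> {0, 1, 2, 3}" "c \<in> {1, 2, 3, 4}" "d \<in> {2, 3, 4, 5}" using bcd d by auto
    ultimately have "ev z (minor Ds2 Rs 0) = 0"
      unfolding m0 using bcd(2,3) by (auto simp: bcd(1) det_3 rows0_def Ds2_index_0)
    moreover have "ev z (minor Ds2 Rs 0) \<noteq> 0" using R0(3) z by (simp add: unit_mod_iff)
    ultimately show False by simp
  qed
  then obtain a where "a < length rows0" "rows0 ! a = xs" unfolding in_set_conv_nth by blast
  then have a: "a < 4" "xs = rows0 ! a" by (simp add: rows0_def, simp only:)
  obtain ys where ys: "sorted_wrt (<) ys" "set ys = Rs ! 1" "length ys = card (Rs ! 1)"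
    using R1(1) finite_nat_set_as_list[of "Rs ! 1"] finite_subset by blast
  then have "length ys = 3" using R1(2) by simp
  then obtain b c d where bcd: "ys = [b, c, d]" "b < c" "c < d" using length_3_sorted[OF _ ys(1)] by blast
  then have d: "d < 4" using ys R1(1) by auto
  then have "b \<in> {0, 1}" "c \<in> {1, 2}" "d \<in> {2, 3}" using bcd by auto
  then have ys_cases: "ys \<in> set rows1 \<or> ys = [0, 1, 2]" using bcd(2,3) by (auto simp: bcd(1) rows1_def)
  have "ys \<noteq> [0, 1, 2]"
  proof
    assume "ys = [0, 1, 2]"
    then have R1': "Rs ! 1 = {0, 1, 2}" using ys by auto
    have "{..<4} - {0, 1, 2} = {3::nat}" by auto
    then have "ev z (minor Ds2 Rs 2) = det (mat (length [0::nat]) (length [3::nat]) (\<lambda>(k, l). ev z ((Ds2 ! 2) $$ ([0] ! k, [3] ! l))))"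
      using Ds2_dims R(1) R1' by (intro ev_minor) (auto simp: minor_cols_def)
    then have "ev z (minor Ds2 Rs 2) = 0" by (simp add: det_1 Ds2_index_2)
    moreover have "ev z (minor Ds2 Rs 2) \<noteq> 0" using R2 z by (simp add: unit_mod_iff)
    ultimately show False by simp
  qed
  with ys_cases obtain i where "i < length rows1" "rows1 ! i = ys" unfolding in_set_conv_nth by blast
  then have i: "i < 3" "ys = rows1 ! i" by (simp add: rows1_def, simp only:)
  show thesis using that[of a i] a i xs ys R(1) by simp
qed

lemma tau2_value:
  obtains s :: complex where "s \<in> {1, - 1}"
    "\<And>z. z \<in> Z \<Longrightarrow> 1 / ev z (tau2 p q) =
      s * 4 * (parabolic_root.j p q z * z\<^sup>2 * (parabolic_root.R p q z n)\<^sup>2 / parabolic_root.dP p q z)"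
proof -
  have len: "length Ds2 = 3" by (simp add: Ds2_def)
  have "row_sets (Vmod p q) Ds2 [set (rows0 ! 0), set (rows1 ! 2), {0}]"
  proof -
    let ?Rs = "[set (rows0 ! 0), set (rows1 ! 2), {0::nat}]"
    have "ev z (minor Ds2 ?Rs i) \<noteq> 0" if "z \<in> Z" "i < 3" for z i
    proof -
      interpret parabolic_root p q z using that(1) by (rule Z_root)
      have "\<phi> 2 \<noteq> 0" "sub_minor 2 \<noteq> 0"
        using coords(3,4) R_n_nz j_nz z_nz dP_nz by (simp_all add: sub_minor_def)
      then show ?thesis using tau2_minors[of 0 2 ?Rs] lt3[OF that(2)] z_nz
        by (auto simp: fac_def sgn0_def)
    qed
    then have u: "unit_mod (Vmod p q) (minor Ds2 ?Rs i)" if "i < 3" for i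
      using that by (simp add: unit_mod_iff)
    have c: "card ({..<6} - set (rows0 ! 0)) = 3" "card ({..<4} - set (rows1 ! 2)) = 1"
      "set (rows0 ! 0) \<subseteq> {..<6}" "set (rows1 ! 2) \<subseteq> {..<4}" "card (set (rows0 ! 0)) = 3" "card (set (rows1 ! 2)) = 3"
    proof -
      have "{..<6} - set (rows0 ! 0) = {2, 3, 5}" "{..<4} - set (rows1 ! 2) = {2}"
        by (auto simp: rows0_def rows1_def)
      then show "card ({..<6} - set (rows0 ! 0)) = 3" "card ({..<4} - set (rows1 ! 2)) = 1" by simp_all
    qed (auto simp: rows0_def rows1_def)
    have "?Rs ! i \<subseteq> {..<dim_row (Ds2 ! i)} \<and> card (?Rs ! i) = card (minor_cols Ds2 ?Rs i)" if "i < 3" for i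
      using lt3[OF that] c Ds2_dims by (elim disjE) (simp_all add: minor_cols_def)
    moreover have "last Ds2 = Ds2 ! 2" by (simp add: Ds2_def)
    ultimately show ?thesis using u Ds2_dims unfolding row_sets_def len by auto
  qed
  then obtain Rs s where Rs': "row_sets (Vmod p q) Ds2 Rs" "s \<in> {1, - 1}"
    "[tau2 p q * (\<Prod>i | i < length Ds2 \<and> even i. minor Ds2 Rs i) =
      s * (\<Prod>i | i < length Ds2 \<and> odd i. minor Ds2 Rs i)] (mod Vmod p q)"
    using torsion_exists unfolding is_torsion_def tau2_def Ds2_def[symmetric] by blast
  obtain a i where ai: "a < 4" "i < 3" "Rs ! 0 = set (rows0 ! a)" "Rs ! 1 = set (rows1 ! i)" "Rs ! 2 = {0}"
    using row_sets_tau2[OF Rs'(1)] .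
  have sets: "{i. i < length Ds2 \<and> even i} = {0, 2}" "{i. i < length Ds2 \<and> odd i} = {1}"
    by (auto simp: len dest!: lt3)
  define c where "c = (if s = 1 then 1 else - 1) * sgn0 a * sgn1 i"
  have c: "c \<in> {1, - 1}" using lt4[OF ai(1)] lt3[OF ai(2)] by (auto simp: c_def sgn0_def sgn1_def)
  have evs: "ev z s = (if s = 1 then 1 else - 1)" for z using Rs'(2) by auto
  show thesis
  proof (rule that)
    show "- c \<in> {1, - 1}" using c by auto
    fix z assume z: "z \<in> Z"
    then interpret parabolic_root p q z by (rule Z_root)
    note m = tau2_minors[OF ai]
    have u: "\<phi> i \<noteq> 0" "fac a \<noteq> 0"
    proof -
      have "ev z (minor Ds2 Rs 2) \<noteq> 0"
        using Rs'(1) z by (auto simp: row_sets_def len unit_mod_iff)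
      then show "\<phi> i \<noteq> 0" using m by simp
      show "fac a \<noteq> 0" using lt4[OF ai(1)] z_nz by (auto simp: fac_def)
    qed
    have "ev z (tau2 p q * (minor Ds2 Rs 0 * minor Ds2 Rs 2)) = ev z (s * minor Ds2 Rs 1)"
      using Rs'(3) z unfolding sets Z_ev by (intro ev_cong) simp_all
    then have e: "ev z (tau2 p q) * (4 * z ^ 3 * fac a * \<phi> i) = ev z s * (sgn0 a * fac a * sub_minor i)"
      by (simp only: m ev_simps)
    have "ev z (tau2 p q) * (4 * z ^ 3 * fac a * \<phi> i) * (4 * z\<^sup>2 * (R n)\<^sup>2) =
        ev z s * sgn0 a * fac a * (sub_minor i * (4 * z\<^sup>2 * (R n)\<^sup>2))" unfolding e by (simp only: mult_ac)
    also have "\<dots> = c * (j * dP) * (4 * z ^ 3 * fac a * \<phi> i)"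
      unfolding sub_minor_eq[OF ai(2)] c_def evs by (simp add: mult_ac)
    finally have "(ev z (tau2 p q) * (4 * z\<^sup>2 * (R n)\<^sup>2)) * (4 * z ^ 3 * fac a * \<phi> i) = (c * (j * dP)) * (4 * z ^ 3 * fac a * \<phi> i)"
      by (simp only: mult_ac)
    moreover have nz: "4 * z ^ 3 * fac a * \<phi> i \<noteq> 0" using u z_nz by simp
    ultimately have t: "ev z (tau2 p q) * (4 * z\<^sup>2 * (R n)\<^sup>2) = c * (j * dP)"
      using mult_right_cancel[OF nz] by blast
    have cc: "c * c = 1" using c by auto
    have "ev z (tau2 p q) * (- c * 4 * (j * z\<^sup>2 * (R n)\<^sup>2 / dP)) =
        (ev z (tau2 p q) * (4 * z\<^sup>2 * (R n)\<^sup>2)) * (- c * j / dP)" by simp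
    also have "\<dots> = - (c * c) * (j * j) * (dP / dP)" unfolding t by (simp add: mult_ac)
    also have "\<dots> = 1" using dP_nz by (simp add: cc j_sq)
    finally have "ev z (tau2 p q) * (- c * 4 * (j * z\<^sup>2 * (R n)\<^sup>2 / dP)) = 1" .
    then show "1 / ev z (tau2 p q) = - c * 4 * (j * z\<^sup>2 * (R n)\<^sup>2 / dP)"
      by (metis divide_eq_eq mult.commute mult_zero_left zero_neq_one)
  qed
qed

end

section \<open>Parabolic representations\<close>

lemma m2_det_cancel:
  fixes A B C :: "complex m2"
  assumes "det_m2 A = 1" "A * B = A * C"
  shows "B = C"
proof -
  let ?A' = "M2 (e22 A) (- e12 A) (- e21 A) (e11 A)"
  have "?A' * A = 1" using assms(1) by (intro m2.expand) (simp add: det_m2_def algebra_simps)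
  then have "B = ?A' * (A * B)" "C = ?A' * (A * C)" by (simp_all add: mult.assoc[symmetric])
  with assms(2) show ?thesis by simp
qed

lemma m2_trace_conj:
  fixes A B g :: "complex m2"
  assumes "det_m2 g = 1" "B * g = g * A"
  shows "e11 A + e22 A = e11 B + e22 B"
proof -
  let ?g = "M2 (e22 g) (- e12 g) (- e21 g) (e11 g)"
  have "g * ?g = 1" using assms(1) by (intro m2.expand) (simp add: det_m2_def algebra_simps)
  then have "B = B * g * ?g" by (simp add: mult.assoc)
  then have "B = g * A * ?g" unfolding assms(2) .
  then have "e11 B + e22 B = det_m2 g * (e11 A + e22 A)" by (simp add: det_m2_def algebra_simps)
  then show ?thesis using assms(1) by simp
qed

lemma det_mat_m2: "det (mat_m2 A) = det_m2 A"
proof -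
  have "mat_m2 A = mat 2 2 (\<lambda>(i, k). mat_m2 A $$ (i, k))" by (rule eq_matI) auto
  then show ?thesis
    using det_2[of "\<lambda>(i, k). mat_m2 A $$ (i, k)"] by (simp add: det_m2_def)
qed

lemma mtrace_m2: "mtrace (mat_m2 A) = e11 A + e22 A"
  by (simp add: mtrace_def numeral_2_eq_2)

lemma carrier_SL2: "mat_m2 A \<in> carrier SL2 \<longleftrightarrow> det_m2 A = 1"
  by (simp add: SL2_def det_mat_m2)

lemma SL2_m2:
  assumes "g \<in> carrier SL2"
  obtains A where "g = mat_m2 A" "det_m2 A = 1"
proof -
  have "g \<in> carrier_mat 2 2" using assms by (simp add: SL2_def)
  from mat_m2_surj[OF this] obtain A where "g = mat_m2 A" by blast
  with assms that show thesis by (simp add: carrier_SL2)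
qed

text \<open>A unipotent matrix is \<open>1 + a \<otimes> \<omega>(a, \<cdot>)\<close> for a vector \<open>a = (s, t)\<close> and the area form
  \<open>\<omega>\<close>.\<close>

definition transvection :: "complex \<Rightarrow> complex \<Rightarrow> complex m2" where
  "transvection s t = M2 (1 - s * t) (s * s) (- t * t) (1 + s * t)"

lemma parabolic_transvection:
  assumes "det_m2 A = 1" "e11 A + e22 A = 2"
  obtains s t where "A = transvection s t"
proof -
  define m where "m = e22 A - 1"
  have A: "e11 A = 1 - m" "e22 A = 1 + m" using assms(2) by (simp_all add: m_def algebra_simps)
  have mm: "m * m = - e12 A * e21 A" using assms(1) by (simp add: det_m2_def A algebra_simps add_eq_0_iff)
  define s where "s = csqrt (e12 A)"
  define t where "t = csqrt (- e21 A)"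
  have s: "s * s = e12 A" and t: "t * t = - e21 A"
    using power2_csqrt[of "e12 A"] power2_csqrt[of "- e21 A"] by (simp_all add: s_def t_def power2_eq_square)
  have "m * m = (s * t) * (s * t)" using mm s t by (simp add: algebra_simps)
  then have "m = s * t \<or> m = - (s * t)" by (simp add: square_eq_iff)
  then show thesis
  proof
    assume "m = s * t"
    then have "A = transvection s t" using A s t by (intro m2.expand) (simp add: transvection_def)
    then show thesis by (rule that)
  next
    assume "m = - (s * t)"
    then have "A = transvection s (- t)" using A s t by (intro m2.expand) (simp add: transvection_def)
    then show thesis by (rule that)
  qed
qed

lemma transvection_normal_form:
  assumes \<kappa>: "s * t' - t * s' \<noteq> (0::complex)"
  obtains g z where "det_m2 g = 1" "z \<noteq> 0" "transvection s t * g = g * gen_m2 z U"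
    "transvection s' t' * g = g * gen_m2 z V"
proof -
  define \<kappa> where "\<kappa> = s * t' - t * s'"
  define \<mu> where "\<mu> = csqrt (\<i> / \<kappa>)"
  have k: "\<kappa> \<noteq> 0" using assms by (simp add: \<kappa>_def)
  have \<mu>: "\<mu> * \<mu> * \<kappa> = \<i>"
    using power2_csqrt[of "\<i> / \<kappa>"] k by (simp add: \<mu>_def power2_eq_square)
  let ?g = "M2 (- \<i> * \<mu> * s) (\<mu> * s') (- \<i> * \<mu> * t) (\<mu> * t')"
  show thesis
  proof (rule that[of ?g "\<i> * \<kappa>"])
    have "det_m2 ?g = - \<i> * (\<mu> * \<mu> * \<kappa>)" by (simp add: det_m2_def \<kappa>_def algebra_simps)
    then show "det_m2 ?g = 1" by (simp add: \<mu>)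
    show "\<i> * \<kappa> \<noteq> 0" using k by simp
    show "transvection s t * ?g = ?g * gen_m2 (\<i> * \<kappa>) U" "transvection s' t' * ?g = ?g * gen_m2 (\<i> * \<kappa>) V"
      by (rule m2.expand; simp add: transvection_def \<kappa>_def algebra_simps)+
  qed
qed

context two_bridge
begin

lemma in_carrier: "word_class {relator p q} a \<in> carrier (knot_group p q)"
  by (simp add: knot_group_def carrier_presented_group)

lemma knot_group_cases:
  assumes "\<gamma> \<in> carrier (knot_group p q)"
  obtains a where "\<gamma> = word_class {relator p q} a"
  using assms by (auto simp: knot_group_def carrier_presented_group)

lemma inv_word_class:
  "inv\<^bsub>knot_group p q\<^esub> (word_class {relator p q} a) = word_class {relator p q} (winv a)"
proof (rule group.inv_equality[OF _ _ in_carrier in_carrier])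
  show "group (knot_group p q)" unfolding knot_group_def by (rule group_presented_group)
  show "word_class {relator p q} (winv a) \<otimes>\<^bsub>knot_group p q\<^esub> word_class {relator p q} a = \<one>\<^bsub>knot_group p q\<^esub>"
    by (simp add: knot_group_def mult_presented_group one_presented_group word_class_eq_iff pres_eq_winv_left)
qed

lemma meridians_eq:
  "meridians p q = {word_class {relator p q} (a @ [(U, b)] @ winv a) | a b. True}"
proof -
  let ?K = "knot_group p q" and ?c = "word_class {relator p q}"
  have m: "?c (a @ [(U, True)] @ winv a) = ?c a \<otimes>\<^bsub>?K\<^esub> gen_elem p q U \<otimes>\<^bsub>?K\<^esub> inv\<^bsub>?K\<^esub> (?c a)"
    "?c (a @ [(U, False)] @ winv a) =
      ?c a \<otimes>\<^bsub>?K\<^esub> inv\<^bsub>?K\<^esub> (gen_elem p q U) \<otimes>\<^bsub>?K\<^esub> inv\<^bsub>?K\<^esub> (?c a)" for a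
  proof -
    have "inv\<^bsub>?K\<^esub> (gen_elem p q U) = ?c [(U, False)]"
      unfolding gen_elem_def inv_word_class by (simp add: winv_def)
    then show "?c (a @ [(U, True)] @ winv a) = ?c a \<otimes>\<^bsub>?K\<^esub> gen_elem p q U \<otimes>\<^bsub>?K\<^esub> inv\<^bsub>?K\<^esub> (?c a)"
      "?c (a @ [(U, False)] @ winv a) =
        ?c a \<otimes>\<^bsub>?K\<^esub> inv\<^bsub>?K\<^esub> (gen_elem p q U) \<otimes>\<^bsub>?K\<^esub> inv\<^bsub>?K\<^esub> (?c a)"
      unfolding inv_word_class by (simp_all add: knot_group_def gen_elem_def mult_presented_group)
  qed
  show ?thesis
  proof (intro equalityI subsetI)
    fix x assume "x \<in> meridians p q"
    then obtain g m where x: "x = g \<otimes>\<^bsub>?K\<^esub> m \<otimes>\<^bsub>?K\<^esub> inv\<^bsub>?K\<^esub> g" "g \<in> carrier ?K"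
      "m = gen_elem p q U \<or> m = inv\<^bsub>?K\<^esub> (gen_elem p q U)"
      unfolding meridians_def by blast
    from x(2) obtain a where a: "g = ?c a" by (rule knot_group_cases)
    from x(3) have "x = ?c (a @ [(U, True)] @ winv a) \<or> x = ?c (a @ [(U, False)] @ winv a)"
      unfolding x(1) a m by blast
    then show "x \<in> {?c (a @ [(U, b)] @ winv a) | a b. True}" by blast
  next
    fix x assume "x \<in> {?c (a @ [(U, b)] @ winv a) | a b. True}"
    then obtain a b where "x = ?c (a @ [(U, b)] @ winv a)" by blast
    then have "x = ?c a \<otimes>\<^bsub>?K\<^esub> gen_elem p q U \<otimes>\<^bsub>?K\<^esub> inv\<^bsub>?K\<^esub> (?c a) \<or>
        x = ?c a \<otimes>\<^bsub>?K\<^esub> inv\<^bsub>?K\<^esub> (gen_elem p q U) \<otimes>\<^bsub>?K\<^esub> inv\<^bsub>?K\<^esub> (?c a)"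
      by (cases b) (simp_all only: m simp_thms)
    then show "x \<in> meridians p q" unfolding meridians_def using in_carrier[of a] by blast
  qed
qed

end

locale knot_rep = two_bridge +
  fixes \<rho> :: "word set \<Rightarrow> complex mat"
  assumes par: "\<rho> \<in> par_reps p q"
begin

definition M :: "word \<Rightarrow> complex m2" where
  "M a = (THE A. \<rho> (word_class {relator p q} a) = mat_m2 A)"

lemma hom: "\<rho> \<in> hom (knot_group p q) SL2"
  using par by (simp add: par_reps_def)

lemma M: "\<rho> (word_class {relator p q} a) = mat_m2 (M a)" and det_M: "det_m2 (M a) = 1"
proof -
  have "\<rho> (word_class {relator p q} a) \<in> carrier SL2" using hom in_carrier by (auto simp: hom_def)
  then obtain A where A: "\<rho> (word_class {relator p q} a) = mat_m2 A" "det_m2 A = 1" by (rule SL2_m2)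
  then have "M a = A" by (simp add: M_def mat_m2_inj)
  with A show "\<rho> (word_class {relator p q} a) = mat_m2 (M a)" "det_m2 (M a) = 1" by simp_all
qed

lemma M_append: "M (a @ b) = M a * M b"
proof -
  have "\<rho> (word_class {relator p q} a \<otimes>\<^bsub>knot_group p q\<^esub> word_class {relator p q} b) = mat_m2 (M a * M b)"
    using hom_mult[OF hom in_carrier in_carrier, of a b] by (simp add: M SL2_def mat_m2_mult)
  then have "\<rho> (word_class {relator p q} (a @ b)) = mat_m2 (M a * M b)"
    by (simp add: knot_group_def mult_presented_group)
  then show ?thesis by (simp add: M mat_m2_inj)
qed

lemma M_Nil: "M [] = 1"
proof (rule m2_det_cancel[OF det_M])
  show "M [] * M [] = M [] * 1" using M_append[of "[]" "[]"] by simp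
qed

lemma M_pres_eq: "pres_eq {relator p q} a b \<Longrightarrow> M a = M b"
  using word_class_eq_iff[of "{relator p q}" a b] M[of a] M[of b] by (simp add: mat_m2_inj)

lemma M_relator: "M (relator p q) = 1"
  using M_pres_eq[of "relator p q" "[]"] M_Nil by (simp add: pres_rel)

lemma M_cancel: "M [(g, False)] * M [(g, True)] = 1"
  using M_append[of "[(g, False)]" "[(g, True)]"] M_pres_eq[OF pres_cancel, of "(g, False)"] M_Nil by simp

lemma M_gen_parabolic: "M [(g, True)] \<noteq> 1" "e11 (M [(g, True)]) + e22 (M [(g, True)]) = 2"
proof -
  let ?c = "word_class {relator p q}"
  have conj: "?c (a @ [(U, True)] @ winv a) \<in> meridians p q" for a
    unfolding meridians_eq by blast
  have "\<exists>a. M (a @ [(U, True)] @ winv a) = M [(g, True)]"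
  proof (cases g)
    case U
    then show ?thesis by (intro exI[of _ "[]"]) (simp add: winv_def)
  next
    case V
    have "M (wword p q @ [(U, True)] @ winv (wword p q)) * M [(V, False)] = 1"
      using M_relator unfolding relator_def M_append by (simp only: mult.assoc)
    then have "M (wword p q @ [(U, True)] @ winv (wword p q)) * (M [(V, False)] * M [(V, True)]) = M [(V, True)]"
      by (simp add: mult.assoc[symmetric])
    then show ?thesis using V M_cancel[of V] by auto
  qed
  then obtain a where a: "M (a @ [(U, True)] @ winv a) = M [(g, True)]" ..
  have "\<rho> (?c (a @ [(U, True)] @ winv a)) \<noteq> 1\<^sub>m 2 \<and> mtrace (\<rho> (?c (a @ [(U, True)] @ winv a))) = 2"
    using par conj by (simp add: par_reps_def parabolic_rep_def)
  then show "M [(g, True)] \<noteq> 1" "e11 (M [(g, True)]) + e22 (M [(g, True)]) = 2"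
    unfolding M a mtrace_m2 mat_m2_one[symmetric] mat_m2_inj by simp_all
qed

lemma no_common_eigenvector:
  assumes "s \<noteq> 0 \<or> t \<noteq> 0"
    and "\<And>a. e11 (M a) * s + e12 (M a) * t = s \<and> e21 (M a) * s + e22 (M a) * t = t"
  shows False
proof -
  define v where "v = vec 2 (\<lambda>i. if i = 0 then s else t)"
  have v: "v \<in> carrier_vec 2" "v \<noteq> 0\<^sub>v 2"
  proof -
    show "v \<in> carrier_vec 2" by (simp add: v_def)
    show "v \<noteq> 0\<^sub>v 2"
    proof
      assume "v = 0\<^sub>v 2"
      then have "v $ 0 = 0" "v $ 1 = 0" by simp_all
      with assms(1) show False by (simp add: v_def)
    qed
  qed
  have ev: "mat_m2 (M a) *\<^sub>v v = 1 \<cdot>\<^sub>v v" for a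
  proof (rule eq_vecI)
    fix i assume "i < dim_vec (1 \<cdot>\<^sub>v v)"
    then have i: "i = 0 \<or> i = 1" by (auto simp: v_def)
    have s2: "{0..<2::nat} = {0, 1}" by auto
    show "(mat_m2 (M a) *\<^sub>v v) $ i = (1 \<cdot>\<^sub>v v) $ i"
      using i assms(2)[of a] by (auto simp: scalar_prod_def v_def s2)
  qed (simp add: v_def)
  have "\<forall>\<gamma>\<in>carrier (knot_group p q). \<exists>c. \<rho> \<gamma> *\<^sub>v v = c \<cdot>\<^sub>v v"
  proof
    fix \<gamma> assume "\<gamma> \<in> carrier (knot_group p q)"
    then obtain a where "\<gamma> = word_class {relator p q} a" by (rule knot_group_cases)
    then have "\<rho> \<gamma> *\<^sub>v v = 1 \<cdot>\<^sub>v v" using ev[of a] by (simp only: M)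
    then show "\<exists>c. \<rho> \<gamma> *\<^sub>v v = c \<cdot>\<^sub>v v" by (rule exI)
  qed
  with v par show False unfolding par_reps_def irreducible_rep_def by blast
qed

lemma M_word:
  assumes "\<And>g. M [(g, True)] * A = A * gen_m2 z g"
  shows "M a * A = A * word_m2 z a"
proof -
  have l: "M [l] * A = A * letter_m2 z l" for l
  proof (cases l)
    case (Pair g b)
    show ?thesis
    proof (cases b)
      case True
      then show ?thesis using assms[of g] by (simp add: Pair letter_m2_def)
    next
      case False
      have "M [(g, False)] * (A * letter_m2 z (g, True)) = M [(g, False)] * (M [(g, True)] * A)"
        using assms[of g] by (simp add: letter_m2_def)
      also have "\<dots> = A" unfolding mult.assoc[symmetric] M_cancel by simp
      finally have "M [(g, False)] * (A * letter_m2 z (g, True)) = A" .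
      then have "M [(g, False)] * A * letter_m2 z (g, True) * letter_m2 z (g, False) = A * letter_m2 z (g, False)"
        by (simp add: mult.assoc)
      then show ?thesis using False by (simp add: Pair mult.assoc letter_m2_inverse)
    qed
  qed
  show ?thesis
  proof (induction a)
    case (Cons x a)
    have "M (x # a) = M [x] * M a" using M_append[of "[x]" a] by simp
    then have "M (x # a) * A = M [x] * A * word_m2 z a" using Cons by (simp add: mult.assoc)
    then show ?case by (simp add: l mult.assoc)
  qed (simp add: M_Nil)
qed

lemma normal_form:
  obtains A z where "det_m2 A = 1" "z \<in> Z" "\<And>a. M a * A = A * word_m2 z a"
proof -
  obtain s t where u: "M [(U, True)] = transvection s t"
    using parabolic_transvection[OF det_M M_gen_parabolic(2)] .
  obtain s' t' where v: "M [(V, True)] = transvection s' t'"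
    using parabolic_transvection[OF det_M M_gen_parabolic(2)] .
  have "s * t' - t * s' \<noteq> 0"
  proof
    assume k: "s * t' - t * s' = 0"
    define \<sigma> where "\<sigma> a \<longleftrightarrow> e11 (M a) * s + e12 (M a) * t = s \<and> e21 (M a) * s + e22 (M a) * t = t" for a
    have mult: "\<sigma> (a @ b)" if "\<sigma> a" "\<sigma> b" for a b
    proof -
      have "e11 (M (a @ b)) * s + e12 (M (a @ b)) * t =
          e11 (M a) * (e11 (M b) * s + e12 (M b) * t) + e12 (M a) * (e21 (M b) * s + e22 (M b) * t)"
        "e21 (M (a @ b)) * s + e22 (M (a @ b)) * t =
          e21 (M a) * (e11 (M b) * s + e12 (M b) * t) + e22 (M a) * (e21 (M b) * s + e22 (M b) * t)"
        by (simp_all add: M_append algebra_simps)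
      then show ?thesis using that by (simp add: \<sigma>_def)
    qed
    have gen: "\<sigma> [(g, True)]" for g
    proof (cases g)
      case U
      then show ?thesis by (simp add: \<sigma>_def u transvection_def algebra_simps)
    next
      case V
      have e: "e11 (M [(V, True)]) * s + e12 (M [(V, True)]) * t = s - s' * (s * t' - t * s')"
        "e21 (M [(V, True)]) * s + e22 (M [(V, True)]) * t = t - t' * (s * t' - t * s')"
        by (simp_all add: v transvection_def algebra_simps)
      show ?thesis using e unfolding V \<sigma>_def k by simp
    qed
    have inv: "\<sigma> [(g, False)]" for g
    proof -
      let ?B = "M [(g, False)]" and ?C = "M [(g, True)]"
      have "e11 (?B * ?C) * s + e12 (?B * ?C) * t =
          e11 ?B * (e11 ?C * s + e12 ?C * t) + e12 ?B * (e21 ?C * s + e22 ?C * t)"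
        "e21 (?B * ?C) * s + e22 (?B * ?C) * t =
          e21 ?B * (e11 ?C * s + e12 ?C * t) + e22 ?B * (e21 ?C * s + e22 ?C * t)"
        by (simp_all add: algebra_simps)
      then show ?thesis using gen[of g] unfolding M_cancel \<sigma>_def by simp
    qed
    have "\<sigma> a" for a
    proof (induction a)
      case Nil
      show ?case by (simp add: \<sigma>_def M_Nil)
    next
      case (Cons l a)
      have "\<sigma> [l]" using gen inv by (cases l; cases "snd l") auto
      then show ?case using mult[of "[l]" a] Cons by simp
    qed
    moreover have "s \<noteq> 0 \<or> t \<noteq> 0"
    proof (rule ccontr)
      assume "\<not> (s \<noteq> 0 \<or> t \<noteq> 0)"
      then have "M [(U, True)] = 1" by (simp add: u transvection_def m2_defs)
      then show False using M_gen_parabolic(1) by simp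
    qed
    ultimately show False using no_common_eigenvector[of s t] unfolding \<sigma>_def by blast
  qed
  then obtain A z where Az: "det_m2 A = 1" "z \<noteq> 0" "transvection s t * A = A * gen_m2 z U"
    "transvection s' t' * A = A * gen_m2 z V"
    by (rule transvection_normal_form)
  have gens: "M [(g, True)] * A = A * gen_m2 z g" for g
    using Az u v by (cases g) simp_all
  have word: "M a * A = A * word_m2 z a" for a
    by (rule M_word[OF gens])
  have r: "word_m2 z (relator p q) = 1"
  proof (rule m2_det_cancel[OF Az(1)])
    show "A * word_m2 z (relator p q) = A * 1" using word[of "relator p q"] unfolding M_relator by simp
  qed
  let ?W = "word_m2 z (wword p q)"
  have "word_m2 z (relator p q) = ?W * (gen_m2 z U * (word_m2 z (winv (wword p q)) * gen_m2 (- z) V))"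
    by (simp add: relator_def word_m2_append letter_m2_def)
  then have "gen_m2 z V * ?W =
      ?W * (gen_m2 z U * (word_m2 z (winv (wword p q)) * gen_m2 (- z) V)) * (gen_m2 z V * ?W)"
    unfolding r by simp
  also have "\<dots> = ?W * gen_m2 z U * (word_m2 z (winv (wword p q)) * (gen_m2 (- z) V * gen_m2 z V) * ?W)"
    by (simp only: mult.assoc)
  also have "gen_m2 (- z) V * gen_m2 z V = 1" by (simp add: m2_defs)
  finally have "?W * gen_m2 z U = gen_m2 z V * ?W" by (simp add: word_m2_winv)
  then have "e12 (?W * gen_m2 z U) = e12 (gen_m2 z V * ?W)" by simp
  then have "e11 ?W * z = 0" by simp
  then have "z \<in> Z" using Az(2) by (simp add: word_m2_wword Z_def)
  from Az(1) this word show thesis by (rule that)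
qed

end

context two_bridge
begin

definition root_rep :: "complex \<Rightarrow> word set \<Rightarrow> complex mat" where
  "root_rep z A = mat_m2 (word_m2 z (SOME a. a \<in> A))"

lemma root_rep:
  assumes "word_m2 z (relator p q) = 1"
  shows "root_rep z (word_class {relator p q} a) = mat_m2 (word_m2 z a)"
proof -
  have "(SOME b. b \<in> word_class {relator p q} a) \<in> word_class {relator p q} a"
    by (rule someI[of _ a]) (simp add: word_class_def pres_refl)
  then have "pres_eq {relator p q} a (SOME b. b \<in> word_class {relator p q} a)"
    by (simp add: word_class_def)
  then have "word_m2 z a = word_m2 z (SOME b. b \<in> word_class {relator p q} a)"
    by (rule word_m2_pres_eq) (simp add: assms)
  then show ?thesis by (simp add: root_rep_def)
qed

lemma two_bridge_root_rep:
  assumes "z \<in> Z"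
  shows "root_rep z (word_class {relator p q} a) = mat_m2 (word_m2 z a)"
  by (rule root_rep) (rule parabolic_root.word_m2_relator[OF Z_root[OF assms]])

lemma root_rep_in_par_reps:
  assumes "z \<in> Z"
  shows "root_rep z \<in> par_reps p q"
proof -
  note rep = two_bridge_root_rep[OF assms]
  have z: "z \<noteq> 0" by (rule parabolic_root.z_nz[OF Z_root[OF assms]])
  have "root_rep z \<in> hom (knot_group p q) SL2"
  proof (rule homI)
    fix \<gamma> assume "\<gamma> \<in> carrier (knot_group p q)"
    then obtain a where a: "\<gamma> = word_class {relator p q} a" by (rule knot_group_cases)
    show "root_rep z \<gamma> \<in> carrier SL2" by (simp add: a rep carrier_SL2 word_m2_det)
    fix \<delta> assume "\<delta> \<in> carrier (knot_group p q)"
    then obtain b where b: "\<delta> = word_class {relator p q} b" by (rule knot_group_cases)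
    have "\<gamma> \<otimes>\<^bsub>knot_group p q\<^esub> \<delta> = word_class {relator p q} (a @ b)"
      by (simp add: a b knot_group_def mult_presented_group)
    then show "root_rep z (\<gamma> \<otimes>\<^bsub>knot_group p q\<^esub> \<delta>) = root_rep z \<gamma> \<otimes>\<^bsub>SL2\<^esub> root_rep z \<delta>"
      by (simp add: a b rep SL2_def word_m2_append mat_m2_mult)
  qed
  moreover have "irreducible_rep p q (root_rep z)"
    unfolding irreducible_rep_def
  proof
    assume "\<exists>v\<in>carrier_vec 2. v \<noteq> 0\<^sub>v 2 \<and>
      (\<forall>\<gamma>\<in>carrier (knot_group p q). \<exists>c. root_rep z \<gamma> *\<^sub>v v = c \<cdot>\<^sub>v v)"
    then obtain v where v: "v \<in> carrier_vec 2" "v \<noteq> 0\<^sub>v 2"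
      and e: "\<And>\<gamma>. \<gamma> \<in> carrier (knot_group p q) \<Longrightarrow> \<exists>c. root_rep z \<gamma> *\<^sub>v v = c \<cdot>\<^sub>v v" by blast
    have s2: "{0..<2::nat} = {0, 1}" by auto
    have ex: "\<exists>c. e11 (gen_m2 z g) * v $ 0 + e12 (gen_m2 z g) * v $ 1 = c * v $ 0 \<and>
        e21 (gen_m2 z g) * v $ 0 + e22 (gen_m2 z g) * v $ 1 = c * v $ 1" for g
    proof -
      obtain c where c: "root_rep z (word_class {relator p q} [(g, True)]) *\<^sub>v v = c \<cdot>\<^sub>v v"
        using e[OF in_carrier] by blast
      have g: "word_m2 z [(g, True)] = gen_m2 z g" by (simp add: letter_m2_def)
      have "mat_m2 (gen_m2 z g) *\<^sub>v v = c \<cdot>\<^sub>v v" using c unfolding rep g .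
      then have i: "(mat_m2 (gen_m2 z g) *\<^sub>v v) $ i = (c \<cdot>\<^sub>v v) $ i" for i by simp
      show ?thesis
        using i[of 0] i[of 1] v(1) by (intro exI[of _ c]) (simp add: scalar_prod_def s2)
    qed
    from ex[of U] obtain c where "v $ 0 + z * v $ 1 = c * v $ 0" "v $ 1 = c * v $ 1" by auto
    then have v1: "v $ 1 = 0" using z by (cases "v $ 1 = 0") auto
    from ex[of V] obtain d where "v $ 0 = d * v $ 0" "z * v $ 0 + v $ 1 = d * v $ 1" by auto
    then have v0: "v $ 0 = 0" using z v1 by auto
    have "v = 0\<^sub>v 2"
    proof (rule eq_vecI)
      fix i assume "i < dim_vec (0\<^sub>v 2 :: complex vec)"
      then have "i = 0 \<or> i = 1" by auto
      then show "v $ i = 0\<^sub>v 2 $ i" using v0 v1 by auto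
    qed (use v(1) in simp)
    with v(2) show False by simp
  qed
  moreover have "parabolic_rep p q (root_rep z)"
    unfolding parabolic_rep_def
  proof
    fix m assume "m \<in> meridians p q"
    then obtain a b where m: "m = word_class {relator p q} (a @ [(U, b)] @ winv a)"
      unfolding meridians_eq by blast
    let ?a = "word_m2 z a" and ?a' = "word_m2 z (winv a)" and ?u = "letter_m2 z (U, b)"
    have w: "word_m2 z (a @ [(U, b)] @ winv a) = ?a * ?u * ?a'"
      by (simp add: word_m2_append mult.assoc)
    have conj: "?a * ?u * ?a' * ?a = ?a * ?u" by (simp add: mult.assoc word_m2_winv)
    have "mtrace (root_rep z m) = 2"
      unfolding m rep mtrace_m2 w m2_trace_conj[OF word_m2_det conj, symmetric]
      by (simp add: letter_m2_def)
    moreover have "?a * ?u * ?a' \<noteq> 1"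
    proof
      assume 1: "?a * ?u * ?a' = 1"
      have "?u = 1" by (rule m2_det_cancel[OF word_m2_det, of z a]) (use conj 1 in simp)
      then have "e12 ?u = 0" by simp
      then show False using z by (simp add: letter_m2_def split: if_splits)
    qed
    ultimately show "root_rep z m \<noteq> 1\<^sub>m 2 \<and> mtrace (root_rep z m) = 2"
      unfolding m rep mat_m2_one[symmetric] mat_m2_inj w by blast
  qed
  ultimately show ?thesis by (simp add: par_reps_def)
qed

lemma SL2_inverse:
  assumes "det_m2 A = (1::complex)"
  obtains B where "A * B = 1" "B * A = 1" "det_m2 B = 1"
proof (rule that[of "M2 (e22 A) (- e12 A) (- e21 A) (e11 A)"])
qed (use assms in \<open>auto intro!: m2.expand simp: det_m2_def algebra_simps\<close>)

lemma conj_relI: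
  assumes "\<rho> \<in> par_reps p q" "\<rho>' \<in> par_reps p q" "det_m2 A = 1"
    and "\<And>a. \<rho>' (word_class {relator p q} a) * mat_m2 A = mat_m2 A * \<rho> (word_class {relator p q} a)"
  shows "(\<rho>, \<rho>') \<in> conj_rel p q"
proof -
  have "\<forall>\<gamma>\<in>carrier (knot_group p q). \<rho>' \<gamma> * mat_m2 A = mat_m2 A * \<rho> \<gamma>"
    using assms(4) by (metis knot_group_cases)
  moreover have "mat_m2 A \<in> carrier SL2" using assms(3) by (simp add: carrier_SL2)
  ultimately show ?thesis using assms(1,2) by (auto simp: conj_rel_def)
qed

lemma conj_relE:
  assumes "(\<rho>, \<rho>') \<in> conj_rel p q"
  obtains A where "\<rho> \<in> par_reps p q" "\<rho>' \<in> par_reps p q" "det_m2 A = 1"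
    "\<And>a. knot_rep.M p q \<rho>' a * A = A * knot_rep.M p q \<rho> a"
proof -
  from assms have \<rho>: "\<rho> \<in> par_reps p q" "\<rho>' \<in> par_reps p q" by (simp_all add: conj_rel_def)
  interpret \<rho>: knot_rep p q \<rho> by unfold_locales (rule \<rho>)
  interpret \<rho>': knot_rep p q \<rho>' by unfold_locales (rule \<rho>)
  from assms obtain g where g: "g \<in> carrier SL2"
    "\<And>\<gamma>. \<gamma> \<in> carrier (knot_group p q) \<Longrightarrow> \<rho>' \<gamma> * g = g * \<rho> \<gamma>"
    unfolding conj_rel_def by blast
  from g(1) obtain A where A: "g = mat_m2 A" "det_m2 A = 1" by (rule SL2_m2)
  show thesis
  proof (rule that[OF \<rho> A(2)])
    fix a
    have "mat_m2 (\<rho>'.M a * A) = mat_m2 (A * \<rho>.M a)"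
      using g(2)[OF in_carrier, of a] by (simp add: mat_m2_mult A(1) \<rho>.M \<rho>'.M)
    then show "\<rho>'.M a * A = A * \<rho>.M a" by (simp add: mat_m2_inj)
  qed
qed

lemma knot_repI: "\<rho> \<in> par_reps p q \<Longrightarrow> knot_rep p q \<rho>"
  by unfold_locales

lemma conj_relI':
  assumes \<rho>: "\<rho> \<in> par_reps p q" "\<rho>' \<in> par_reps p q" and A: "det_m2 A = 1"
    "\<And>a. knot_rep.M p q \<rho>' a * A = A * knot_rep.M p q \<rho> a"
  shows "(\<rho>, \<rho>') \<in> conj_rel p q"
proof (rule conj_relI[OF \<rho> A(1)])
  fix a
  show "\<rho>' (word_class {relator p q} a) * mat_m2 A = mat_m2 A * \<rho> (word_class {relator p q} a)"
    using A(2)[of a] by (simp add: knot_rep.M[OF knot_repI] \<rho> mat_m2_mult[symmetric])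
qed

lemma M_root_rep:
  assumes "z \<in> Z"
  shows "knot_rep.M p q (root_rep z) a = word_m2 z a"
proof -
  interpret knot_rep p q "root_rep z" by (rule knot_repI) (rule root_rep_in_par_reps[OF assms])
  show ?thesis using M[of a] by (simp add: two_bridge_root_rep[OF assms] mat_m2_inj)
qed

lemma equiv_conj_rel: "equiv (par_reps p q) (conj_rel p q)"
proof (rule equivI)
  show "conj_rel p q \<subseteq> par_reps p q \<times> par_reps p q" by (auto simp: conj_rel_def)
  show "refl_on (par_reps p q) (conj_rel p q)"
  proof (rule refl_onI)
    fix \<rho> assume "\<rho> \<in> par_reps p q"
    then show "(\<rho>, \<rho>) \<in> conj_rel p q" by (intro conj_relI'[of _ _ 1]) (simp_all add: det_m2_def)
  qed
  show "sym (conj_rel p q)"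
  proof (rule symI)
    fix \<rho> \<rho>' assume "(\<rho>, \<rho>') \<in> conj_rel p q"
    then obtain A where A: "\<rho> \<in> par_reps p q" "\<rho>' \<in> par_reps p q" "det_m2 A = 1"
      "\<And>a. knot_rep.M p q \<rho>' a * A = A * knot_rep.M p q \<rho> a" by (rule conj_relE) blast
    obtain B where B: "A * B = 1" "B * A = 1" "det_m2 B = 1" using SL2_inverse[OF A(3)] .
    show "(\<rho>', \<rho>) \<in> conj_rel p q"
    proof (rule conj_relI'[OF A(2,1) B(3)])
      fix a
      have "knot_rep.M p q \<rho> a * B = B * (A * knot_rep.M p q \<rho> a) * B"
        using B(2) by (simp add: mult.assoc[symmetric])
      also have "\<dots> = B * knot_rep.M p q \<rho>' a * (A * B)"
        unfolding A(4)[symmetric] by (simp only: mult.assoc)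
      finally show "knot_rep.M p q \<rho> a * B = B * knot_rep.M p q \<rho>' a" by (simp add: B(1))
    qed
  qed
  show "trans (conj_rel p q)"
  proof (rule transI)
    fix \<rho> \<rho>' \<rho>'' assume 1: "(\<rho>, \<rho>') \<in> conj_rel p q" and 2: "(\<rho>', \<rho>'') \<in> conj_rel p q"
    from 1 obtain A where A: "\<rho> \<in> par_reps p q" "\<rho>' \<in> par_reps p q" "det_m2 A = 1"
      "\<And>a. knot_rep.M p q \<rho>' a * A = A * knot_rep.M p q \<rho> a" by (rule conj_relE) blast
    from 2 obtain B where B: "\<rho>' \<in> par_reps p q" "\<rho>'' \<in> par_reps p q" "det_m2 B = 1"
      "\<And>a. knot_rep.M p q \<rho>'' a * B = B * knot_rep.M p q \<rho>' a" by (rule conj_relE) blast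
    show "(\<rho>, \<rho>'') \<in> conj_rel p q"
    proof (rule conj_relI'[OF A(1) B(2)])
      show "det_m2 (B * A) = 1" by (simp add: det_m2_mult A(3) B(3))
      fix a
      have "knot_rep.M p q \<rho>'' a * (B * A) = knot_rep.M p q \<rho>'' a * B * A" by (simp only: mult.assoc)
      also have "\<dots> = B * (knot_rep.M p q \<rho>' a * A)" unfolding B(4) by (simp only: mult.assoc)
      also have "\<dots> = B * A * knot_rep.M p q \<rho> a" unfolding A(4) by (simp only: mult.assoc)
      finally show "knot_rep.M p q \<rho>'' a * (B * A) = B * A * knot_rep.M p q \<rho> a" .
    qed
  qed
qed

definition point :: "complex \<Rightarrow> (word set \<Rightarrow> complex mat) set" where
  "point z = conj_rel p q `` {root_rep z}"

lemma par_char_variety_eq: "par_char_variety p q = point ` Z"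
proof (intro equalityI subsetI)
  fix \<chi> assume "\<chi> \<in> par_char_variety p q"
  then obtain \<rho> where \<rho>: "\<rho> \<in> par_reps p q" "\<chi> = conj_rel p q `` {\<rho>}"
    by (auto simp: par_char_variety_def elim: quotientE)
  interpret knot_rep p q \<rho> by (rule knot_repI) fact
  obtain A z where A: "det_m2 A = 1" "z \<in> Z" "\<And>a. M a * A = A * word_m2 z a" by (rule normal_form) blast
  have "(root_rep z, \<rho>) \<in> conj_rel p q"
    by (rule conj_relI'[OF root_rep_in_par_reps[OF A(2)] \<rho>(1) A(1)]) (simp add: M_root_rep A(2,3))
  then have "\<chi> = point z"
    unfolding \<rho>(2) point_def by (rule equiv_class_eq[OF equiv_conj_rel, symmetric])
  with A(2) show "\<chi> \<in> point ` Z" by blast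
next
  fix \<chi> assume "\<chi> \<in> point ` Z"
  then obtain z where "z \<in> Z" "\<chi> = conj_rel p q `` {root_rep z}" by (auto simp: point_def)
  then show "\<chi> \<in> par_char_variety p q"
    unfolding par_char_variety_def by (simp add: quotientI root_rep_in_par_reps)
qed

lemma eps_rec_uminus: "eps_rec p q (- x) 0 1 (Suc k) = (- 1) ^ k * eps_rec p q x 0 (1::'a::comm_ring_1) (Suc k)"
proof -
  have "eps_rec p q (- x) 0 1 k = - ((- 1) ^ k * eps_rec p q x 0 1 k) \<and>
    eps_rec p q (- x) 0 1 (Suc k) = (- 1) ^ k * eps_rec p q x 0 1 (Suc k)"
    by (induction k) (simp_all add: algebra_simps)
  then show ?thesis ..
qed

lemma Z_uminus: "z \<in> Z \<Longrightarrow> - z \<in> Z"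
  using eps_rec_uminus[of z "p - 1"] p0 by (simp add: Z_def)

lemma point_uminus:
  assumes "z \<in> Z"
  shows "point (- z) = point z"
proof -
  let ?g = "M2 \<i> 0 0 (- \<i>)"
  have l: "letter_m2 (- z) l * ?g = ?g * letter_m2 z l" for l
    by (cases "fst l"; rule m2.expand) (simp_all add: letter_m2_def)
  have w: "word_m2 (- z) a * ?g = ?g * word_m2 z a" for a
  proof (induction a)
    case Nil
    show ?case by simp
  next
    case (Cons x a)
    have "word_m2 (- z) (x # a) * ?g = letter_m2 (- z) x * (word_m2 (- z) a * ?g)" by (simp add: mult.assoc)
    also have "\<dots> = letter_m2 (- z) x * ?g * word_m2 z a" unfolding Cons by (simp only: mult.assoc)
    also have "\<dots> = ?g * word_m2 z (x # a)" unfolding l by (simp add: mult.assoc)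
    finally show ?case .
  qed
  have "(root_rep z, root_rep (- z)) \<in> conj_rel p q"
    using root_rep_in_par_reps[OF assms] root_rep_in_par_reps[OF Z_uminus[OF assms]]
  proof (rule conj_relI')
    show "det_m2 ?g = 1" by (simp add: det_m2_def)
    show "knot_rep.M p q (root_rep (- z)) a * ?g = ?g * knot_rep.M p q (root_rep z) a" for a
      unfolding M_root_rep[OF assms] M_root_rep[OF Z_uminus[OF assms]] by (rule w)
  qed
  then show ?thesis
    unfolding point_def by (rule equiv_class_eq[OF equiv_conj_rel, symmetric])
qed

text \<open>The trace \<open>2 + z\<^sup>2\<close> of \<open>u v\<close> determines the root up to sign.\<close>

lemma gives_point_sq:
  assumes "z \<in> Z" "gives_point p q z' (point z)"
  shows "z' \<in> Z \<and> (z' = z \<or> z' = - z)"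
proof -
  have z': "z' \<in> Z" using assms(2) by (simp add: gives_point_def Z_ev ev_def)
  obtain \<rho> where \<rho>: "(root_rep z, \<rho>) \<in> conj_rel p q" "\<And>g. \<rho> (gen_elem p q g) = gen_mat z' g"
    using assms(2) by (auto simp: gives_point_def point_def)
  from \<rho>(1) obtain A where A: "\<rho> \<in> par_reps p q" "det_m2 A = 1"
    "\<And>a. knot_rep.M p q \<rho> a * A = A * knot_rep.M p q (root_rep z) a" by (rule conj_relE) blast
  interpret knot_rep p q \<rho> by (rule knot_repI) fact
  have g: "M [(g, True)] = gen_m2 z' g" for g
    using \<rho>(2)[of g] by (simp add: gen_elem_def M gen_mat_m2 mat_m2_inj)
  let ?w = "[(U, True)] @ [(V, True)]"
  have "M ?w * A = A * word_m2 z ?w" using A(3)[of ?w] unfolding M_root_rep[OF assms(1)] .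
  then have "e11 (word_m2 z ?w) + e22 (word_m2 z ?w) = e11 (M ?w) + e22 (M ?w)"
    by (rule m2_trace_conj[OF A(2)])
  also have "M ?w = gen_m2 z' U * gen_m2 z' V" unfolding M_append g ..
  also have "word_m2 z ?w = gen_m2 z U * gen_m2 z V" by (simp add: letter_m2_def)
  finally have "z * z = z' * z'" by simp
  then have "z' = z \<or> z' = - z" by (metis square_eq_iff)
  with z' show ?thesis by simp
qed

lemma gives_point: 
  assumes "z \<in> Z"
  shows "gives_point p q z (point z)"
proof -
  have "root_rep z \<in> point z"
    unfolding point_def by (rule equiv_class_self[OF equiv_conj_rel root_rep_in_par_reps[OF assms]])
  moreover have "root_rep z (gen_elem p q g) = gen_mat z g" for g
    by (simp add: gen_elem_def two_bridge_root_rep[OF assms] gen_mat_m2 letter_m2_def)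
  moreover have "poly (map_poly of_rat (Vmod p q)) z = 0" using assms by (simp add: Z_ev ev_def)
  ultimately show ?thesis unfolding gives_point_def by blast
qed

lemma point_eq_iff:
  assumes "z \<in> Z" "z' \<in> Z"
  shows "point z' = point z \<longleftrightarrow> z' = z \<or> z' = - z"
  using gives_point[OF assms(2)] gives_point_sq[OF assms(1)] point_uminus[OF assms(1)] by metis

lemma sum_par_char_variety:
  assumes "\<And>z. z \<in> Z \<Longrightarrow> 1 / ev z t = f z" and "\<And>z. z \<in> Z \<Longrightarrow> f (- z) = f z"
  shows "(\<Sum>\<chi>\<in>par_char_variety p q. 1 / value_at p q t \<chi>) = (\<Sum>z\<in>Z. f z) / 2"
proof -
  have v: "1 / value_at p q t (point z) = f z" if z: "z \<in> Z" for z
  proof -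
    have "gives_point p q (SOME z'. gives_point p q z' (point z)) (point z)"
      by (rule someI) (rule gives_point[OF z])
    from gives_point_sq[OF z this] show ?thesis
      using assms z by (auto simp: value_at_def simp flip: ev_def)
  qed
  have "(\<Sum>z\<in>Z. f z) = (\<Sum>\<chi>\<in>point ` Z. \<Sum>z | z \<in> Z \<and> point z = \<chi>. f z)"
    using finite_Z by (rule sum.image_gen)
  also have "\<dots> = (\<Sum>\<chi>\<in>point ` Z. 2 * (1 / value_at p q t \<chi>))"
  proof (rule sum.cong[OF refl])
    fix \<chi> assume "\<chi> \<in> point ` Z"
    then obtain z where z: "z \<in> Z" "\<chi> = point z" by blast
    have "{z' \<in> Z. point z' = \<chi>} = {z, - z}"
      using z point_eq_iff[OF z(1)] Z_uminus[OF z(1)] by auto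
    moreover have "z \<noteq> - z" using parabolic_root.z_nz[OF Z_root[OF z(1)]] by simp
    ultimately show "(\<Sum>z' | z' \<in> Z \<and> point z' = \<chi>. f z') = 2 * (1 / value_at p q t \<chi>)"
      using v[OF z(1)] assms(2)[OF z(1)] z(2) by simp
  qed
  finally show ?thesis unfolding par_char_variety_eq sum_distrib_left[symmetric] by simp
qed

lemma R_uminus_root: "parabolic_root.R p q (- z) i = - altsgn i * parabolic_root.R p q z i"
  if z: "z \<in> Z"
proof -
  interpret z: parabolic_root p q z by (rule Z_root[OF z])
  interpret mz: parabolic_root p q "- z" by (rule Z_root[OF Z_uminus[OF z]])
  show ?thesis
  proof (cases "nat \<bar>i\<bar>")
    case 0
    then show ?thesis by simp
  next
    case (Suc k)
    have "altsgn i = - ((- 1) ^ k)"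
    proof -
      have "even i \<longleftrightarrow> even (nat \<bar>i\<bar>)" by (simp add: even_nat_iff)
      then have "even i \<longleftrightarrow> odd k" using Suc by simp
      then show ?thesis by (simp add: altsgn_def)
    qed
    then show ?thesis
      using eps_rec_uminus[of z k] by (simp add: z.R_def mz.R_def Suc)
  qed
qed

lemma uminus_root:
  assumes z: "z \<in> Z"
  shows "parabolic_root.j p q (- z) = - parabolic_root.j p q z"
    and "parabolic_root.R p q (- z) n = - parabolic_root.R p q z n"
    and "parabolic_root.dP p q (- z) = - parabolic_root.dP p q z"
proof -
  interpret z: parabolic_root p q z by (rule Z_root[OF z])
  interpret mz: parabolic_root p q "- z" by (rule Z_root[OF Z_uminus[OF z]])
  have "even (int p - 1)" using op by simp
  then have "altsgn (int p - 1) = 1" by (simp add: altsgn_def)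
  then show j: "mz.j = - z.j" using R_uminus_root[OF z, of "int p - 1"] by (simp add: z.j_def mz.j_def)
  have "altsgn n = 1" using n_props(1) by (simp add: altsgn_def)
  then show "mz.R n = - z.R n" using R_uminus_root[OF z, of n] by simp
  have a: "altsgn i * altsgn i = 1" for i by (simp add: altsgn_def)
  have "(mz.R i)\<^sup>2 = (z.R i)\<^sup>2" for i
  proof -
    have "(mz.R i)\<^sup>2 = (altsgn i * altsgn i) * (z.R i)\<^sup>2"
      unfolding R_uminus_root[OF z] by (simp add: power2_eq_square mult_ac)
    then show ?thesis by (simp add: a)
  qed
  then have "mz.dP * mz.j = z.dP * z.j" unfolding mz.dP_mult_j z.dP_mult_j by simp
  then have "- mz.dP * z.j = z.dP * z.j" using j by simp
  then have "- mz.dP = z.dP" using z.j_nz by (metis mult_right_cancel)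
  then show "mz.dP = - z.dP" unfolding minus_equation_iff[of mz.dP] by (rule sym)
qed

end

theorem theorem2:
  fixes p q :: nat
  assumes "0 < q" and "q < p" and "coprime p q" and "odd p" and "odd q" and "q \<noteq> 1"
  shows "(\<Sum>\<chi> \<in> par_char_variety p q. 1 / value_at p q (tau1 p q) \<chi>) \<in> {1, - 1} \<and>
    (\<Sum>\<chi> \<in> par_char_variety p q. 1 / value_at p q (tau2 p q) \<chi>) = 0"
proof
  interpret two_bridge' p q using assms by unfold_locales
  define f where "f z = parabolic_root.j p q z * z\<^sup>2 * parabolic_root.R p q z n" for z
  define g where "g z = parabolic_root.j p q z * z\<^sup>2 * (parabolic_root.R p q z n)\<^sup>2 / parabolic_root.dP p q z" for z
  obtain s :: complex where s: "s \<in> {1, - 1}" "\<And>z. z \<in> Z \<Longrightarrow> 1 / ev z (tau1 p q) = s * f z / 2"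
    unfolding f_def by (rule tau1_value) blast
  obtain t :: complex where t: "t \<in> {1, - 1}" "\<And>z. z \<in> Z \<Longrightarrow> 1 / ev z (tau2 p q) = t * 4 * g z"
    unfolding g_def by (rule tau2_value) blast
  have "(\<Sum>\<chi>\<in>par_char_variety p q. 1 / value_at p q (tau1 p q) \<chi>) = (\<Sum>z\<in>Z. s * f z / 2) / 2"
    by (rule sum_par_char_variety[OF s(2)]) (simp_all add: f_def uminus_root)
  also have "\<dots> = s * (\<Sum>z\<in>Z. f z) / 4" by (simp add: sum_distrib_left sum_divide_distrib)
  finally show "(\<Sum>\<chi>\<in>par_char_variety p q. 1 / value_at p q (tau1 p q) \<chi>) \<in> {1, - 1}"
    using sum_tautological s(1) unfolding f_def[symmetric] by auto
  have "(\<Sum>\<chi>\<in>par_char_variety p q. 1 / value_at p q (tau2 p q) \<chi>) = (\<Sum>z\<in>Z. t * 4 * g z) / 2"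
    by (rule sum_par_char_variety[OF t(2)]) (simp_all add: g_def uminus_root)
  also have "\<dots> = t * 4 * (\<Sum>z\<in>Z. g z) / 2" by (simp add: sum_distrib_left)
  finally show "(\<Sum>\<chi>\<in>par_char_variety p q. 1 / value_at p q (tau2 p q) \<chi>) = 0"
    using sum_adjoint by (simp add: g_def)
qed

end
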